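(* Let $\Bbbk$ be a commutative ring and let $(L,\circ)$ be a pre-Lie algebra over $\Bbbk$. Then the Hopf algebra $(S(L),*,\Delta)$ is isomorphic (as a Hopf algebra) to the enveloping algebra $\mathcal U(L_{Lie})$ of the Lie algebra $L_{Lie}$.
   Context: $\Bbbk$ is a fixed commutative ring; modules, algebras, tensor products and linear maps are over $\Bbbk$. A pre-Lie algebra is a $\Bbbk$-module $L$ with a bilinear product $\circ$ satisfying $X\circ (Y\circ Z)-(X\circ Y)\circ Z = X\circ (Z\circ Y)-(X\circ Z)\circ Y$ for all $X,Y,Z\in L$. The bracket $[X,Y]=X\circ Y-Y\circ X$ makes $L$ a Lie algebra, denoted $L_{Lie}$. $S(L)$ is the symmetric algebra of $L$ with its usual (shuffle) coproduct $\Delta$, i.e. the algebra morphism for the usual product with $\Delta(X)=X\otimes 1+1\otimes X$ for $X\in L$; $\varepsilon$ is its counit. Sweedler notation: $\Delta(A)=A_{(1)}\otimes A_{(2)}$. The usual commutative product of $S(L)$ is written by juxtaposition. The product $\circ$ of $L$ extends uniquely to a bilinear product $\circ$ on $S(L)$ such that, for all $A,B,C\in S(L)$ and $T,X\in L$: (i) $A\circ 1=A$; (ii) $T\circ (BX)=(T\circ B)\circ X-T\circ(B\circ X)$; (iii) $(AB)\circ C=(A\circ C_{(1)})(B\circ C_{(2)})$. The product $*$ on $S(L)$ is defined by $A*B:=(A\circ B_{(1)})B_{(2)}$; it is associative with unit $1$, and $(S(L),*,\Delta)$ is a Hopf algebra. The enveloping algebra $\mathcal U(L_{Lie})$ carries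 its usual Hopf algebra structure, in which elements of $L$ are primitive. *)

theory Defs
  imports "HOL-Algebra.Module" "HOL-Algebra.QuotRing"
begin

section \<open>Linear maps and associative algebras\<close>

definition linear_map ::
  "('r, 'm) ring_scheme \<Rightarrow> ('r, 'a, 'n) module_scheme \<Rightarrow> ('r, 'b, 'p) module_scheme
    \<Rightarrow> ('a \<Rightarrow> 'b) \<Rightarrow> bool" where
  "linear_map R M N f \<longleftrightarrow>
     f \<in> carrier M \<rightarrow> carrier N \<and>
     (\<forall>x\<in>carrier M. \<forall>y\<in>carrier M. f (x \<oplus>\<^bsub>M\<^esub> y) = f x \<oplus>\<^bsub>N\<^esub> f y) \<and>
     (\<forall>r\<in>carrier R. \<forall>x\<in>carrier M. f (r \<odot>\<^bsub>M\<^esub> x) = r \<odot>\<^bsub>N\<^esub> f x)"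

definition bilinear_map ::
  "('r, 'm) ring_scheme \<Rightarrow> ('r, 'a, 'n) module_scheme \<Rightarrow> ('r, 'b, 'p) module_scheme
    \<Rightarrow> ('r, 'c, 'q) module_scheme \<Rightarrow> ('a \<Rightarrow> 'b \<Rightarrow> 'c) \<Rightarrow> bool" where
  "bilinear_map R M N P \<beta> \<longleftrightarrow>
     (\<forall>x\<in>carrier M. linear_map R N P (\<beta> x)) \<and>
     (\<forall>y\<in>carrier N. linear_map R M P (\<lambda>x. \<beta> x y))"

text \<open>The library locale \<^locale>\<open>algebra\<close> is restricted to commutative algebras.\<close>

locale assoc_algebra = module R A + ring A for R (structure) and A (structure) +
  assumes smult_mult_left:
      "\<lbrakk>r \<in> carrier R; x \<in> carrier A; y \<in> carrier A\<rbrakk>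
        \<Longrightarrow> (r \<odot>\<^bsub>A\<^esub> x) \<otimes>\<^bsub>A\<^esub> y = r \<odot>\<^bsub>A\<^esub> (x \<otimes>\<^bsub>A\<^esub> y)"
    and smult_mult_right:
      "\<lbrakk>r \<in> carrier R; x \<in> carrier A; y \<in> carrier A\<rbrakk>
        \<Longrightarrow> x \<otimes>\<^bsub>A\<^esub> (r \<odot>\<^bsub>A\<^esub> y) = r \<odot>\<^bsub>A\<^esub> (x \<otimes>\<^bsub>A\<^esub> y)"

definition alg_hom ::
  "('r, 'm) ring_scheme \<Rightarrow> ('r, 'a, 'n) module_scheme \<Rightarrow> ('r, 'b, 'p) module_scheme
    \<Rightarrow> ('a \<Rightarrow> 'b) \<Rightarrow> bool" where
  "alg_hom R A B f \<longleftrightarrow> f \<in> ring_hom A B \<and> linear_map R A B f"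

definition base_algebra :: "('r, 'm) ring_scheme \<Rightarrow> ('r, 'r) module" where
  "base_algebra R =
     \<lparr>carrier = carrier R, mult = mult R, one = one R, zero = zero R, add = add R,
      smult = mult R\<rparr>"


section \<open>Free modules, free algebras and quotients\<close>

text \<open>The free module on a set \<open>B\<close> consists of the finitely supported functions from \<open>B\<close>
  to \<open>R\<close>, extended by zero. The ring operations \<^const>\<open>mult\<close> and \<^const>\<open>one\<close>
  of the record play no role in a module.\<close>

definition free_module :: "('r, 'm) ring_scheme \<Rightarrow> 'b set \<Rightarrow> ('r, 'b \<Rightarrow> 'r) module" where
  "free_module R B =
     \<lparr>carrier = {f. (\<forall>b. f b \<in> carrier R) \<and> finite {b. f b \<noteq> \<zero>\<^bsub>R\<^esub>} \<and> {b. f b \<noteq> \<zero>\<^bsub>R\<^esub>} \<subseteq> B},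
      mult = undefined, one = undefined,
      zero = (\<lambda>b. \<zero>\<^bsub>R\<^esub>), add = (\<lambda>f g b. f b \<oplus>\<^bsub>R\<^esub> g b),
      smult = (\<lambda>r f b. r \<otimes>\<^bsub>R\<^esub> f b)\<rparr>"

definition basis_elem :: "('r, 'm) ring_scheme \<Rightarrow> 'b \<Rightarrow> 'b \<Rightarrow> 'r" where
  "basis_elem R b = (\<lambda>c. if c = b then \<one>\<^bsub>R\<^esub> else \<zero>\<^bsub>R\<^esub>)"

text \<open>Noncommutative polynomials in the variables \<open>B\<close>: the free module on the words over \<open>B\<close>,
  with the bilinear extension of concatenation as product.\<close>

definition free_algebra :: "('r, 'm) ring_scheme \<Rightarrow> 'b set \<Rightarrow> ('r, 'b list \<Rightarrow> 'r) module" where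
  "free_algebra R B = (free_module R (lists B))
     \<lparr>mult := (\<lambda>f g w. \<Oplus>\<^bsub>R\<^esub>i\<in>{..length w}. f (take i w) \<otimes>\<^bsub>R\<^esub> g (drop i w)),
      one := basis_elem R []\<rparr>"

text \<open>Scalar multiplication of a coset: all cosets in the union coincide when \<open>I\<close> is a submodule.
  Every two-sided ideal of an associative unital algebra is one.\<close>

definition quotient_by ::
  "('r, 'a, 'n) module_scheme \<Rightarrow> 'a set \<Rightarrow> ('r, 'a set) module" where
  "quotient_by A I =
     \<lparr>carrier = carrier (A Quot I), mult = mult (A Quot I), one = one (A Quot I),
      zero = zero (A Quot I), add = add (A Quot I),
      smult = (\<lambda>r X. \<Union>x\<in>X. I +>\<^bsub>A\<^esub> (r \<odot>\<^bsub>A\<^esub> x))\<rparr>"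

definition gen_submodule ::
  "('r, 'm) ring_scheme \<Rightarrow> ('r, 'a, 'n) module_scheme \<Rightarrow> 'a set \<Rightarrow> 'a set" where
  "gen_submodule R M X = \<Inter>{N. submodule N R M \<and> X \<subseteq> N}"


section \<open>Tensor products\<close>

definition tensor_relations ::
  "('r, 'm) ring_scheme \<Rightarrow> ('r, 'a, 'n) module_scheme \<Rightarrow> ('r, 'b, 'p) module_scheme
    \<Rightarrow> ('a \<times> 'b \<Rightarrow> 'r) set" where
  "tensor_relations R M N =
     (let F = free_module R (carrier M \<times> carrier N); e = (\<lambda>x y. basis_elem R (x, y)) in
      {e (x \<oplus>\<^bsub>M\<^esub> x') y \<ominus>\<^bsub>F\<^esub> (e x y \<oplus>\<^bsub>F\<^esub> e x' y) | x x' y.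
         x \<in> carrier M \<and> x' \<in> carrier M \<and> y \<in> carrier N} \<union>
      {e x (y \<oplus>\<^bsub>N\<^esub> y') \<ominus>\<^bsub>F\<^esub> (e x y \<oplus>\<^bsub>F\<^esub> e x y') | x y y'.
         x \<in> carrier M \<and> y \<in> carrier N \<and> y' \<in> carrier N} \<union>
      {e (r \<odot>\<^bsub>M\<^esub> x) y \<ominus>\<^bsub>F\<^esub> r \<odot>\<^bsub>F\<^esub> e x y | r x y.
         r \<in> carrier R \<and> x \<in> carrier M \<and> y \<in> carrier N} \<union>
      {e x (r \<odot>\<^bsub>N\<^esub> y) \<ominus>\<^bsub>F\<^esub> r \<odot>\<^bsub>F\<^esub> e x y | r x y.
         r \<in> carrier R \<and> x \<in> carrier M \<and> y \<in> carrier N})"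

definition tensor_kernel ::
  "('r, 'm) ring_scheme \<Rightarrow> ('r, 'a, 'n) module_scheme \<Rightarrow> ('r, 'b, 'p) module_scheme
    \<Rightarrow> ('a \<times> 'b \<Rightarrow> 'r) set" where
  "tensor_kernel R M N =
     gen_submodule R (free_module R (carrier M \<times> carrier N)) (tensor_relations R M N)"

definition tensor_module ::
  "('r, 'm) ring_scheme \<Rightarrow> ('r, 'a, 'n) module_scheme \<Rightarrow> ('r, 'b, 'p) module_scheme
    \<Rightarrow> ('r, ('a \<times> 'b \<Rightarrow> 'r) set) module" where
  "tensor_module R M N =
     quotient_by (free_module R (carrier M \<times> carrier N)) (tensor_kernel R M N)"

definition tensor ::
  "('r, 'm) ring_scheme \<Rightarrow> ('r, 'a, 'n) module_scheme \<Rightarrow> ('r, 'b, 'p) module_scheme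
    \<Rightarrow> 'a \<Rightarrow> 'b \<Rightarrow> ('a \<times> 'b \<Rightarrow> 'r) set" where
  "tensor R M N x y =
     tensor_kernel R M N +>\<^bsub>free_module R (carrier M \<times> carrier N)\<^esub> basis_elem R (x, y)"

text \<open>The linear map on a tensor product induced by a bilinear map \<open>\<beta>\<close> with values in \<open>P\<close>:
  on the class of \<open>\<Sum> f(x,y) (x,y)\<close> its value is \<open>\<Sum> f(x,y) \<beta>(x,y)\<close>, which does not depend on
  the representative \<open>f\<close> because \<open>\<beta>\<close> is bilinear. Sweedler notation is rendered by this:
  an expression \<open>\<beta>(A\<^sub>(\<^sub>1\<^sub>), A\<^sub>(\<^sub>2\<^sub>))\<close> is \<open>tensor_lift R P \<beta> (\<Delta> A)\<close>.\<close>

definition tensor_lift ::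
  "('r, 'm) ring_scheme \<Rightarrow> ('r, 'c, 'n) module_scheme \<Rightarrow> ('a \<Rightarrow> 'b \<Rightarrow> 'c)
    \<Rightarrow> ('a \<times> 'b \<Rightarrow> 'r) set \<Rightarrow> 'c" where
  "tensor_lift R P \<beta> X =
     (let f = (SOME f. f \<in> X) in
      \<Oplus>\<^bsub>P\<^esub>p\<in>{p. f p \<noteq> \<zero>\<^bsub>R\<^esub>}. f p \<odot>\<^bsub>P\<^esub> \<beta> (fst p) (snd p))"

definition tensor_product_algebra ::
  "('r, 'm) ring_scheme \<Rightarrow> ('r, 'a, 'n) module_scheme \<Rightarrow> ('r, 'b, 'p) module_scheme
    \<Rightarrow> ('r, ('a \<times> 'b \<Rightarrow> 'r) set) module" where
  "tensor_product_algebra R A B = (tensor_module R A B)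
     \<lparr>mult := (\<lambda>s t.
        tensor_lift R (tensor_module R A B) (\<lambda>a b.
          tensor_lift R (tensor_module R A B) (\<lambda>c d.
            tensor R A B (a \<otimes>\<^bsub>A\<^esub> c) (b \<otimes>\<^bsub>B\<^esub> d)) t) s),
      one := tensor R A B \<one>\<^bsub>A\<^esub> \<one>\<^bsub>B\<^esub>\<rparr>"


section \<open>Hopf algebras\<close>

record ('r, 'a) hopf = "('r, 'a) module" +
  comult :: "'a \<Rightarrow> ('a \<times> 'a \<Rightarrow> 'r) set"
  counit :: "'a \<Rightarrow> 'r"

text \<open>The antipode of a Hopf algebra is unique, so it is required to exist rather than being a
  component of the record. Likewise, bialgebra maps between Hopf algebras automatically preserve it.\<close>

locale hopf_algebra = assoc_algebra R H for R (structure) and H (structure) +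
  assumes comult_alg_hom: "alg_hom R H (tensor_product_algebra R H H) (comult H)"
    and counit_alg_hom: "alg_hom R H (base_algebra R) (counit H)"
    and coassoc: "x \<in> carrier H \<Longrightarrow>
      tensor_lift R (tensor_module R (tensor_module R H H) H)
        (\<lambda>a b. tensor R (tensor_module R H H) H (comult H a) b) (comult H x) =
      tensor_lift R (tensor_module R (tensor_module R H H) H)
        (\<lambda>a b. tensor_lift R (tensor_module R (tensor_module R H H) H)
          (\<lambda>c d. tensor R (tensor_module R H H) H (tensor R H H a c) d) (comult H b))
        (comult H x)"
    and counit_left: "x \<in> carrier H \<Longrightarrow>
      tensor_lift R H (\<lambda>a b. counit H a \<odot>\<^bsub>H\<^esub> b) (comult H x) = x"
    and counit_right: "x \<in> carrier H \<Longrightarrow>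
      tensor_lift R H (\<lambda>a b. counit H b \<odot>\<^bsub>H\<^esub> a) (comult H x) = x"
    and antipode: "\<exists>S. linear_map R H H S \<and>
      (\<forall>x\<in>carrier H.
        tensor_lift R H (\<lambda>a b. S a \<otimes>\<^bsub>H\<^esub> b) (comult H x) = counit H x \<odot>\<^bsub>H\<^esub> \<one>\<^bsub>H\<^esub> \<and>
        tensor_lift R H (\<lambda>a b. a \<otimes>\<^bsub>H\<^esub> S b) (comult H x) = counit H x \<odot>\<^bsub>H\<^esub> \<one>\<^bsub>H\<^esub>)"

definition hopf_iso ::
  "('r, 'm) ring_scheme \<Rightarrow> ('r, 'a, 'n) hopf_scheme \<Rightarrow> ('r, 'b, 'p) hopf_scheme
    \<Rightarrow> ('a \<Rightarrow> 'b) \<Rightarrow> bool" where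
  "hopf_iso R H K f \<longleftrightarrow>
     alg_hom R H K f \<and> bij_betw f (carrier H) (carrier K) \<and>
     (\<forall>x\<in>carrier H. comult K (f x) =
        tensor_lift R (tensor_module R K K) (\<lambda>a b. tensor R K K (f a) (f b)) (comult H x)) \<and>
     (\<forall>x\<in>carrier H. counit K (f x) = counit H x)"

definition hopf_isomorphic ::
  "('r, 'm) ring_scheme \<Rightarrow> ('r, 'a, 'n) hopf_scheme \<Rightarrow> ('r, 'b, 'p) hopf_scheme \<Rightarrow> bool" where
  "hopf_isomorphic R H K \<longleftrightarrow>
     hopf_algebra R H \<and> hopf_algebra R K \<and> (\<exists>f. hopf_iso R H K f)"


section \<open>Tensor, symmetric and enveloping algebras\<close>

definition linearity_relations ::
  "('r, 'm) ring_scheme \<Rightarrow> ('r, 'a, 'n) module_scheme \<Rightarrow> ('a list \<Rightarrow> 'r) set" where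
  "linearity_relations R L =
     (let F = free_algebra R (carrier L); e = (\<lambda>x. basis_elem R [x]) in
      {e (x \<oplus>\<^bsub>L\<^esub> y) \<ominus>\<^bsub>F\<^esub> (e x \<oplus>\<^bsub>F\<^esub> e y) | x y. x \<in> carrier L \<and> y \<in> carrier L} \<union>
      {e (r \<odot>\<^bsub>L\<^esub> x) \<ominus>\<^bsub>F\<^esub> r \<odot>\<^bsub>F\<^esub> e x | r x. r \<in> carrier R \<and> x \<in> carrier L})"

text \<open>The tensor algebra \<open>T(L)\<close>, as the free algebra on the set \<open>L\<close> modulo linearity of the
  inclusion of the generators.\<close>

definition tensor_algebra ::
  "('r, 'm) ring_scheme \<Rightarrow> ('r, 'a, 'n) module_scheme
    \<Rightarrow> ('r, ('a list \<Rightarrow> 'r) set) module" where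
  "tensor_algebra R L =
     quotient_by (free_algebra R (carrier L)) (Idl\<^bsub>free_algebra R (carrier L)\<^esub> (linearity_relations R L))"

definition tensor_gen ::
  "('r, 'm) ring_scheme \<Rightarrow> ('r, 'a, 'n) module_scheme \<Rightarrow> 'a \<Rightarrow> ('a list \<Rightarrow> 'r) set" where
  "tensor_gen R L x =
     Idl\<^bsub>free_algebra R (carrier L)\<^esub> (linearity_relations R L)
       +>\<^bsub>free_algebra R (carrier L)\<^esub> basis_elem R [x]"

text \<open>\<open>T(L)\<close> modulo the ideal generated by all \<open>x y - y x - [x, y]\<close>.\<close>

definition enveloping_ideal ::
  "('r, 'm) ring_scheme \<Rightarrow> ('r, 'a, 'n) module_scheme \<Rightarrow> ('a \<Rightarrow> 'a \<Rightarrow> 'a)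
    \<Rightarrow> ('a list \<Rightarrow> 'r) set set" where
  "enveloping_ideal R L br =
     (let T = tensor_algebra R L; \<iota> = tensor_gen R L in
      Idl\<^bsub>T\<^esub> {(\<iota> x \<otimes>\<^bsub>T\<^esub> \<iota> y \<ominus>\<^bsub>T\<^esub> \<iota> y \<otimes>\<^bsub>T\<^esub> \<iota> x) \<ominus>\<^bsub>T\<^esub> \<iota> (br x y) | x y.
               x \<in> carrier L \<and> y \<in> carrier L})"

definition enveloping_algebra ::
  "('r, 'm) ring_scheme \<Rightarrow> ('r, 'a, 'n) module_scheme \<Rightarrow> ('a \<Rightarrow> 'a \<Rightarrow> 'a)
    \<Rightarrow> ('r, ('a list \<Rightarrow> 'r) set set) module" where
  "enveloping_algebra R L br = quotient_by (tensor_algebra R L) (enveloping_ideal R L br)"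

definition enveloping_gen ::
  "('r, 'm) ring_scheme \<Rightarrow> ('r, 'a, 'n) module_scheme \<Rightarrow> ('a \<Rightarrow> 'a \<Rightarrow> 'a)
    \<Rightarrow> 'a \<Rightarrow> ('a list \<Rightarrow> 'r) set set" where
  "enveloping_gen R L br x = enveloping_ideal R L br +>\<^bsub>tensor_algebra R L\<^esub> tensor_gen R L x"

definition symmetric_ideal ::
  "('r, 'm) ring_scheme \<Rightarrow> ('r, 'a, 'n) module_scheme \<Rightarrow> ('a list \<Rightarrow> 'r) set set" where
  "symmetric_ideal R L =
     (let T = tensor_algebra R L; \<iota> = tensor_gen R L in
      Idl\<^bsub>T\<^esub> {\<iota> x \<otimes>\<^bsub>T\<^esub> \<iota> y \<ominus>\<^bsub>T\<^esub> \<iota> y \<otimes>\<^bsub>T\<^esub> \<iota> x | x y. x \<in> carrier L \<and> y \<in> carrier L})"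

definition symmetric_algebra ::
  "('r, 'm) ring_scheme \<Rightarrow> ('r, 'a, 'n) module_scheme
    \<Rightarrow> ('r, ('a list \<Rightarrow> 'r) set set) module" where
  "symmetric_algebra R L = quotient_by (tensor_algebra R L) (symmetric_ideal R L)"

definition symmetric_gen ::
  "('r, 'm) ring_scheme \<Rightarrow> ('r, 'a, 'n) module_scheme \<Rightarrow> 'a \<Rightarrow> ('a list \<Rightarrow> 'r) set set" where
  "symmetric_gen R L x = symmetric_ideal R L +>\<^bsub>tensor_algebra R L\<^esub> tensor_gen R L x"

text \<open>The algebra morphism from \<open>A\<close> to \<open>B\<close> with prescribed values on the generators \<open>\<iota> x\<close>
  (\<open>x\<close> in \<open>L\<close>). It is determined on the carrier of \<open>A\<close> because it is only used for
  algebras \<open>A\<close> generated by these elements.\<close>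

definition hom_on_gens ::
  "('r, 'm) ring_scheme \<Rightarrow> ('r, 'l, 'n) module_scheme \<Rightarrow> ('r, 'a, 'p) module_scheme
    \<Rightarrow> ('r, 'b, 'q) module_scheme \<Rightarrow> ('l \<Rightarrow> 'a) \<Rightarrow> ('l \<Rightarrow> 'b) \<Rightarrow> 'a \<Rightarrow> 'b" where
  "hom_on_gens R L A B \<iota> \<phi> =
     (SOME f. alg_hom R A B f \<and> (\<forall>x\<in>carrier L. f (\<iota> x) = \<phi> x))"

text \<open>The Hopf structure on \<open>A\<close> in which the generators \<open>\<iota> x\<close> are primitive.\<close>

definition primitive_hopf ::
  "('r, 'm) ring_scheme \<Rightarrow> ('r, 'l, 'n) module_scheme \<Rightarrow> ('r, 'a, 'p) module_scheme
    \<Rightarrow> ('l \<Rightarrow> 'a) \<Rightarrow> ('r, 'a) hopf" where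
  "primitive_hopf R L A \<iota> =
     \<lparr>carrier = carrier A, mult = mult A, one = one A, zero = zero A, add = add A, smult = smult A,
      comult = hom_on_gens R L A (tensor_product_algebra R A A) \<iota>
        (\<lambda>x. tensor R A A (\<iota> x) \<one>\<^bsub>A\<^esub> \<oplus>\<^bsub>tensor_product_algebra R A A\<^esub> tensor R A A \<one>\<^bsub>A\<^esub> (\<iota> x)),
      counit = hom_on_gens R L A (base_algebra R) \<iota> (\<lambda>x. \<zero>\<^bsub>R\<^esub>)\<rparr>"

definition symmetric_hopf ::
  "('r, 'm) ring_scheme \<Rightarrow> ('r, 'a, 'n) module_scheme
    \<Rightarrow> ('r, ('a list \<Rightarrow> 'r) set set) hopf" where
  "symmetric_hopf R L = primitive_hopf R L (symmetric_algebra R L) (symmetric_gen R L)"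

definition enveloping_hopf ::
  "('r, 'm) ring_scheme \<Rightarrow> ('r, 'a, 'n) module_scheme \<Rightarrow> ('a \<Rightarrow> 'a \<Rightarrow> 'a)
    \<Rightarrow> ('r, ('a list \<Rightarrow> 'r) set set) hopf" where
  "enveloping_hopf R L br = primitive_hopf R L (enveloping_algebra R L br) (enveloping_gen R L br)"


section \<open>Pre-Lie algebras\<close>

locale pre_lie_algebra = module R L for R (structure) and L (structure) +
  fixes pl :: "'c \<Rightarrow> 'c \<Rightarrow> 'c" (infixl \<open>\<star>\<close> 70)
  assumes pl_bilinear: "bilinear_map R L L L pl"
    and pre_lie: "\<lbrakk>x \<in> carrier L; y \<in> carrier L; z \<in> carrier L\<rbrakk> \<Longrightarrow>
      (x \<star> (y \<star> z)) \<ominus>\<^bsub>L\<^esub> ((x \<star> y) \<star> z) = (x \<star> (z \<star> y)) \<ominus>\<^bsub>L\<^esub> ((x \<star> z) \<star> y)"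

definition lie_bracket ::
  "('r, 'a, 'n) module_scheme \<Rightarrow> ('a \<Rightarrow> 'a \<Rightarrow> 'a) \<Rightarrow> 'a \<Rightarrow> 'a \<Rightarrow> 'a" where
  "lie_bracket L pl x y = pl x y \<ominus>\<^bsub>L\<^esub> pl y x"

definition is_pl_extension ::
  "('r, 'm) ring_scheme \<Rightarrow> ('r, 'a, 'n) module_scheme \<Rightarrow> ('a \<Rightarrow> 'a \<Rightarrow> 'a)
    \<Rightarrow> (('a list \<Rightarrow> 'r) set set \<Rightarrow> ('a list \<Rightarrow> 'r) set set \<Rightarrow> ('a list \<Rightarrow> 'r) set set) \<Rightarrow> bool" where
  "is_pl_extension R L pl c \<longleftrightarrow>
     (let S = symmetric_hopf R L; \<iota> = symmetric_gen R L in
      bilinear_map R S S S c \<and>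
      (\<forall>x\<in>carrier L. \<forall>y\<in>carrier L. c (\<iota> x) (\<iota> y) = \<iota> (pl x y)) \<and>
      (\<forall>A\<in>carrier S. c A \<one>\<^bsub>S\<^esub> = A) \<and>
      (\<forall>t\<in>carrier L. \<forall>x\<in>carrier L. \<forall>B\<in>carrier S.
         c (\<iota> t) (B \<otimes>\<^bsub>S\<^esub> \<iota> x) = c (c (\<iota> t) B) (\<iota> x) \<ominus>\<^bsub>S\<^esub> c (\<iota> t) (c B (\<iota> x))) \<and>
      (\<forall>A\<in>carrier S. \<forall>B\<in>carrier S. \<forall>C\<in>carrier S.
         c (A \<otimes>\<^bsub>S\<^esub> B) C =
           tensor_lift R S (\<lambda>C1 C2. c A C1 \<otimes>\<^bsub>S\<^esub> c B C2) (comult S C)))"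

text \<open>The extension is unique on the carrier of \<open>S(L)\<close>; its values elsewhere are irrelevant.\<close>

definition pl_extension ::
  "('r, 'm) ring_scheme \<Rightarrow> ('r, 'a, 'n) module_scheme \<Rightarrow> ('a \<Rightarrow> 'a \<Rightarrow> 'a)
    \<Rightarrow> ('a list \<Rightarrow> 'r) set set \<Rightarrow> ('a list \<Rightarrow> 'r) set set \<Rightarrow> ('a list \<Rightarrow> 'r) set set" where
  "pl_extension R L pl = (SOME c. is_pl_extension R L pl c)"

definition pre_lie_hopf ::
  "('r, 'm) ring_scheme \<Rightarrow> ('r, 'a, 'n) module_scheme \<Rightarrow> ('a \<Rightarrow> 'a \<Rightarrow> 'a)
    \<Rightarrow> ('r, ('a list \<Rightarrow> 'r) set set) hopf" where
  "pre_lie_hopf R L pl =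
     (let S = symmetric_hopf R L in
      S\<lparr>mult := (\<lambda>A B. tensor_lift R S (\<lambda>B1 B2. pl_extension R L pl A B1 \<otimes>\<^bsub>S\<^esub> B2) (comult S B))\<rparr>)"

end

theory Submission
  imports Defs
begin

text \<open>
  The symmetric algebra is the enveloping algebra of \<open>L\<close> with the zero bracket, and the universal
  property and the Hopf structure of an enveloping algebra need no property of the bracket at all.
  One construction, words modulo relations, therefore serves both \<open>S(L)\<close> and \<open>\<U>(L\<^sub>L\<^sub>i\<^sub>e)\<close>.

  By the pre-Lie identity, the maps \<open>A \<mapsto> A x + A \<circ> x\<close> define a right action of \<open>L\<^sub>L\<^sub>i\<^sub>e\<close> on \<open>S(L)\<close>, whence
  a linear map \<open>\<phi> : \<U>(L\<^sub>L\<^sub>i\<^sub>e) \<rightarrow> S(L)\<close> with \<open>\<phi>(u x) = \<phi>(u) x + \<phi>(u) \<circ> x\<close>. Its inverse satisfies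
  \<open>\<psi>(A x) = \<psi>(A) x - \<psi>(A \<circ> x)\<close>. Since \<open>A \<circ> x\<close> has the same degree as \<open>A\<close>, this is a recursion on the degree,
  and it is compatible with the commutativity of \<open>S(L)\<close> again by the pre-Lie identity. No
  Poincare--Birkhoff--Witt theorem is involved, so nothing has to be assumed about \<open>L\<close> as a module.
  The same recursion, with \<open>A \<mapsto> A \<circ> x\<close> as the action, constructs the extension of the product to \<open>S(L)\<close>.

  Finally \<open>A * (B * x) = (A * B) * x\<close> makes \<open>\<phi>\<close> multiplicative, and associativity, compatibility with
  the coproduct and the antipode are transported from \<open>\<U>(L\<^sub>L\<^sub>i\<^sub>e)\<close> along \<open>\<phi>\<close>.
\<close>

section \<open>Linear and bilinear maps\<close>

text \<open>Elements of \<open>S(L)\<close> are cosets of cosets and a word is only one of many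
  representatives, so a recursion that peels off a letter means nothing until its result is known
  not to depend on the order of the letters. No basis of \<open>S(L)\<close> can be used, as
  \<open>L\<close> is an arbitrary module, and no grading is set up. The degree is never attached to
  an element: statements about it are statements about lengths of words, and a linear map is built
  in stages, each correct on words up to some length and zero on longer ones. Truncation respects
  the relations because those of the zero bracket are homogeneous. Most of the maps involved are
  linear but not multiplicative. The universal property is therefore stated for functions on words
  that are linear in every letter and turn a commutator at any position into a bracket. The product
  on \<open>S(L)\<close> is defined by an arbitrary choice among the extensions, so the one
  constructed must also be shown to be unique. The difficulty there is that (ii) is imposed for
  generators only and that the value of \<open>1 \<circ> C\<close>, the counit, has to be extracted
  from (iii).\<close>

context abelian_group
begin

lemma minus_eq_zero_iff:
  assumes "x \<in> carrier G" "y \<in> carrier G"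
  shows "x \<ominus> y = \<zero> \<longleftrightarrow> x = y"
proof
  assume "x \<ominus> y = \<zero>"
  then have "x = \<ominus> (\<ominus> y)"
    using assms by (intro minus_equality[symmetric]) (simp_all add: a_minus_def)
  then show "x = y" using assms by simp
qed (use assms in \<open>simp add: a_minus_def r_neg\<close>)

lemma minus_add_cancel:
  assumes "x \<in> carrier G" "y \<in> carrier G"
  shows "(x \<ominus> y) \<oplus> y = x"
  using assms by (simp add: a_minus_def a_assoc l_neg)

text \<open>Turns an equality of two associators, the form of the pre-Lie axiom, into the form in
  which it is used: a commutator of two operations equals the operation of a bracket.\<close>

lemma minus_eq_minus_swap:
  assumes eq: "a \<ominus> b = c \<ominus> d" and [simp]: "a \<in> carrier G" "b \<in> carrier G" "c \<in> carrier G" "d \<in> carrier G"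
  shows "b \<ominus> d = a \<ominus> c"
proof -
  have "a = (c \<ominus> d) \<oplus> b" using minus_add_cancel[of a b] by (simp add: eq)
  also have "\<dots> = (b \<ominus> d) \<oplus> c" by (simp add: a_minus_def a_ac)
  finally have "a \<ominus> c = ((b \<ominus> d) \<oplus> c) \<ominus> c" by simp
  also have "\<dots> = (b \<ominus> d) \<oplus> (c \<ominus> c)"
    by (simp add: a_minus_def a_assoc)
  finally show ?thesis by (simp add: a_minus_def r_neg)
qed

lemma minus_eq_minusD:
  assumes eq: "a \<ominus> b = c \<ominus> d" and [simp]: "a \<in> carrier G" "b \<in> carrier G" "c \<in> carrier G" "d \<in> carrier G"
  shows "a \<oplus> d = b \<oplus> c"
proof -
  have "a \<oplus> d = ((c \<ominus> d) \<oplus> b) \<oplus> d" using minus_add_cancel[of a b] by (simp add: eq)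
  also have "\<dots> = b \<oplus> ((c \<ominus> d) \<oplus> d)" by (simp add: a_ac)
  finally show ?thesis by (simp add: minus_add_cancel)
qed

lemma common_summand_cancel:
  assumes "z \<in> carrier G" "p \<in> carrier G" "q \<in> carrier G" "r \<in> carrier G" "s \<in> carrier G"
  shows "(z \<oplus> (p \<oplus> q)) \<ominus> (z \<oplus> (r \<oplus> s)) = (p \<ominus> r) \<oplus> (q \<ominus> s)"
proof -
  have "(p \<ominus> r) \<oplus> (q \<ominus> s) = ((p \<ominus> r) \<oplus> (q \<ominus> s)) \<oplus> (z \<oplus> \<ominus> z)"
    using assms by (simp add: r_neg)
  also have "\<dots> = (z \<oplus> (p \<oplus> q)) \<ominus> (z \<oplus> (r \<oplus> s))"
    using assms by (simp only: a_minus_def minus_add a_ac a_closed a_inv_closed)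
  finally show ?thesis by (rule sym)
qed

text \<open>The pattern of a commutator of two sums: the mixed terms \<open>q\<close> and
  \<open>r\<close> occur on both sides. It serves for primitive elements of a tensor square and for
  the composition of two derivations.\<close>

lemma cross_terms_cancel:
  assumes "p \<in> carrier G" "q \<in> carrier G" "r \<in> carrier G" "s \<in> carrier G"
    "p' \<in> carrier G" "s' \<in> carrier G"
  shows "((p \<oplus> q) \<oplus> (r \<oplus> s)) \<ominus> ((p' \<oplus> r) \<oplus> (q \<oplus> s')) = (p \<ominus> p') \<oplus> (s \<ominus> s')"
proof -
  have "(p \<ominus> p') \<oplus> (s \<ominus> s') = ((p \<ominus> p') \<oplus> (s \<ominus> s')) \<oplus> ((q \<oplus> \<ominus> q) \<oplus> (r \<oplus> \<ominus> r))"
    using assms by (simp add: r_neg)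
  also have "\<dots> = ((p \<oplus> q) \<oplus> (r \<oplus> s)) \<ominus> ((p' \<oplus> r) \<oplus> (q \<oplus> s'))"
    using assms by (simp only: a_minus_def minus_add a_ac a_closed a_inv_closed)
  finally show ?thesis by (rule sym)
qed

end

lemma linear_mapI:
  assumes "\<And>x. x \<in> carrier M \<Longrightarrow> f x \<in> carrier N"
    and "\<And>x y. \<lbrakk>x \<in> carrier M; y \<in> carrier M\<rbrakk> \<Longrightarrow> f (x \<oplus>\<^bsub>M\<^esub> y) = f x \<oplus>\<^bsub>N\<^esub> f y"
    and "\<And>r x. \<lbrakk>r \<in> carrier R; x \<in> carrier M\<rbrakk> \<Longrightarrow> f (r \<odot>\<^bsub>M\<^esub> x) = r \<odot>\<^bsub>N\<^esub> f x"
  shows "linear_map R M N f"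
  using assms by (auto simp: linear_map_def)

lemma linear_map_closed: "\<lbrakk>linear_map R M N f; x \<in> carrier M\<rbrakk> \<Longrightarrow> f x \<in> carrier N"
  by (auto simp: linear_map_def)

lemma linear_map_add:
  "\<lbrakk>linear_map R M N f; x \<in> carrier M; y \<in> carrier M\<rbrakk> \<Longrightarrow> f (x \<oplus>\<^bsub>M\<^esub> y) = f x \<oplus>\<^bsub>N\<^esub> f y"
  by (auto simp: linear_map_def)

lemma linear_map_smult:
  "\<lbrakk>linear_map R M N f; r \<in> carrier R; x \<in> carrier M\<rbrakk> \<Longrightarrow> f (r \<odot>\<^bsub>M\<^esub> x) = r \<odot>\<^bsub>N\<^esub> f x"
  by (auto simp: linear_map_def)

lemma linear_map_zero:
  assumes "module R M" "module R N" "linear_map R M N f"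
  shows "f \<zero>\<^bsub>M\<^esub> = \<zero>\<^bsub>N\<^esub>"
proof -
  interpret M: module R M by fact
  interpret N: module R N by fact
  have "f (\<zero>\<^bsub>R\<^esub> \<odot>\<^bsub>M\<^esub> \<zero>\<^bsub>M\<^esub>) = \<zero>\<^bsub>R\<^esub> \<odot>\<^bsub>N\<^esub> f \<zero>\<^bsub>M\<^esub>"
    by (rule linear_map_smult[OF assms(3)]) auto
  then show ?thesis
    using linear_map_closed[OF assms(3)] by simp
qed

lemma linear_map_uminus:
  assumes "module R M" "module R N" "linear_map R M N f" "x \<in> carrier M"
  shows "f (\<ominus>\<^bsub>M\<^esub> x) = \<ominus>\<^bsub>N\<^esub> f x"
proof -
  interpret M: module R M by fact
  interpret N: module R N by fact
  have "f (\<ominus>\<^bsub>M\<^esub> x) \<oplus>\<^bsub>N\<^esub> f x = \<zero>\<^bsub>N\<^esub>"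
    using assms linear_map_add[OF assms(3), of "\<ominus>\<^bsub>M\<^esub> x" x] linear_map_zero[OF assms(1-3)]
    by (simp add: M.M.l_neg)
  then show ?thesis
    using assms(4) linear_map_closed[OF assms(3)] by (simp add: N.M.minus_equality)
qed

lemma linear_map_diff:
  assumes "module R M" "module R N" "linear_map R M N f" "x \<in> carrier M" "y \<in> carrier M"
  shows "f (x \<ominus>\<^bsub>M\<^esub> y) = f x \<ominus>\<^bsub>N\<^esub> f y"
proof -
  interpret M: module R M by fact
  interpret N: module R N by fact
  show ?thesis
    using assms linear_map_add[OF assms(3), of x "\<ominus>\<^bsub>M\<^esub> y"] linear_map_uminus[OF assms(1-3)]
    by (simp add: a_minus_def)
qed

lemma linear_map_comp:
  "\<lbrakk>linear_map R M N f; linear_map R N P g\<rbrakk> \<Longrightarrow> linear_map R M P (\<lambda>x. g (f x))"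
  by (auto simp: linear_map_def Pi_def)

lemma linear_map_ident: "linear_map R M M (\<lambda>x. x)"
  by (auto simp: linear_map_def)

lemma linear_map_cong:
  assumes "linear_map R M N f" "module R M" "\<And>x. x \<in> carrier M \<Longrightarrow> f x = g x"
  shows "linear_map R M N g"
proof -
  interpret module R M by fact
  show ?thesis
    using assms(1) assms(3) unfolding linear_map_def Pi_def by simp
qed

lemma linear_map_plus:
  assumes "module R N" "linear_map R M N f" "linear_map R M N g"
  shows "linear_map R M N (\<lambda>x. f x \<oplus>\<^bsub>N\<^esub> g x)"
proof -
  interpret N: module R N by fact
  note c = linear_map_closed[OF assms(2)] linear_map_closed[OF assms(3)]
  show ?thesis
    by (rule linear_mapI)
      (simp_all add: c linear_map_add[OF assms(2)] linear_map_add[OF assms(3)]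
        linear_map_smult[OF assms(2)] linear_map_smult[OF assms(3)] N.smult_r_distr N.M.a_ac)
qed

lemma linear_map_neg:
  assumes "module R N" "linear_map R M N f"
  shows "linear_map R M N (\<lambda>x. \<ominus>\<^bsub>N\<^esub> f x)"
proof -
  interpret N: module R N by fact
  note c = linear_map_closed[OF assms(2)]
  show ?thesis
    by (rule linear_mapI)
      (simp_all add: c linear_map_add[OF assms(2)] linear_map_smult[OF assms(2)]
        N.smult_r_minus N.M.minus_add)
qed

lemma linear_map_const_zero: "module R N \<Longrightarrow> linear_map R M N (\<lambda>x. \<zero>\<^bsub>N\<^esub>)"
proof -
  assume "module R N"
  interpret N: module R N by fact
  show ?thesis by (rule linear_mapI) simp_all
qed

lemma linear_map_minus:
  assumes "module R N" "linear_map R M N f" "linear_map R M N g"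
  shows "linear_map R M N (\<lambda>x. f x \<ominus>\<^bsub>N\<^esub> g x)"
  unfolding a_minus_def by (intro linear_map_plus linear_map_neg assms)

lemma linear_map_scale:
  assumes "module R N" "linear_map R M N f" "r \<in> carrier R"
  shows "linear_map R M N (\<lambda>x. r \<odot>\<^bsub>N\<^esub> f x)"
proof -
  interpret N: module R N by fact
  note c = linear_map_closed[OF assms(2)]
  show ?thesis
  proof (rule linear_mapI)
    fix s x assume sx: "s \<in> carrier R" "x \<in> carrier M"
    then have "r \<odot>\<^bsub>N\<^esub> f (s \<odot>\<^bsub>M\<^esub> x) = (r \<otimes>\<^bsub>R\<^esub> s) \<odot>\<^bsub>N\<^esub> f x"
      using assms(3) by (simp add: c linear_map_smult[OF assms(2)] N.smult_assoc1)
    also have "\<dots> = s \<odot>\<^bsub>N\<^esub> (r \<odot>\<^bsub>N\<^esub> f x)"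
      using sx assms(3) by (subst N.R.m_comm) (simp_all add: c N.smult_assoc1)
    finally show "r \<odot>\<^bsub>N\<^esub> f (s \<odot>\<^bsub>M\<^esub> x) = s \<odot>\<^bsub>N\<^esub> (r \<odot>\<^bsub>N\<^esub> f x)" .
  qed (use assms(3) in \<open>simp_all add: c linear_map_add[OF assms(2)] N.smult_r_distr\<close>)
qed

lemma bilinear_mapI:
  assumes "\<And>x. x \<in> carrier M \<Longrightarrow> linear_map R N P (\<beta> x)"
    and "\<And>y. y \<in> carrier N \<Longrightarrow> linear_map R M P (\<lambda>x. \<beta> x y)"
  shows "bilinear_map R M N P \<beta>"
  using assms by (auto simp: bilinear_map_def)

lemma bilinear_map_left: "\<lbrakk>bilinear_map R M N P \<beta>; y \<in> carrier N\<rbrakk> \<Longrightarrow> linear_map R M P (\<lambda>x. \<beta> x y)"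
  and bilinear_map_right: "\<lbrakk>bilinear_map R M N P \<beta>; x \<in> carrier M\<rbrakk> \<Longrightarrow> linear_map R N P (\<beta> x)"
  by (auto simp: bilinear_map_def)

lemma bilinear_map_closed:
  "\<lbrakk>bilinear_map R M N P \<beta>; x \<in> carrier M; y \<in> carrier N\<rbrakk> \<Longrightarrow> \<beta> x y \<in> carrier P"
  by (rule linear_map_closed[OF bilinear_map_right])

lemma bilinear_map_comp:
  assumes "bilinear_map R M N P \<beta>" "linear_map R P Q f"
  shows "bilinear_map R M N Q (\<lambda>x y. f (\<beta> x y))"
proof (rule bilinear_mapI)
  show "linear_map R N Q (\<lambda>y. f (\<beta> x y))" if "x \<in> carrier M" for x
    by (rule linear_map_comp[OF bilinear_map_right[OF assms(1) that] assms(2)])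
  show "linear_map R M Q (\<lambda>x. f (\<beta> x y))" if "y \<in> carrier N" for y
    by (rule linear_map_comp[OF bilinear_map_left[OF assms(1) that] assms(2)])
qed

lemma bilinear_map_comp2:
  assumes "bilinear_map R M N P \<beta>" "linear_map R M' M f" "linear_map R N' N g"
  shows "bilinear_map R M' N' P (\<lambda>x y. \<beta> (f x) (g y))"
proof (rule bilinear_mapI)
  show "linear_map R N' P (\<lambda>y. \<beta> (f x) (g y))" if "x \<in> carrier M'" for x
    by (rule linear_map_comp[OF assms(3) bilinear_map_right[OF assms(1)]])
      (rule linear_map_closed[OF assms(2) that])
  show "linear_map R M' P (\<lambda>x. \<beta> (f x) (g y))" if "y \<in> carrier N'" for y
    by (rule linear_map_comp[OF assms(2) bilinear_map_left[OF assms(1)]])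
      (rule linear_map_closed[OF assms(3) that])
qed

lemma bilinear_map_plus:
  "\<lbrakk>module R P; bilinear_map R M N P \<beta>; bilinear_map R M N P \<gamma>\<rbrakk>
    \<Longrightarrow> bilinear_map R M N P (\<lambda>x y. \<beta> x y \<oplus>\<^bsub>P\<^esub> \<gamma> x y)"
  by (intro bilinear_mapI linear_map_plus) (auto simp: bilinear_map_left bilinear_map_right)

lemma bilinear_map_minus:
  "\<lbrakk>module R P; bilinear_map R M N P \<beta>; bilinear_map R M N P \<gamma>\<rbrakk>
    \<Longrightarrow> bilinear_map R M N P (\<lambda>x y. \<beta> x y \<ominus>\<^bsub>P\<^esub> \<gamma> x y)"
  by (intro bilinear_mapI linear_map_minus) (auto simp: bilinear_map_left bilinear_map_right)

section \<open>Free modules\<close>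

text \<open>The sum has the same shape as the one in \<open>tensor_lift\<close>, so
  \<open>tensor_lift\<close> of a coset is literally \<open>free_lift\<close> of the chosen
  representative.\<close>

definition free_lift ::
  "('r, 'm) ring_scheme \<Rightarrow> ('r, 'c, 'n) module_scheme \<Rightarrow> ('b \<Rightarrow> 'c) \<Rightarrow> ('b \<Rightarrow> 'r) \<Rightarrow> 'c" where
  "free_lift R P g f = (\<Oplus>\<^bsub>P\<^esub>b\<in>{b. f b \<noteq> \<zero>\<^bsub>R\<^esub>}. f b \<odot>\<^bsub>P\<^esub> g b)"

lemma free_module_simps [simp]:
  "carrier (free_module R B) =
    {f. (\<forall>b. f b \<in> carrier R) \<and> finite {b. f b \<noteq> \<zero>\<^bsub>R\<^esub>} \<and> {b. f b \<noteq> \<zero>\<^bsub>R\<^esub>} \<subseteq> B}"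
  "\<zero>\<^bsub>free_module R B\<^esub> = (\<lambda>b. \<zero>\<^bsub>R\<^esub>)"
  "f \<oplus>\<^bsub>free_module R B\<^esub> g = (\<lambda>b. f b \<oplus>\<^bsub>R\<^esub> g b)"
  "r \<odot>\<^bsub>free_module R B\<^esub> f = (\<lambda>b. r \<otimes>\<^bsub>R\<^esub> f b)"
  by (simp_all add: free_module_def)

context cring
begin

lemma module_free_module: "module R (free_module R B)"
proof (rule moduleI)
  have add: "f \<oplus>\<^bsub>free_module R B\<^esub> g \<in> carrier (free_module R B)"
    if "f \<in> carrier (free_module R B)" "g \<in> carrier (free_module R B)" for f g
  proof -
    have sub: "{b. f b \<oplus> g b \<noteq> \<zero>} \<subseteq> {b. f b \<noteq> \<zero>} \<union> {b. g b \<noteq> \<zero>}"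
      by auto
    have fin: "finite ({b. f b \<noteq> \<zero>} \<union> {b. g b \<noteq> \<zero>})"
      using that by simp
    have "{b. f b \<noteq> \<zero>} \<union> {b. g b \<noteq> \<zero>} \<subseteq> B"
      using that by simp
    with sub have "{b. f b \<oplus> g b \<noteq> \<zero>} \<subseteq> B"
      by (rule subset_trans)
    with that finite_subset[OF sub fin] show ?thesis
      by simp
  qed
  show "abelian_group (free_module R B)"
  proof (rule abelian_groupI)
    fix f assume f: "f \<in> carrier (free_module R B)"
    have "{b. \<ominus> f b \<noteq> \<zero>} = {b. f b \<noteq> \<zero>}"
      using f by (simp add: add.inv_eq_1_iff)
    then have "(\<lambda>b. \<ominus> f b) \<in> carrier (free_module R B)"
      using f by auto
    moreover have "(\<lambda>b. \<ominus> f b) \<oplus>\<^bsub>free_module R B\<^esub> f = \<zero>\<^bsub>free_module R B\<^esub>"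
      using f by (auto simp: l_neg)
    ultimately show "\<exists>g\<in>carrier (free_module R B). g \<oplus>\<^bsub>free_module R B\<^esub> f = \<zero>\<^bsub>free_module R B\<^esub>"
      by blast
  qed (use add in \<open>auto simp: fun_eq_iff a_ac\<close>)
  fix r f assume rf: "r \<in> carrier R" "f \<in> carrier (free_module R B)"
  have "{b. r \<otimes> f b \<noteq> \<zero>} \<subseteq> {b. f b \<noteq> \<zero>}" using rf by auto
  with rf show "r \<odot>\<^bsub>free_module R B\<^esub> f \<in> carrier (free_module R B)"
    using finite_subset by fastforce
qed (auto simp: fun_eq_iff l_distr r_distr m_assoc is_cring)

lemma basis_elem_closed: "b \<in> B \<Longrightarrow> basis_elem R b \<in> carrier (free_module R B)"
  by (auto simp: basis_elem_def)

text \<open>Induction on a finite set containing the support: resetting one value to zero splits off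
  a multiple of a basis element.\<close>

lemma free_module_induct [consumes 1, case_names zero add]:
  assumes "f \<in> carrier (free_module R B)"
    and zero: "P \<zero>\<^bsub>free_module R B\<^esub>"
    and add: "\<And>r b f. \<lbrakk>r \<in> carrier R; b \<in> B; f \<in> carrier (free_module R B); P f\<rbrakk>
      \<Longrightarrow> P (r \<odot>\<^bsub>free_module R B\<^esub> basis_elem R b \<oplus>\<^bsub>free_module R B\<^esub> f)"
  shows "P f"
proof -
  have "f \<in> carrier (free_module R B) \<Longrightarrow> {b. f b \<noteq> \<zero>} \<subseteq> S \<Longrightarrow> P f" if "finite S" for S
    using that
  proof (induction S arbitrary: f)
    case empty
    then have "f = (\<lambda>b. \<zero>)" by auto
    then show ?case using zero by simp
  next
    case (insert c S)
    show ?case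
    proof (cases "f c = \<zero>")
      case True
      then show ?thesis using insert by blast
    next
      case False
      let ?g = "f(c := \<zero>)"
      have sub: "{b. ?g b \<noteq> \<zero>} \<subseteq> {b. f b \<noteq> \<zero>}" by auto
      have "finite {b. f b \<noteq> \<zero>}" "{b. f b \<noteq> \<zero>} \<subseteq> B"
        using insert.prems by simp_all
      then have "finite {b. ?g b \<noteq> \<zero>}" "{b. ?g b \<noteq> \<zero>} \<subseteq> B"
        using finite_subset[OF sub] subset_trans[OF sub] by simp_all
      then have g: "?g \<in> carrier (free_module R B)"
        using insert.prems by simp
      moreover have "P ?g" using insert.prems by (intro insert.IH g) auto
      moreover have "f c \<in> carrier R" "c \<in> B" using insert.prems False by auto
      ultimately have "P (f c \<odot>\<^bsub>free_module R B\<^esub> basis_elem R c \<oplus>\<^bsub>free_module R B\<^esub> ?g)"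
        using add by blast
      moreover have "f c \<odot>\<^bsub>free_module R B\<^esub> basis_elem R c \<oplus>\<^bsub>free_module R B\<^esub> ?g = f"
        using insert.prems by (auto simp: basis_elem_def fun_eq_iff)
      ultimately show ?thesis by simp
    qed
  qed
  then show ?thesis using assms(1) by auto
qed

lemma free_module_ext:
  assumes "module R P" "linear_map R (free_module R B) P F" "linear_map R (free_module R B) P G"
    and "\<And>b. b \<in> B \<Longrightarrow> F (basis_elem R b) = G (basis_elem R b)"
    and "f \<in> carrier (free_module R B)"
  shows "F f = G f"
  using assms(5)
proof (induction rule: free_module_induct)
  case zero
  then show ?case
    using linear_map_zero[OF module_free_module assms(1,2)] linear_map_zero[OF module_free_module assms(1,3)]
    by simp
next
  case (add r b f)
  interpret F: module R "free_module R B" by (rule module_free_module)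
  show ?case
    using add basis_elem_closed[OF add(2)] assms(4)
    by (simp only: linear_map_add[OF assms(2)] linear_map_add[OF assms(3)] F.smult_closed
      linear_map_smult[OF assms(2)] linear_map_smult[OF assms(3)])
qed

text \<open>By cancellation the support of a sum may be smaller than the union of the supports.
  Additivity of \<open>free_lift\<close> is proved by summing over a common larger index
  set.\<close>

lemma free_lift_superset:
  assumes "module R P" "g \<in> B \<rightarrow> carrier P" "f \<in> carrier (free_module R B)"
    and "finite A" "{b. f b \<noteq> \<zero>} \<subseteq> A" "A \<subseteq> B"
  shows "free_lift R P g f = (\<Oplus>\<^bsub>P\<^esub>b\<in>A. f b \<odot>\<^bsub>P\<^esub> g b)"
proof -
  interpret P: module R P by fact
  have *: "g b \<in> carrier P" if "b \<in> A" for b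
    using that assms by auto
  show ?thesis
    unfolding free_lift_def
    using assms * by (intro P.M.add.finprod_mono_neutral_cong_left) auto
qed

lemma free_lift_linear:
  assumes "module R P" "g \<in> B \<rightarrow> carrier P"
  shows "linear_map R (free_module R B) P (free_lift R P g)"
proof -
  interpret P: module R P by fact
  interpret F: module R "free_module R B" by (rule module_free_module)
  show ?thesis
  proof (rule linear_mapI)
    fix f assume f: "f \<in> carrier (free_module R B)"
    then show "free_lift R P g f \<in> carrier P"
      unfolding free_lift_def using assms(2) by (intro P.M.finsum_closed) auto
    fix h assume h: "h \<in> carrier (free_module R B)"
    let ?A = "{b. f b \<noteq> \<zero>} \<union> {b. h b \<noteq> \<zero>}"
    have A: "finite ?A" "?A \<subseteq> B" using f h by auto
    have *: "g b \<in> carrier P" if "b \<in> ?A" for b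
      using that A assms by auto
    have "f \<oplus>\<^bsub>free_module R B\<^esub> h \<in> carrier (free_module R B)" using f h by (rule F.M.a_closed)
    then have "free_lift R P g (f \<oplus>\<^bsub>free_module R B\<^esub> h) =
      (\<Oplus>\<^bsub>P\<^esub>b\<in>?A. (f \<oplus>\<^bsub>free_module R B\<^esub> h) b \<odot>\<^bsub>P\<^esub> g b)"
      using A by (intro free_lift_superset[OF assms]) auto
    also have "\<dots> = (\<Oplus>\<^bsub>P\<^esub>b\<in>?A. f b \<odot>\<^bsub>P\<^esub> g b \<oplus>\<^bsub>P\<^esub> h b \<odot>\<^bsub>P\<^esub> g b)"
      using f h * by (intro P.M.finsum_cong') (auto simp: P.smult_l_distr)
    also have "\<dots> = (\<Oplus>\<^bsub>P\<^esub>b\<in>?A. f b \<odot>\<^bsub>P\<^esub> g b) \<oplus>\<^bsub>P\<^esub> (\<Oplus>\<^bsub>P\<^esub>b\<in>?A. h b \<odot>\<^bsub>P\<^esub> g b)"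
      using f h * by (intro P.M.finsum_addf) auto
    also have "\<dots> = free_lift R P g f \<oplus>\<^bsub>P\<^esub> free_lift R P g h"
      using A f h free_lift_superset[OF assms f, of ?A] free_lift_superset[OF assms h, of ?A] by auto
    finally show "free_lift R P g (f \<oplus>\<^bsub>free_module R B\<^esub> h) = free_lift R P g f \<oplus>\<^bsub>P\<^esub> free_lift R P g h" .
  next
    fix r f assume r: "r \<in> carrier R" and f: "f \<in> carrier (free_module R B)"
    let ?A = "{b. f b \<noteq> \<zero>}"
    have A: "finite ?A" "?A \<subseteq> B" using f by auto
    have *: "g b \<in> carrier P" if "b \<in> ?A" for b
      using that A assms by auto
    have "r \<odot>\<^bsub>free_module R B\<^esub> f \<in> carrier (free_module R B)" using r f by (rule F.smult_closed)
    then have "free_lift R P g (r \<odot>\<^bsub>free_module R B\<^esub> f) =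
      (\<Oplus>\<^bsub>P\<^esub>b\<in>?A. (r \<odot>\<^bsub>free_module R B\<^esub> f) b \<odot>\<^bsub>P\<^esub> g b)"
      using r A by (intro free_lift_superset[OF assms]) auto
    also have "\<dots> = (\<Oplus>\<^bsub>P\<^esub>b\<in>?A. r \<odot>\<^bsub>P\<^esub> (f b \<odot>\<^bsub>P\<^esub> g b))"
      using r f * by (intro P.M.finsum_cong') (auto simp: P.smult_assoc1)
    also have "\<dots> = r \<odot>\<^bsub>P\<^esub> free_lift R P g f"
      unfolding free_lift_def using r A f * by (intro P.finsum_smult_ldistr[symmetric]) auto
    finally show "free_lift R P g (r \<odot>\<^bsub>free_module R B\<^esub> f) = r \<odot>\<^bsub>P\<^esub> free_lift R P g f" .
  qed
qed

lemma free_lift_basis: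
  assumes "module R P" "g \<in> B \<rightarrow> carrier P" "b \<in> B"
  shows "free_lift R P g (basis_elem R b) = g b"
proof -
  interpret P: module R P by fact
  have "g b \<in> carrier P" using assms by auto
  moreover have "free_lift R P g (basis_elem R b) = (\<Oplus>\<^bsub>P\<^esub>c\<in>{b}. basis_elem R b c \<odot>\<^bsub>P\<^esub> g c)"
    using basis_elem_closed[OF assms(3)] assms(3)
    by (intro free_lift_superset[OF assms(1,2)]) (auto simp: basis_elem_def)
  ultimately show ?thesis by (simp add: basis_elem_def)
qed

end

declare free_module_simps [simp del]

section \<open>Quotient modules\<close>

lemma quotient_by_simps:
  "mult (quotient_by A I) = mult (A Quot I)"
  "one (quotient_by A I) = one (A Quot I)"
  "zero (quotient_by A I) = I"
  "add (quotient_by A I) = set_add A"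
  "carrier (quotient_by A I) = a_rcosets\<^bsub>A\<^esub> I"
  by (simp_all add: quotient_by_def FactRing_def)

locale quotient_module = module R M for R (structure) and M (structure) +
  fixes N
  assumes submodule: "submodule N R M"
begin

sublocale N: abelian_subgroup N M
  using submodule M.abelian_group_axioms by (intro abelian_subgroupI3 additive_subgroupI)
    (auto simp: submodule_def)

lemma carrier_quotient: "carrier (quotient_by M N) = (\<lambda>x. N +>\<^bsub>M\<^esub> x) ` carrier M"
  by (auto simp: quotient_by_simps A_RCOSETS_def')

lemma quotient_eq_iff:
  assumes "x \<in> carrier M" "y \<in> carrier M"
  shows "N +>\<^bsub>M\<^esub> x = N +>\<^bsub>M\<^esub> y \<longleftrightarrow> x \<ominus>\<^bsub>M\<^esub> y \<in> N"
proof
  assume "N +>\<^bsub>M\<^esub> x = N +>\<^bsub>M\<^esub> y"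
  then have "x \<in> N +>\<^bsub>M\<^esub> y" using N.a_rcos_self[OF assms(1)] by simp
  then show "x \<ominus>\<^bsub>M\<^esub> y \<in> N" unfolding a_minus_def N.a_rcos_module[OF assms(2,1)] .
next
  assume "x \<ominus>\<^bsub>M\<^esub> y \<in> N"
  then have "x \<in> N +>\<^bsub>M\<^esub> y" unfolding a_minus_def N.a_rcos_module[OF assms(2,1)] .
  from N.a_repr_independence'[OF this assms(2)] show "N +>\<^bsub>M\<^esub> x = N +>\<^bsub>M\<^esub> y" by (rule sym)
qed

lemma smult_quotient:
  assumes "r \<in> carrier R" "x \<in> carrier M"
  shows "r \<odot>\<^bsub>quotient_by M N\<^esub> (N +>\<^bsub>M\<^esub> x) = N +>\<^bsub>M\<^esub> (r \<odot>\<^bsub>M\<^esub> x)"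
proof -
  \<comment> \<open>All cosets in the union that defines scalar multiplication coincide, because
    \<open>N\<close> is closed under scalars; the union is then equal to any one of them.\<close>
  have "\<forall>y\<in>N +>\<^bsub>M\<^esub> x. N +>\<^bsub>M\<^esub> (r \<odot>\<^bsub>M\<^esub> y) = N +>\<^bsub>M\<^esub> (r \<odot>\<^bsub>M\<^esub> x)"
  proof
    fix y assume y: "y \<in> N +>\<^bsub>M\<^esub> x"
    have yc: "y \<in> carrier M" using N.a_elemrcos_carrier y assms by blast
    then have "y \<ominus>\<^bsub>M\<^esub> x \<in> N" using y assms N.a_rcos_module by (simp add: a_minus_def)
    then have "r \<odot>\<^bsub>M\<^esub> (y \<ominus>\<^bsub>M\<^esub> x) \<in> N" using submodule assms by (simp add: submodule.smult_closed)
    then show "N +>\<^bsub>M\<^esub> (r \<odot>\<^bsub>M\<^esub> y) = N +>\<^bsub>M\<^esub> (r \<odot>\<^bsub>M\<^esub> x)"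
      using assms yc by (simp add: quotient_eq_iff a_minus_def smult_r_distr smult_r_minus)
  qed
  from UN_constant_eq[OF N.a_rcos_self[OF assms(2)] this] show ?thesis
    by (simp add: quotient_by_def)
qed

lemma add_quotient:
  assumes "x \<in> carrier M" "y \<in> carrier M"
  shows "(N +>\<^bsub>M\<^esub> x) \<oplus>\<^bsub>quotient_by M N\<^esub> (N +>\<^bsub>M\<^esub> y) = N +>\<^bsub>M\<^esub> (x \<oplus>\<^bsub>M\<^esub> y)"
  by (simp only: quotient_by_simps N.a_rcos_sum[OF assms])

lemma linear_quotient_proj: "linear_map R M (quotient_by M N) (\<lambda>x. N +>\<^bsub>M\<^esub> x)"
  by (rule linear_mapI) (simp_all only: carrier_quotient imageI smult_quotient add_quotient)

lemma module_quotient: "module R (quotient_by M N)"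
proof -
  have zero: "\<zero>\<^bsub>quotient_by M N\<^esub> = N +>\<^bsub>M\<^esub> \<zero>\<^bsub>M\<^esub>"
    by (simp add: quotient_by_simps N.a_rcos_const)
  have "abelian_group (quotient_by M N)"
  proof (rule abelian_groupI)
    fix X assume "X \<in> carrier (quotient_by M N)"
    then obtain x where "x \<in> carrier M" "X = N +>\<^bsub>M\<^esub> x"
      unfolding carrier_quotient by blast
    then have "(N +>\<^bsub>M\<^esub> (\<ominus>\<^bsub>M\<^esub> x)) \<oplus>\<^bsub>quotient_by M N\<^esub> X = \<zero>\<^bsub>quotient_by M N\<^esub>"
      "N +>\<^bsub>M\<^esub> (\<ominus>\<^bsub>M\<^esub> x) \<in> carrier (quotient_by M N)"
      unfolding zero carrier_quotient by (simp_all add: add_quotient M.l_neg)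
    then show "\<exists>Y\<in>carrier (quotient_by M N). Y \<oplus>\<^bsub>quotient_by M N\<^esub> X = \<zero>\<^bsub>quotient_by M N\<^esub>"
      by blast
  qed (auto simp: carrier_quotient zero add_quotient M.a_ac)
  then show ?thesis
    by (rule moduleI[OF R.is_cring];
      unfold carrier_quotient; elim imageE;
      simp add: smult_quotient add_quotient smult_l_distr smult_r_distr smult_assoc1
       )
qed

lemma quotient_factor:
  assumes P: "module R P" and F: "linear_map R M P F" and F0: "\<And>x. x \<in> N \<Longrightarrow> F x = \<zero>\<^bsub>P\<^esub>"
  obtains G where "linear_map R (quotient_by M N) P G"
    and "\<And>x. x \<in> carrier M \<Longrightarrow> G (N +>\<^bsub>M\<^esub> x) = F x"
proof -
  interpret P: module R P by fact
  \<comment> \<open>Any representative will do, since \<open>F\<close> is constant on each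
    coset.\<close>
  define G where "G X = F (SOME x. x \<in> X)" for X
  have eq: "F y = F x" if x: "x \<in> carrier M" and y: "y \<in> N +>\<^bsub>M\<^esub> x" for x y
  proof -
    have yc: "y \<in> carrier M" using N.a_elemrcos_carrier y x by blast
    have "y \<ominus>\<^bsub>M\<^esub> x \<in> N" using y x N.a_rcos_module[OF x yc] by (simp add: a_minus_def)
    then have "F y \<ominus>\<^bsub>P\<^esub> F x = \<zero>\<^bsub>P\<^esub>"
      using F0 linear_map_diff[OF module_axioms P F yc x] by simp
    then show ?thesis
      using x yc linear_map_closed[OF F] by (simp add: P.M.minus_eq_zero_iff)
  qed
  have G: "G (N +>\<^bsub>M\<^esub> x) = F x" if "x \<in> carrier M" for x
    unfolding G_def using N.a_rcos_self[OF that] by (intro eq[OF that]) (rule someI)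
  have "linear_map R (quotient_by M N) P G"
    by (rule linear_mapI)
      (auto simp: carrier_quotient smult_quotient add_quotient G
        linear_map_closed[OF F] linear_map_add[OF F] linear_map_smult[OF F])
  then show thesis using G that by blast
qed

end

section \<open>Submodules generated by a set\<close>

lemma gen_submodule_submodule:
  assumes "module R M" "X \<subseteq> carrier M"
  shows "submodule (gen_submodule R M X) R M"
proof -
  interpret module R M by fact
  have "submodule (carrier M) R M"
    by (rule submoduleI) auto
  then have "gen_submodule R M X \<subseteq> carrier M"
    using assms(2) by (auto simp: gen_submodule_def)
  then show ?thesis
    by (rule submoduleI)
      (auto simp: gen_submodule_def submodule_def submodule_axioms_def subgroup_def a_inv_def)
qed

text \<open>The kernel of \<open>F\<close> is a submodule, so it contains the submodule generated by
  \<open>X\<close> as soon as it contains \<open>X\<close>.\<close>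

lemma gen_submodule_kernel:
  assumes "module R M" "module R P" "linear_map R M P F" "X \<subseteq> carrier M"
    and "\<And>x. x \<in> X \<Longrightarrow> F x = \<zero>\<^bsub>P\<^esub>" and "x \<in> gen_submodule R M X"
  shows "F x = \<zero>\<^bsub>P\<^esub>"
proof -
  interpret M: module R M by fact
  interpret P: module R P by fact
  have "submodule {x \<in> carrier M. F x = \<zero>\<^bsub>P\<^esub>} R M"
    by (rule M.submoduleI)
      (auto simp: linear_map_zero[OF assms(1-3)] linear_map_add[OF assms(3)]
        linear_map_smult[OF assms(3)] linear_map_uminus[OF assms(1-3)])
  with assms show ?thesis by (auto simp: gen_submodule_def)
qed

section \<open>Tensor products\<close>

text \<open>Bounded existentials in place of set comprehensions, so that a relation can be split
  into its four kinds by elimination rules.\<close>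

lemma tensor_relations_iff:
  "x \<in> tensor_relations R M N \<longleftrightarrow>
    (let F = free_module R (carrier M \<times> carrier N); e = (\<lambda>x y. basis_elem R (x, y)) in
      (\<exists>a\<in>carrier M. \<exists>a'\<in>carrier M. \<exists>b\<in>carrier N. x = e (a \<oplus>\<^bsub>M\<^esub> a') b \<ominus>\<^bsub>F\<^esub> (e a b \<oplus>\<^bsub>F\<^esub> e a' b)) \<or>
      (\<exists>a\<in>carrier M. \<exists>b\<in>carrier N. \<exists>b'\<in>carrier N. x = e a (b \<oplus>\<^bsub>N\<^esub> b') \<ominus>\<^bsub>F\<^esub> (e a b \<oplus>\<^bsub>F\<^esub> e a b')) \<or>
      (\<exists>r\<in>carrier R. \<exists>a\<in>carrier M. \<exists>b\<in>carrier N. x = e (r \<odot>\<^bsub>M\<^esub> a) b \<ominus>\<^bsub>F\<^esub> r \<odot>\<^bsub>F\<^esub> e a b) \<or>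
      (\<exists>r\<in>carrier R. \<exists>a\<in>carrier M. \<exists>b\<in>carrier N. x = e a (r \<odot>\<^bsub>N\<^esub> b) \<ominus>\<^bsub>F\<^esub> r \<odot>\<^bsub>F\<^esub> e a b))"
  unfolding tensor_relations_def Let_def by blast

locale tensor_prod = M: module R M + N: module R N
  for R (structure) and M and N
begin

abbreviation "T \<equiv> tensor_module R M N"
abbreviation "F \<equiv> free_module R (carrier M \<times> carrier N)"

sublocale F: module R F by (rule M.R.module_free_module)

lemma basis_pair_closed: "x \<in> carrier M \<Longrightarrow> y \<in> carrier N \<Longrightarrow> basis_elem R (x, y) \<in> carrier F"
  by (rule M.R.basis_elem_closed) simp

lemma relations_closed: "tensor_relations R M N \<subseteq> carrier F"
proof
  fix x assume "x \<in> tensor_relations R M N"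
  then show "x \<in> carrier F"
    unfolding tensor_relations_iff Let_def
    by (elim disjE bexE)
      (simp_all only: F.M.minus_closed F.M.a_closed F.smult_closed basis_pair_closed
        M.M.a_closed N.M.a_closed M.smult_closed N.smult_closed)
qed

sublocale Q: quotient_module R F "tensor_kernel R M N"
  by (intro quotient_module.intro quotient_module_axioms.intro F.module_axioms)
    (unfold tensor_kernel_def, rule gen_submodule_submodule[OF F.module_axioms relations_closed])

sublocale T: module R T
  unfolding tensor_module_def by (rule Q.module_quotient)

lemma tensor_closed [simp, intro]:
  "x \<in> carrier M \<Longrightarrow> y \<in> carrier N \<Longrightarrow> tensor R M N x y \<in> carrier T"
  unfolding tensor_module_def tensor_def by (rule linear_map_closed[OF Q.linear_quotient_proj basis_pair_closed])

lemma kernel_imp_eq: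
  assumes "f \<ominus>\<^bsub>F\<^esub> g \<in> tensor_relations R M N" "f \<in> carrier F" "g \<in> carrier F"
  shows "tensor_kernel R M N +>\<^bsub>F\<^esub> f = tensor_kernel R M N +>\<^bsub>F\<^esub> g"
proof -
  have "tensor_relations R M N \<subseteq> tensor_kernel R M N"
    unfolding tensor_kernel_def gen_submodule_def by blast
  with assms(1) show ?thesis
    unfolding Q.quotient_eq_iff[OF assms(2,3)] by (rule rev_subsetD)
qed

lemma bilinear_tensor: "bilinear_map R M N T (tensor R M N)"
proof -
  let ?q = "\<lambda>x. tensor_kernel R M N +>\<^bsub>F\<^esub> x"
  let ?e = "\<lambda>x y. basis_elem R (x, y)"
  have lin: "linear_map R F T ?q"
    unfolding tensor_module_def by (rule Q.linear_quotient_proj)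
  note [simp] = basis_pair_closed
  have "?q (?e (x \<oplus>\<^bsub>M\<^esub> x') y) = ?q (?e x y) \<oplus>\<^bsub>T\<^esub> ?q (?e x' y)"
    if "x \<in> carrier M" "x' \<in> carrier M" "y \<in> carrier N" for x x' y
    unfolding linear_map_add[OF lin basis_pair_closed[OF that(1,3)] basis_pair_closed[OF that(2,3)], symmetric]
    using that by (intro kernel_imp_eq) (simp_all, unfold tensor_relations_iff Let_def, blast)
  moreover have "?q (?e x (y \<oplus>\<^bsub>N\<^esub> y')) = ?q (?e x y) \<oplus>\<^bsub>T\<^esub> ?q (?e x y')"
    if "x \<in> carrier M" "y \<in> carrier N" "y' \<in> carrier N" for x y y'
    unfolding linear_map_add[OF lin basis_pair_closed[OF that(1,2)] basis_pair_closed[OF that(1,3)], symmetric]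
    using that by (intro kernel_imp_eq) (simp_all, unfold tensor_relations_iff Let_def, blast)
  moreover have "?q (?e (r \<odot>\<^bsub>M\<^esub> x) y) = r \<odot>\<^bsub>T\<^esub> ?q (?e x y)"
    if "r \<in> carrier R" "x \<in> carrier M" "y \<in> carrier N" for r x y
    unfolding linear_map_smult[OF lin that(1) basis_pair_closed[OF that(2,3)], symmetric]
    using that by (intro kernel_imp_eq) (simp_all, unfold tensor_relations_iff Let_def, blast)
  moreover have "?q (?e x (r \<odot>\<^bsub>N\<^esub> y)) = r \<odot>\<^bsub>T\<^esub> ?q (?e x y)"
    if "r \<in> carrier R" "x \<in> carrier M" "y \<in> carrier N" for r x y
    unfolding linear_map_smult[OF lin that(1) basis_pair_closed[OF that(2,3)], symmetric]
    using that by (intro kernel_imp_eq) (simp_all, unfold tensor_relations_iff Let_def, blast)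
  ultimately show ?thesis
    by (intro bilinear_mapI linear_mapI) (simp_all, simp_all add: tensor_def)
qed

lemma linear_tensor_left: "y \<in> carrier N \<Longrightarrow> linear_map R M T (\<lambda>x. tensor R M N x y)"
  and linear_tensor_right: "x \<in> carrier M \<Longrightarrow> linear_map R N T (tensor R M N x)"
  using bilinear_tensor by (auto simp: bilinear_map_def)

text \<open>A bilinear map extends linearly to the free module on pairs, and each of the four
  families of relations is killed by one of the four clauses of bilinearity.\<close>

lemma bilinear_free_lift:
  assumes "module R P" "bilinear_map R M N P \<beta>"
  shows "linear_map R F P (free_lift R P (\<lambda>p. \<beta> (fst p) (snd p)))"
    and "\<And>x y. x \<in> carrier M \<Longrightarrow> y \<in> carrier N \<Longrightarrow>
      free_lift R P (\<lambda>p. \<beta> (fst p) (snd p)) (basis_elem R (x, y)) = \<beta> x y"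
    and "\<And>f. f \<in> tensor_kernel R M N \<Longrightarrow> free_lift R P (\<lambda>p. \<beta> (fst p) (snd p)) f = \<zero>\<^bsub>P\<^esub>"
proof -
  let ?f = "free_lift R P (\<lambda>p. \<beta> (fst p) (snd p))"
  interpret P: module R P by fact
  have \<beta>: "(\<lambda>p. \<beta> (fst p) (snd p)) \<in> carrier M \<times> carrier N \<rightarrow> carrier P"
    using bilinear_map_closed[OF assms(2)] by auto
  show lin: "linear_map R F P ?f"
    by (rule M.R.free_lift_linear[OF assms(1) \<beta>])
  show e: "?f (basis_elem R (x, y)) = \<beta> x y" if "x \<in> carrier M" "y \<in> carrier N" for x y
    using M.R.free_lift_basis[OF assms(1) \<beta>, of "(x, y)"] that by simp
  show "?f f = \<zero>\<^bsub>P\<^esub>" if "f \<in> tensor_kernel R M N" for f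
  proof (rule gen_submodule_kernel[OF F.module_axioms assms(1) lin relations_closed])
    show "f \<in> gen_submodule R F (tensor_relations R M N)"
      using that by (simp add: tensor_kernel_def)
    fix x assume "x \<in> tensor_relations R M N"
    then show "?f x = \<zero>\<^bsub>P\<^esub>"
      unfolding tensor_relations_iff Let_def
      by (elim disjE bexE)
        (simp_all add: linear_map_diff[OF F.module_axioms assms(1) lin] linear_map_add[OF lin]
          linear_map_smult[OF lin] e basis_pair_closed
          linear_map_add[OF bilinear_map_left[OF assms(2)]] linear_map_add[OF bilinear_map_right[OF assms(2)]]
          linear_map_smult[OF bilinear_map_left[OF assms(2)]] linear_map_smult[OF bilinear_map_right[OF assms(2)]]
          bilinear_map_closed[OF assms(2)] P.M.minus_eq_zero_iff)
  qed
qed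

lemma carrier_tensor: "carrier T = (\<lambda>f. tensor_kernel R M N +>\<^bsub>F\<^esub> f) ` carrier F"
  unfolding tensor_module_def by (rule Q.carrier_quotient)

lemma tensor_lift_coset:
  assumes "module R P" "bilinear_map R M N P \<beta>" "f \<in> carrier F"
  shows "tensor_lift R P \<beta> (tensor_kernel R M N +>\<^bsub>F\<^esub> f) = free_lift R P (\<lambda>p. \<beta> (fst p) (snd p)) f"
proof -
  interpret P: module R P by fact
  let ?f = "free_lift R P (\<lambda>p. \<beta> (fst p) (snd p))"
  let ?X = "tensor_kernel R M N +>\<^bsub>F\<^esub> f"
  \<comment> \<open>This is the representative that \<open>tensor_lift\<close> picks. It differs
    from \<open>f\<close> by an element of the kernel, on which the linear extension
    vanishes.\<close>
  define g where "g = (SOME g. g \<in> ?X)"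
  have "g \<in> ?X"
    using someI[of "\<lambda>g. g \<in> ?X" f, OF Q.N.a_rcos_self[OF assms(3)]] by (simp only: g_def)
  then have g: "g \<in> carrier F"
    using Q.N.a_elemrcos_carrier assms(3) by blast
  have "g \<ominus>\<^bsub>F\<^esub> f \<in> tensor_kernel R M N"
    using \<open>g \<in> ?X\<close> Q.N.a_rcos_module[OF assms(3) g] by (simp add: a_minus_def)
  then have "?f g \<ominus>\<^bsub>P\<^esub> ?f f = \<zero>\<^bsub>P\<^esub>"
    using bilinear_free_lift(3)[OF assms(1,2)]
      linear_map_diff[OF F.module_axioms assms(1) bilinear_free_lift(1)[OF assms(1,2)] g assms(3)] by simp
  then have "?f g = ?f f"
    using linear_map_closed[OF bilinear_free_lift(1)[OF assms(1,2)]] g assms(3)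
    by (simp add: P.M.minus_eq_zero_iff)
  then show ?thesis
    by (simp add: tensor_lift_def free_lift_def g_def Let_def)
qed

lemma linear_tensor_lift:
  assumes "module R P" "bilinear_map R M N P \<beta>"
  shows "linear_map R T P (tensor_lift R P \<beta>)"
proof -
  obtain G where G: "linear_map R T P G"
    "\<And>f. f \<in> carrier F \<Longrightarrow> G (tensor_kernel R M N +>\<^bsub>F\<^esub> f) = free_lift R P (\<lambda>p. \<beta> (fst p) (snd p)) f"
    using Q.quotient_factor[OF assms(1) bilinear_free_lift(1,3)[OF assms], folded tensor_module_def] by blast
  have "G t = tensor_lift R P \<beta> t" if "t \<in> carrier T" for t
    using that G(2) tensor_lift_coset[OF assms] unfolding carrier_tensor by (auto)
  then show ?thesis
    by (rule linear_map_cong[OF G(1) T.module_axioms])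
qed

lemma tensor_lift_tensor:
  assumes "module R P" "bilinear_map R M N P \<beta>" "x \<in> carrier M" "y \<in> carrier N"
  shows "tensor_lift R P \<beta> (tensor R M N x y) = \<beta> x y"
  unfolding tensor_def using tensor_lift_coset[OF assms(1,2)] bilinear_free_lift(2)[OF assms(1,2)] assms(3,4)
  by (simp add: basis_pair_closed)

text \<open>Pure tensors are the images of the basis of the free module on pairs. Identities in
  tensor products are reduced to pure tensors by this lemma.\<close>

lemma tensor_ext:
  assumes "module R P" "linear_map R T P f" "linear_map R T P g"
    and "\<And>x y. x \<in> carrier M \<Longrightarrow> y \<in> carrier N \<Longrightarrow> f (tensor R M N x y) = g (tensor R M N x y)"
    and "t \<in> carrier T"
  shows "f t = g t"
proof -
  let ?q = "\<lambda>x. tensor_kernel R M N +>\<^bsub>F\<^esub> x"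
  obtain u where u: "u \<in> carrier F" "t = ?q u"
    using assms(5) unfolding carrier_tensor by blast
  have lin: "linear_map R F T ?q"
    unfolding tensor_module_def by (rule Q.linear_quotient_proj)
  have "f (?q u) = g (?q u)"
    by (rule M.R.free_module_ext[OF assms(1) linear_map_comp[OF lin assms(2)] linear_map_comp[OF lin assms(3)] _ u(1)])
      (use assms(4) in \<open>auto simp: tensor_def\<close>)
  with u show ?thesis by simp
qed

lemma linear_map_tensor_lift:
  assumes "module R P" "module R Q" "bilinear_map R M N P \<beta>" "linear_map R P Q f" "t \<in> carrier T"
  shows "f (tensor_lift R P \<beta> t) = tensor_lift R Q (\<lambda>x y. f (\<beta> x y)) t"
  by (rule tensor_ext[OF assms(2) linear_map_comp[OF linear_tensor_lift[OF assms(1,3)] assms(4)]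
      linear_tensor_lift[OF assms(2) bilinear_map_comp[OF assms(3,4)]] _ assms(5)])
    (simp add: tensor_lift_tensor[OF assms(1,3)] tensor_lift_tensor[OF assms(2) bilinear_map_comp[OF assms(3,4)]])

text \<open>Rewriting under a Sweedler sum. Bilinearity of \<open>\<gamma>\<close> is inherited from
  \<open>\<beta>\<close>, with which it agrees on the carriers.\<close>

lemma tensor_lift_cong:
  assumes "module R P" "bilinear_map R M N P \<beta>"
    and "\<And>x y. x \<in> carrier M \<Longrightarrow> y \<in> carrier N \<Longrightarrow> \<beta> x y = \<gamma> x y" and "t \<in> carrier T"
  shows "tensor_lift R P \<beta> t = tensor_lift R P \<gamma> t"
proof -
  have \<gamma>: "bilinear_map R M N P \<gamma>"
  proof (rule bilinear_mapI)
    show "linear_map R N P (\<gamma> x)" if "x \<in> carrier M" for x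
      using bilinear_map_right[OF assms(2) that]
      by (rule linear_map_cong[OF _ N.module_axioms]) (rule assms(3)[OF that])
    show "linear_map R M P (\<lambda>x. \<gamma> x y)" if "y \<in> carrier N" for y
      using bilinear_map_left[OF assms(2) that]
      by (rule linear_map_cong[OF _ M.module_axioms]) (rule assms(3)[OF _ that])
  qed
  show ?thesis
    by (rule tensor_ext[OF assms(1) linear_tensor_lift[OF assms(1,2)] linear_tensor_lift[OF assms(1) \<gamma>] _ assms(4)])
      (simp add: tensor_lift_tensor[OF assms(1,2)] tensor_lift_tensor[OF assms(1) \<gamma>] assms(3))
qed

lemma tensor_lift_plus:
  assumes "module R P" "bilinear_map R M N P \<beta>" "bilinear_map R M N P \<gamma>" "t \<in> carrier T"
  shows "tensor_lift R P (\<lambda>x y. \<beta> x y \<oplus>\<^bsub>P\<^esub> \<gamma> x y) t = tensor_lift R P \<beta> t \<oplus>\<^bsub>P\<^esub> tensor_lift R P \<gamma> t"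
  by (rule tensor_ext[OF assms(1) linear_tensor_lift[OF assms(1) bilinear_map_plus[OF assms(1-3)]]
      linear_map_plus[OF assms(1) linear_tensor_lift[OF assms(1,2)] linear_tensor_lift[OF assms(1,3)]] _ assms(4)])
    (simp add: tensor_lift_tensor[OF assms(1,2)] tensor_lift_tensor[OF assms(1,3)]
      tensor_lift_tensor[OF assms(1) bilinear_map_plus[OF assms(1-3)]])

lemma tensor_lift_minus:
  assumes "module R P" "bilinear_map R M N P \<beta>" "bilinear_map R M N P \<gamma>" "t \<in> carrier T"
  shows "tensor_lift R P (\<lambda>x y. \<beta> x y \<ominus>\<^bsub>P\<^esub> \<gamma> x y) t = tensor_lift R P \<beta> t \<ominus>\<^bsub>P\<^esub> tensor_lift R P \<gamma> t"
  by (rule tensor_ext[OF assms(1) linear_tensor_lift[OF assms(1) bilinear_map_minus[OF assms(1-3)]]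
      linear_map_minus[OF assms(1) linear_tensor_lift[OF assms(1,2)] linear_tensor_lift[OF assms(1,3)]] _ assms(4)])
    (simp add: tensor_lift_tensor[OF assms(1,2)] tensor_lift_tensor[OF assms(1,3)]
      tensor_lift_tensor[OF assms(1) bilinear_map_minus[OF assms(1-3)]])

lemma tensor_lift_closed:
  assumes "module R P" "bilinear_map R M N P \<beta>" "t \<in> carrier T"
  shows "tensor_lift R P \<beta> t \<in> carrier P"
  by (rule linear_map_closed[OF linear_tensor_lift[OF assms(1,2)] assms(3)])

lemma tensor_lift_self: "t \<in> carrier T \<Longrightarrow> tensor_lift R T (tensor R M N) t = t"
  by (rule tensor_ext[OF T.module_axioms linear_tensor_lift[OF T.module_axioms bilinear_tensor] linear_map_ident])
    (simp_all add: tensor_lift_tensor[OF T.module_axioms bilinear_tensor])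

text \<open>For nested Sweedler sums: the inner sum depends on a variable of the outer one and has
  to be linear in it before the outer sum makes sense.\<close>

lemma linear_tensor_lift_param:
  assumes P: "module R P" and X: "module R X"
    and \<beta>: "\<And>x. x \<in> carrier X \<Longrightarrow> bilinear_map R M N P (\<beta> x)"
    and lin: "\<And>m n. m \<in> carrier M \<Longrightarrow> n \<in> carrier N \<Longrightarrow> linear_map R X P (\<lambda>x. \<beta> x m n)"
    and t: "t \<in> carrier T"
  shows "linear_map R X P (\<lambda>x. tensor_lift R P (\<beta> x) t)"
proof -
  interpret X: module R X by (rule X)
  show ?thesis
  proof (rule linear_mapI)
    show "tensor_lift R P (\<beta> x) t \<in> carrier P" if "x \<in> carrier X" for x
      by (rule tensor_lift_closed[OF P \<beta>[OF that] t])
    fix x assume x: "x \<in> carrier X"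
    show "tensor_lift R P (\<beta> (x \<oplus>\<^bsub>X\<^esub> y)) t = tensor_lift R P (\<beta> x) t \<oplus>\<^bsub>P\<^esub> tensor_lift R P (\<beta> y) t"
      if y: "y \<in> carrier X" for y
    proof (rule tensor_ext[OF P linear_tensor_lift[OF P \<beta>]
          linear_map_plus[OF P linear_tensor_lift[OF P \<beta>] linear_tensor_lift[OF P \<beta>]] _ t])
      fix m n assume mn: "m \<in> carrier M" "n \<in> carrier N"
      show "tensor_lift R P (\<beta> (x \<oplus>\<^bsub>X\<^esub> y)) (tensor R M N m n) =
        tensor_lift R P (\<beta> x) (tensor R M N m n) \<oplus>\<^bsub>P\<^esub> tensor_lift R P (\<beta> y) (tensor R M N m n)"
        using x y by (simp add: tensor_lift_tensor[OF P \<beta> mn] linear_map_add[OF lin[OF mn]])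
    qed (use x y in simp_all)
    show "tensor_lift R P (\<beta> (r \<odot>\<^bsub>X\<^esub> x)) t = r \<odot>\<^bsub>P\<^esub> tensor_lift R P (\<beta> x) t"
      if r: "r \<in> carrier R" for r
    proof (rule tensor_ext[OF P linear_tensor_lift[OF P \<beta>] linear_map_scale[OF P linear_tensor_lift[OF P \<beta>]] _ t])
      fix m n assume mn: "m \<in> carrier M" "n \<in> carrier N"
      show "tensor_lift R P (\<beta> (r \<odot>\<^bsub>X\<^esub> x)) (tensor R M N m n) = r \<odot>\<^bsub>P\<^esub> tensor_lift R P (\<beta> x) (tensor R M N m n)"
        using x r by (simp add: tensor_lift_tensor[OF P \<beta> mn] linear_map_smult[OF lin[OF mn]])
    qed (use x r in simp_all)
  qed
qed

lemma bilinear_tensor_map: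
  assumes "module R M'" "module R N'" "linear_map R M M' f" "linear_map R N N' g"
  shows "bilinear_map R M N (tensor_module R M' N') (\<lambda>a b. tensor R M' N' (f a) (g b))"
proof -
  interpret T': tensor_prod R M' N' by (intro tensor_prod.intro assms)
  show ?thesis by (rule bilinear_map_comp2[OF T'.bilinear_tensor assms(3,4)])
qed

text \<open>Substitution in a Sweedler sum: applying \<open>f \<otimes> g\<close> to a tensor
  amounts to inserting \<open>f\<close> and \<open>g\<close> into the two slots of whatever is
  summed afterwards.\<close>

lemma tensor_lift_map:
  assumes M': "module R M'" and N': "module R N'" and P: "module R P"
    and f: "linear_map R M M' f" and g: "linear_map R N N' g" and \<beta>: "bilinear_map R M' N' P \<beta>"
    and t: "t \<in> carrier T"
  shows "tensor_lift R P \<beta> (tensor_lift R (tensor_module R M' N') (\<lambda>a b. tensor R M' N' (f a) (g b)) t) =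
    tensor_lift R P (\<lambda>a b. \<beta> (f a) (g b)) t"
proof -
  interpret T': tensor_prod R M' N' by (intro tensor_prod.intro assms)
  note b = bilinear_tensor_map[OF M' N' f g]
  note \<beta>' = bilinear_map_comp2[OF \<beta> f g]
  show ?thesis
    by (rule tensor_ext[OF P linear_map_comp[OF linear_tensor_lift[OF T'.T.module_axioms b] T'.linear_tensor_lift[OF P \<beta>]]
          linear_tensor_lift[OF P \<beta>'] _ t])
      (simp add: tensor_lift_tensor[OF T'.T.module_axioms b] tensor_lift_tensor[OF P \<beta>']
        T'.tensor_lift_tensor[OF P \<beta>] linear_map_closed[OF f] linear_map_closed[OF g])
qed

end

section \<open>Associative algebras\<close>

lemma assoc_algebraI:
  fixes R (structure) and A (structure)
  assumes A: "module R A" and bil: "bilinear_map R A A A (mult A)" and mult_one: "\<one>\<^bsub>A\<^esub> \<in> carrier A"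
    and mult_assoc: "\<And>x y z. \<lbrakk>x \<in> carrier A; y \<in> carrier A; z \<in> carrier A\<rbrakk>
      \<Longrightarrow> (x \<otimes>\<^bsub>A\<^esub> y) \<otimes>\<^bsub>A\<^esub> z = x \<otimes>\<^bsub>A\<^esub> (y \<otimes>\<^bsub>A\<^esub> z)"
    and mult_l_one: "\<And>x. x \<in> carrier A \<Longrightarrow> \<one>\<^bsub>A\<^esub> \<otimes>\<^bsub>A\<^esub> x = x"
    and mult_r_one: "\<And>x. x \<in> carrier A \<Longrightarrow> x \<otimes>\<^bsub>A\<^esub> \<one>\<^bsub>A\<^esub> = x"
  shows "assoc_algebra R A"
proof -
  interpret module R A by (rule A)
  note left = bilinear_map_left[OF bil] and right = bilinear_map_right[OF bil]
  have "ring A"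
  proof (rule ringI)
    show "monoid A"
      by (rule monoidI) (simp_all add: mult_one mult_assoc mult_l_one mult_r_one bilinear_map_closed[OF bil])
  qed (use M.abelian_group_axioms linear_map_add[OF left] linear_map_add[OF right] in simp_all)
  then show ?thesis
    by (intro assoc_algebra.intro A assoc_algebra_axioms.intro)
      (simp_all add: linear_map_smult[OF left] linear_map_smult[OF right])
qed

context assoc_algebra
begin

lemma bilinear_mult: "bilinear_map R A A A (mult A)"
  by (intro bilinear_mapI linear_mapI)
    (simp_all add: l_distr r_distr smult_mult_left smult_mult_right)

lemma linear_mult_left: "y \<in> carrier A \<Longrightarrow> linear_map R A A (\<lambda>x. x \<otimes>\<^bsub>A\<^esub> y)"
  and linear_mult_right: "x \<in> carrier A \<Longrightarrow> linear_map R A A (\<lambda>y. x \<otimes>\<^bsub>A\<^esub> y)"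
  using bilinear_mult by (auto simp: bilinear_map_def)

text \<open>A scalar acts as multiplication by a multiple of the unit, so an ideal absorbs
  it.\<close>

lemma ideal_submodule:
  assumes "ideal I A"
  shows "submodule I R A"
proof -
  interpret I: ideal I A by fact
  show ?thesis
  proof (rule submoduleI)
    show "r \<odot>\<^bsub>A\<^esub> x \<in> I" if "r \<in> carrier R" "x \<in> I" for r x
      using I.I_l_closed[OF that(2), of "r \<odot>\<^bsub>A\<^esub> \<one>\<^bsub>A\<^esub>"] that smult_mult_left[of r "\<one>\<^bsub>A\<^esub>" x] by simp
  qed (use I.a_subset in auto)
qed

lemma quotient_module: "ideal I A \<Longrightarrow> quotient_module R A I"
  by (intro quotient_module.intro quotient_module_axioms.intro module_axioms ideal_submodule)

lemma mult_quotient: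
  assumes "ideal I A" "x \<in> carrier A" "y \<in> carrier A"
  shows "(I +>\<^bsub>A\<^esub> x) \<otimes>\<^bsub>quotient_by A I\<^esub> (I +>\<^bsub>A\<^esub> y) = I +>\<^bsub>A\<^esub> (x \<otimes>\<^bsub>A\<^esub> y)"
  using ideal.rcoset_mult_add[OF assms] by (simp add: quotient_by_simps FactRing_def)

lemma one_quotient: "\<one>\<^bsub>quotient_by A I\<^esub> = I +>\<^bsub>A\<^esub> \<one>\<^bsub>A\<^esub>"
  by (simp add: quotient_by_simps FactRing_def)

lemma assoc_algebra_quotient:
  assumes "ideal I A"
  shows "assoc_algebra R (quotient_by A I)"
proof -
  interpret Q: quotient_module R A I by (rule quotient_module[OF assms])
  note [simp] = Q.carrier_quotient Q.add_quotient Q.smult_quotient mult_quotient[OF assms] one_quotient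
  have "bilinear_map R (quotient_by A I) (quotient_by A I) (quotient_by A I) (mult (quotient_by A I))"
    by (intro bilinear_mapI linear_mapI)
      (auto simp: l_distr r_distr smult_mult_left smult_mult_right)
  then show ?thesis
    by (intro assoc_algebraI Q.module_quotient) (auto simp: m_assoc)
qed

text \<open>\<open>F\<close> is linear but may fail to be multiplicative, and then its kernel may
  fail to be an ideal. The set \<open>?K\<close> of those \<open>x\<close> all of whose two-sided
  multiples \<open>a x b\<close> are killed is an ideal; \<open>a = b = 1\<close> leads back to
  \<open>F x\<close>.\<close>

lemma genideal_kernel:
  assumes P: "module R P" and F: "linear_map R A P F" and X: "X \<subseteq> carrier A"
    and 0: "\<And>a x b. \<lbrakk>a \<in> carrier A; x \<in> X; b \<in> carrier A\<rbrakk> \<Longrightarrow> F (a \<otimes>\<^bsub>A\<^esub> x \<otimes>\<^bsub>A\<^esub> b) = \<zero>\<^bsub>P\<^esub>"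
    and x: "x \<in> Idl\<^bsub>A\<^esub> X"
  shows "F x = \<zero>\<^bsub>P\<^esub>"
proof -
  interpret P: module R P by fact
  let ?K = "{x \<in> carrier A. \<forall>a\<in>carrier A. \<forall>b\<in>carrier A. F (a \<otimes>\<^bsub>A\<^esub> x \<otimes>\<^bsub>A\<^esub> b) = \<zero>\<^bsub>P\<^esub>}"
  have "submodule ?K R A"
    by (rule submoduleI)
      (auto simp: l_distr r_distr l_minus r_minus linear_map_add[OF F] linear_map_zero[OF module_axioms P F]
        linear_map_uminus[OF module_axioms P F] linear_map_smult[OF F] smult_mult_left smult_mult_right)
  then have "subgroup ?K (add_monoid A)" by (simp add: submodule_def)
  then have "ideal ?K A"
  proof (rule idealI[OF ring_axioms])
    fix x y assume x: "x \<in> ?K" and y: "y \<in> carrier A"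
    show "y \<otimes>\<^bsub>A\<^esub> x \<in> ?K"
    proof -
      have "F (a \<otimes>\<^bsub>A\<^esub> (y \<otimes>\<^bsub>A\<^esub> x) \<otimes>\<^bsub>A\<^esub> b) = \<zero>\<^bsub>P\<^esub>" if "a \<in> carrier A" "b \<in> carrier A" for a b
      proof -
        have "F (a \<otimes>\<^bsub>A\<^esub> y \<otimes>\<^bsub>A\<^esub> x \<otimes>\<^bsub>A\<^esub> b) = \<zero>\<^bsub>P\<^esub>" using x y that by simp
        then show ?thesis using x y that by (simp add: m_assoc)
      qed
      then show ?thesis using x y by simp
    qed
    show "x \<otimes>\<^bsub>A\<^esub> y \<in> ?K"
    proof -
      have "F (a \<otimes>\<^bsub>A\<^esub> (x \<otimes>\<^bsub>A\<^esub> y) \<otimes>\<^bsub>A\<^esub> b) = \<zero>\<^bsub>P\<^esub>" if "a \<in> carrier A" "b \<in> carrier A" for a b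
      proof -
        have "F (a \<otimes>\<^bsub>A\<^esub> x \<otimes>\<^bsub>A\<^esub> (y \<otimes>\<^bsub>A\<^esub> b)) = \<zero>\<^bsub>P\<^esub>" using x y that by simp
        then show ?thesis using x y that by (simp add: m_assoc)
      qed
      then show ?thesis using x y by simp
    qed
  qed
  moreover have "X \<subseteq> ?K" using X 0 by blast
  ultimately have "x \<in> ?K" using x unfolding genideal_def by blast
  then have "x \<in> carrier A" "F (\<one>\<^bsub>A\<^esub> \<otimes>\<^bsub>A\<^esub> x \<otimes>\<^bsub>A\<^esub> \<one>\<^bsub>A\<^esub>) = \<zero>\<^bsub>P\<^esub>" by blast+
  then show ?thesis by simp
qed

lemma genideal_factor:
  assumes "module R P" "linear_map R A P F" "X \<subseteq> carrier A"
    and "\<And>a x b. \<lbrakk>a \<in> carrier A; x \<in> X; b \<in> carrier A\<rbrakk> \<Longrightarrow> F (a \<otimes>\<^bsub>A\<^esub> x \<otimes>\<^bsub>A\<^esub> b) = \<zero>\<^bsub>P\<^esub>"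
  obtains G where "linear_map R (quotient_by A (Idl\<^bsub>A\<^esub> X)) P G"
    and "\<And>x. x \<in> carrier A \<Longrightarrow> G (Idl\<^bsub>A\<^esub> X +>\<^bsub>A\<^esub> x) = F x"
proof -
  interpret Q: quotient_module R A "Idl\<^bsub>A\<^esub> X"
    by (rule quotient_module[OF genideal_ideal[OF assms(3)]])
  show thesis
    using Q.quotient_factor[OF assms(1,2)] genideal_kernel[OF assms] that by blast
qed

end

lemma module_cong:
  assumes "module R M" "carrier N = carrier M" "zero N = zero M" "add N = add M" "smult N = smult M"
  shows "module R N"
proof -
  interpret module R M by fact
  have "abelian_group N"
    by (rule abelian_groupI) (use assms M.a_ac M.l_neg in \<open>auto intro: exI[of _ "\<ominus>\<^bsub>M\<^esub> _"]\<close>)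
  then show ?thesis
    by (intro moduleI R.is_cring)
      (simp_all add: assms smult_l_distr smult_r_distr smult_assoc1)
qed

section \<open>The tensor product of algebras\<close>

locale tensor_alg = A: assoc_algebra R A + B: assoc_algebra R B
  for R (structure) and A and B
begin

sublocale tensor_prod R A B by unfold_locales

abbreviation "TA \<equiv> tensor_product_algebra R A B"
abbreviation tens (infixl \<open>\<diamondop>\<close> 75) where "x \<diamondop> y \<equiv> tensor R A B x y"

lemma TA_simps [simp]:
  "carrier TA = carrier T" "zero TA = zero T" "add TA = add T" "smult TA = smult T"
  "\<one>\<^bsub>TA\<^esub> = \<one>\<^bsub>A\<^esub> \<diamondop> \<one>\<^bsub>B\<^esub>"
  by (simp_all add: tensor_product_algebra_def)

lemma module_TA: "module R TA"
  by (rule module_cong[OF T.module_axioms]) simp_all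

lemma linear_TA [simp]: "linear_map R TA P f \<longleftrightarrow> linear_map R T P f" "linear_map R Q TA g \<longleftrightarrow> linear_map R Q T g"
  by (simp_all add: linear_map_def)

lemma bilinear_tens_mult:
  assumes "a \<in> carrier A" "b \<in> carrier B"
  shows "bilinear_map R A B T (\<lambda>c d. (a \<otimes>\<^bsub>A\<^esub> c) \<diamondop> (b \<otimes>\<^bsub>B\<^esub> d))"
  by (rule bilinear_map_comp2[OF bilinear_tensor A.linear_mult_right[OF assms(1)] B.linear_mult_right[OF assms(2)]])

lemma bilinear_tens_lift:
  assumes "t \<in> carrier T"
  shows "bilinear_map R A B T (\<lambda>a b. tensor_lift R T (\<lambda>c d. (a \<otimes>\<^bsub>A\<^esub> c) \<diamondop> (b \<otimes>\<^bsub>B\<^esub> d)) t)"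
proof (rule bilinear_mapI)
  fix a assume a: "a \<in> carrier A"
  show "linear_map R B T (\<lambda>b. tensor_lift R T (\<lambda>c d. (a \<otimes>\<^bsub>A\<^esub> c) \<diamondop> (b \<otimes>\<^bsub>B\<^esub> d)) t)"
    by (rule linear_tensor_lift_param[OF T.module_axioms B.module_axioms bilinear_tens_mult[OF a] _ assms])
      (auto intro!: linear_map_comp[OF B.linear_mult_left linear_tensor_right] a)
next
  fix b assume b: "b \<in> carrier B"
  show "linear_map R A T (\<lambda>a. tensor_lift R T (\<lambda>c d. (a \<otimes>\<^bsub>A\<^esub> c) \<diamondop> (b \<otimes>\<^bsub>B\<^esub> d)) t)"
    by (rule linear_tensor_lift_param[OF T.module_axioms A.module_axioms bilinear_tens_mult[OF _ b] _ assms])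
      (auto intro!: linear_map_comp[OF A.linear_mult_left linear_tensor_left] b)
qed

lemma mult_TA:
  "s \<otimes>\<^bsub>TA\<^esub> t = tensor_lift R T (\<lambda>a b. tensor_lift R T (\<lambda>c d. (a \<otimes>\<^bsub>A\<^esub> c) \<diamondop> (b \<otimes>\<^bsub>B\<^esub> d)) t) s"
  by (simp add: tensor_product_algebra_def)

lemma linear_TA_left: "t \<in> carrier T \<Longrightarrow> linear_map R T T (\<lambda>s. s \<otimes>\<^bsub>TA\<^esub> t)"
  unfolding mult_TA by (rule linear_tensor_lift[OF T.module_axioms bilinear_tens_lift])

lemma linear_TA_right:
  assumes "s \<in> carrier T"
  shows "linear_map R T T (\<lambda>t. s \<otimes>\<^bsub>TA\<^esub> t)"
  unfolding mult_TA
  by (rule linear_tensor_lift_param[OF T.module_axioms T.module_axioms bilinear_tens_lift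
      linear_tensor_lift[OF T.module_axioms bilinear_tens_mult] assms])

lemma mult_tens:
  "\<lbrakk>a \<in> carrier A; b \<in> carrier B; c \<in> carrier A; d \<in> carrier B\<rbrakk>
    \<Longrightarrow> (a \<diamondop> b) \<otimes>\<^bsub>TA\<^esub> (c \<diamondop> d) = (a \<otimes>\<^bsub>A\<^esub> c) \<diamondop> (b \<otimes>\<^bsub>B\<^esub> d)"
  unfolding mult_TA
  by (simp add: tensor_lift_tensor[OF T.module_axioms bilinear_tens_lift]
      tensor_lift_tensor[OF T.module_axioms bilinear_tens_mult])

lemma mult_TA_tens:
  assumes "s \<in> carrier T" "c \<in> carrier A" "d \<in> carrier B"
  shows "s \<otimes>\<^bsub>TA\<^esub> (c \<diamondop> d) = tensor_lift R T (\<lambda>a b. (a \<otimes>\<^bsub>A\<^esub> c) \<diamondop> (b \<otimes>\<^bsub>B\<^esub> d)) s"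
  unfolding mult_TA using assms
  by (intro tensor_lift_cong[OF T.module_axioms bilinear_tens_lift])
    (simp_all add: tensor_lift_tensor[OF T.module_axioms bilinear_tens_mult])

lemma assoc_algebra_TA: "assoc_algebra R TA"
proof (rule assoc_algebraI[OF module_TA])
  show "bilinear_map R TA TA TA (mult TA)"
    by (rule bilinear_mapI) (simp_all add: linear_TA_left linear_TA_right)
  note L = linear_TA_left and R = linear_TA_right
  have c: "x \<otimes>\<^bsub>TA\<^esub> y \<in> carrier T" if "x \<in> carrier T" "y \<in> carrier T" for x y
    using linear_map_closed[OF L[OF that(2)] that(1)] .
  \<comment> \<open>Associativity is reduced to pure tensors one factor at a time: the last factor
    here, then the middle one, then the first.\<close>
  have 1: "(a \<diamondop> b) \<otimes>\<^bsub>TA\<^esub> (c \<diamondop> d) \<otimes>\<^bsub>TA\<^esub> z = (a \<diamondop> b) \<otimes>\<^bsub>TA\<^esub> ((c \<diamondop> d) \<otimes>\<^bsub>TA\<^esub> z)"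
    if [simp]: "a \<in> carrier A" "b \<in> carrier B" "c \<in> carrier A" "d \<in> carrier B" and z: "z \<in> carrier T" for a b c d z
    by (rule tensor_ext[OF T.module_axioms R linear_map_comp[OF R R] _ z])
      (simp_all add: c mult_tens A.m_assoc B.m_assoc)
  have 2: "(a \<diamondop> b) \<otimes>\<^bsub>TA\<^esub> y \<otimes>\<^bsub>TA\<^esub> z = (a \<diamondop> b) \<otimes>\<^bsub>TA\<^esub> (y \<otimes>\<^bsub>TA\<^esub> z)"
    if [simp]: "a \<in> carrier A" "b \<in> carrier B" "z \<in> carrier T" and y: "y \<in> carrier T" for a b y z
    by (rule tensor_ext[OF T.module_axioms linear_map_comp[OF R L] linear_map_comp[OF L R] _ y])
      (simp_all add: c 1)
  show "x \<otimes>\<^bsub>TA\<^esub> y \<otimes>\<^bsub>TA\<^esub> z = x \<otimes>\<^bsub>TA\<^esub> (y \<otimes>\<^bsub>TA\<^esub> z)"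
    if "x \<in> carrier TA" "y \<in> carrier TA" "z \<in> carrier TA" for x y z
    by (rule tensor_ext[OF T.module_axioms linear_map_comp[OF L L] L, where t=x])
      (use that in \<open>simp_all add: c 2\<close>)
  show "\<one>\<^bsub>TA\<^esub> \<otimes>\<^bsub>TA\<^esub> x = x" if "x \<in> carrier TA" for x
    by (rule tensor_ext[OF T.module_axioms R linear_map_ident])
      (use that in \<open>simp_all add: mult_tens\<close>)
  show "x \<otimes>\<^bsub>TA\<^esub> \<one>\<^bsub>TA\<^esub> = x" if "x \<in> carrier TA" for x
    by (rule tensor_ext[OF T.module_axioms L linear_map_ident])
      (use that in \<open>simp_all add: mult_tens\<close>)
qed simp

end

section \<open>Free algebras\<close>

lemma free_algebra_simps:
  "carrier (free_algebra R B) = carrier (free_module R (lists B))"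
  "zero (free_algebra R B) = zero (free_module R (lists B))"
  "add (free_algebra R B) = add (free_module R (lists B))"
  "smult (free_algebra R B) = smult (free_module R (lists B))"
  "\<one>\<^bsub>free_algebra R B\<^esub> = basis_elem R []"
  "f \<otimes>\<^bsub>free_algebra R B\<^esub> g = (\<lambda>w. \<Oplus>\<^bsub>R\<^esub>i\<in>{..length w}. f (take i w) \<otimes>\<^bsub>R\<^esub> g (drop i w))"
  by (simp_all add: free_algebra_def)

context cring
begin

lemma module_free_algebra: "module R (free_algebra R B)"
  by (rule module_cong[OF module_free_module[of "lists B"]]) (simp_all add: free_algebra_simps)

lemma linear_free_algebra:
  "linear_map R (free_algebra R B) P f \<longleftrightarrow> linear_map R (free_module R (lists B)) P f"
  "linear_map R Q (free_algebra R B) g \<longleftrightarrow> linear_map R Q (free_module R (lists B)) g"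
  by (simp_all add: linear_map_def free_algebra_simps)

lemma free_algebra_ext:
  assumes "module R P" "linear_map R (free_algebra R B) P F" "linear_map R (free_algebra R B) P G"
    and "\<And>w. w \<in> lists B \<Longrightarrow> F (basis_elem R w) = G (basis_elem R w)"
    and "f \<in> carrier (free_algebra R B)"
  shows "F f = G f"
  by (rule free_module_ext[OF assms(1) assms(2,3)[unfolded linear_free_algebra] assms(4) assms(5)[unfolded free_algebra_simps]])

lemma basis_word_closed: "w \<in> lists B \<Longrightarrow> basis_elem R w \<in> carrier (free_algebra R B)"
  unfolding free_algebra_simps by (rule basis_elem_closed)

lemma free_algebra_value: "f \<in> carrier (free_algebra R B) \<Longrightarrow> f w \<in> carrier R"
  by (simp add: free_algebra_simps free_module_simps)

lemma free_mult_closed: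
  assumes "f \<in> carrier (free_algebra R B)" "g \<in> carrier (free_algebra R B)"
  shows "f \<otimes>\<^bsub>free_algebra R B\<^esub> g \<in> carrier (free_algebra R B)"
proof -
  note v = free_algebra_value[OF assms(1)] free_algebra_value[OF assms(2)]
  let ?h = "f \<otimes>\<^bsub>free_algebra R B\<^esub> g"
  have sf: "finite {w. f w \<noteq> \<zero>}" "{w. f w \<noteq> \<zero>} \<subseteq> lists B"
    and sg: "finite {w. g w \<noteq> \<zero>}" "{w. g w \<noteq> \<zero>} \<subseteq> lists B"
    using assms by (simp_all add: free_algebra_simps free_module_simps)
  \<comment> \<open>A nonzero coefficient at \<open>w\<close> requires a cut of \<open>w\<close>
    into a word of one support followed by a word of the other, which bounds the support of the
    product.\<close>
  have "{w. ?h w \<noteq> \<zero>} \<subseteq> (\<lambda>(u, v). u @ v) ` ({w. f w \<noteq> \<zero>} \<times> {w. g w \<noteq> \<zero>})" (is "_ \<subseteq> ?S")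
  proof
    fix w assume "w \<in> {w. ?h w \<noteq> \<zero>}"
    then have nz: "(\<Oplus>i\<in>{..length w}. f (take i w) \<otimes> g (drop i w)) \<noteq> \<zero>"
      by (simp add: free_algebra_simps)
    have "\<exists>i. f (take i w) \<otimes> g (drop i w) \<noteq> \<zero>"
    proof (rule ccontr)
      assume "\<nexists>i. f (take i w) \<otimes> g (drop i w) \<noteq> \<zero>"
      then have "(\<Oplus>i\<in>{..length w}. f (take i w) \<otimes> g (drop i w)) = \<zero>"
        by (intro add.finprod_one_eqI) blast
      with nz show False by blast
    qed
    then obtain i where "f (take i w) \<noteq> \<zero>" "g (drop i w) \<noteq> \<zero>"
      using v by (metis l_null r_null)
    then show "w \<in> ?S"
      by (intro image_eqI[of _ _ "(take i w, drop i w)"]) simp_all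
  qed
  moreover have "finite ?S" using sf sg by simp
  moreover have "?S \<subseteq> lists B"
  proof
    fix w assume "w \<in> ?S"
    then obtain u v where "w = u @ v" "f u \<noteq> \<zero>" "g v \<noteq> \<zero>" by auto
    then show "w \<in> lists B"
      using subsetD[OF sf(2), of u] subsetD[OF sg(2), of v] by simp
  qed
  ultimately have "finite {w. ?h w \<noteq> \<zero>}" "{w. ?h w \<noteq> \<zero>} \<subseteq> lists B"
    by (meson finite_subset subset_trans)+
  moreover have "?h w \<in> carrier R" for w
    unfolding free_algebra_simps by (rule finsum_closed) (simp add: v)
  ultimately show ?thesis
    unfolding free_algebra_simps(1) free_module_simps by simp
qed

lemma bilinear_free_mult:
  "bilinear_map R (free_algebra R B) (free_algebra R B) (free_algebra R B) (mult (free_algebra R B))"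
proof (intro bilinear_mapI linear_mapI free_mult_closed)
  note v = free_algebra_value
  note s = free_algebra_simps(3,4,6) free_module_simps(3,4)
  let ?F = "free_algebra R B"
  fix f g h assume f: "f \<in> carrier ?F" and g: "g \<in> carrier ?F"
  {
    assume h: "h \<in> carrier ?F"
    show "f \<otimes>\<^bsub>?F\<^esub> (g \<oplus>\<^bsub>?F\<^esub> h) = f \<otimes>\<^bsub>?F\<^esub> g \<oplus>\<^bsub>?F\<^esub> f \<otimes>\<^bsub>?F\<^esub> h"
      unfolding s by (simp add: v[OF f] v[OF g] v[OF h] r_distr finsum_addf)
    show "(g \<oplus>\<^bsub>?F\<^esub> h) \<otimes>\<^bsub>?F\<^esub> f = g \<otimes>\<^bsub>?F\<^esub> f \<oplus>\<^bsub>?F\<^esub> h \<otimes>\<^bsub>?F\<^esub> f"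
      unfolding s by (simp add: v[OF f] v[OF g] v[OF h] l_distr finsum_addf)
  }
  fix r assume r: "r \<in> carrier R"
  show "f \<otimes>\<^bsub>?F\<^esub> (r \<odot>\<^bsub>?F\<^esub> g) = r \<odot>\<^bsub>?F\<^esub> (f \<otimes>\<^bsub>?F\<^esub> g)"
    unfolding s by (simp add: v[OF f] v[OF g] r finsum_rdistr m_lcomm)
  show "(r \<odot>\<^bsub>?F\<^esub> g) \<otimes>\<^bsub>?F\<^esub> f = r \<odot>\<^bsub>?F\<^esub> (g \<otimes>\<^bsub>?F\<^esub> f)"
    unfolding s by (simp add: v[OF f] v[OF g] r finsum_rdistr m_assoc)
qed

lemma basis_mult: "basis_elem R u \<otimes>\<^bsub>free_algebra R B\<^esub> basis_elem R v = basis_elem R (u @ v)"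
proof
  fix w
  show "(basis_elem R u \<otimes>\<^bsub>free_algebra R B\<^esub> basis_elem R v) w = basis_elem R (u @ v) w"
  proof (cases "w = u @ v")
    case True
    \<comment> \<open>Among all cuts of \<open>u @ v\<close> only the one after
      \<open>length u\<close> letters contributes.\<close>
    have "i = length u" if "take i w = u" "i \<le> length w" for i
      using arg_cong[OF that(1), of length] that(2) by simp
    then have "(\<Oplus>i\<in>{..length w}. basis_elem R u (take i w) \<otimes> basis_elem R v (drop i w)) =
      (\<Oplus>i\<in>{..length w}. if length u = i then \<one> else \<zero>)"
      by (intro finsum_cong') (auto simp: True basis_elem_def)
    also have "\<dots> = \<one>"
      using add.finprod_singleton[of "length u" "{..length w}" "\<lambda>_. \<one>"] True by simp
    finally show ?thesis by (simp add: True free_algebra_simps basis_elem_def)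
  next
    case False
    then have "take i w \<noteq> u \<or> drop i w \<noteq> v" for i
      by (metis append_take_drop_id)
    then have "(\<Oplus>i\<in>{..length w}. basis_elem R u (take i w) \<otimes> basis_elem R v (drop i w)) = \<zero>"
      by (intro add.finprod_one_eqI) (auto simp: basis_elem_def)
    then show ?thesis using False by (simp add: free_algebra_simps basis_elem_def)
  qed
qed

lemma assoc_algebra_free: "assoc_algebra R (free_algebra R B)"
proof (rule assoc_algebraI[OF module_free_algebra bilinear_free_mult])
  let ?F = "free_algebra R B"
  note L = bilinear_map_left[OF bilinear_free_mult[of B]] and R = bilinear_map_right[OF bilinear_free_mult[of B]]
  note [simp] = free_mult_closed basis_word_closed basis_mult
  note ext = free_algebra_ext[OF module_free_algebra]
  show "\<one>\<^bsub>?F\<^esub> \<in> carrier ?F" by (simp add: free_algebra_simps(5))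
  show "\<one>\<^bsub>?F\<^esub> \<otimes>\<^bsub>?F\<^esub> x = x" if "x \<in> carrier ?F" for x
    by (rule ext[OF R linear_map_ident _ that]) (simp_all add: free_algebra_simps(5))
  show "x \<otimes>\<^bsub>?F\<^esub> \<one>\<^bsub>?F\<^esub> = x" if "x \<in> carrier ?F" for x
    by (rule ext[OF L linear_map_ident _ that]) (simp_all add: free_algebra_simps(5))
  have 1: "basis_elem R u \<otimes>\<^bsub>?F\<^esub> basis_elem R v \<otimes>\<^bsub>?F\<^esub> z = basis_elem R u \<otimes>\<^bsub>?F\<^esub> (basis_elem R v \<otimes>\<^bsub>?F\<^esub> z)"
    if [simp]: "u \<in> lists B" "v \<in> lists B" and z: "z \<in> carrier ?F" for u v z
    by (rule ext[OF R linear_map_comp[OF R R] _ z]) simp_all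
  have 2: "basis_elem R u \<otimes>\<^bsub>?F\<^esub> y \<otimes>\<^bsub>?F\<^esub> z = basis_elem R u \<otimes>\<^bsub>?F\<^esub> (y \<otimes>\<^bsub>?F\<^esub> z)"
    if [simp]: "u \<in> lists B" "z \<in> carrier ?F" and y: "y \<in> carrier ?F" for u y z
    by (rule ext[OF linear_map_comp[OF R L] linear_map_comp[OF L R] _ y]) (simp_all only: 1 that basis_word_closed)
  show "x \<otimes>\<^bsub>?F\<^esub> y \<otimes>\<^bsub>?F\<^esub> z = x \<otimes>\<^bsub>?F\<^esub> (y \<otimes>\<^bsub>?F\<^esub> z)"
    if x: "x \<in> carrier ?F" and "y \<in> carrier ?F" "z \<in> carrier ?F" for x y z
    by (rule ext[OF linear_map_comp[OF L L] L _ x]) (use that in \<open>simp_all add: 2\<close>)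
qed

end

section \<open>Enveloping algebras\<close>

locale bracket_module = module R L for R (structure) and L (structure) +
  fixes br :: "'c \<Rightarrow> 'c \<Rightarrow> 'c"
  assumes br_closed [simp, intro]: "\<lbrakk>x \<in> carrier L; y \<in> carrier L\<rbrakk> \<Longrightarrow> br x y \<in> carrier L"
begin

abbreviation "F \<equiv> free_algebra R (carrier L)"
abbreviation "TL \<equiv> tensor_algebra R L"
abbreviation "U \<equiv> enveloping_algebra R L br"
abbreviation "words \<equiv> lists (carrier L)"
abbreviation gen (\<open>\<iota>\<close>) where "\<iota> \<equiv> enveloping_gen R L br"
abbreviation proj_T (\<open>\<pi>\<^sub>T\<close>) where "\<pi>\<^sub>T a \<equiv> Idl\<^bsub>F\<^esub> (linearity_relations R L) +>\<^bsub>F\<^esub> a"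
abbreviation proj_U (\<open>\<pi>\<^sub>U\<close>) where "\<pi>\<^sub>U a \<equiv> enveloping_ideal R L br +>\<^bsub>TL\<^esub> a"
abbreviation "commutator_relations \<equiv>
  {(tensor_gen R L x \<otimes>\<^bsub>TL\<^esub> tensor_gen R L y \<ominus>\<^bsub>TL\<^esub> tensor_gen R L y \<otimes>\<^bsub>TL\<^esub> tensor_gen R L x)
    \<ominus>\<^bsub>TL\<^esub> tensor_gen R L (br x y) | x y. x \<in> carrier L \<and> y \<in> carrier L}"

text \<open>A monomial of the free algebra pushed through both quotients, hence the product of the
  generators of its letters. These elements span \<open>U\<close>, and linear maps out of
  \<open>U\<close> are compared and constructed on them.\<close>

definition word :: "'c list \<Rightarrow> ('c list \<Rightarrow> 'a) set set" where
  "word w = \<pi>\<^sub>U (\<pi>\<^sub>T (basis_elem R w))"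

sublocale F: assoc_algebra R F by (rule R.assoc_algebra_free)

lemma linearity_relations_iff:
  "x \<in> linearity_relations R L \<longleftrightarrow>
    (\<exists>a\<in>carrier L. \<exists>b\<in>carrier L. x = basis_elem R [a \<oplus>\<^bsub>L\<^esub> b] \<ominus>\<^bsub>F\<^esub> (basis_elem R [a] \<oplus>\<^bsub>F\<^esub> basis_elem R [b])) \<or>
    (\<exists>r\<in>carrier R. \<exists>a\<in>carrier L. x = basis_elem R [r \<odot>\<^bsub>L\<^esub> a] \<ominus>\<^bsub>F\<^esub> r \<odot>\<^bsub>F\<^esub> basis_elem R [a])"
  unfolding linearity_relations_def Let_def by blast

lemma basis_closed [simp]: "w \<in> words \<Longrightarrow> basis_elem R w \<in> carrier F"
  by (rule R.basis_word_closed)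

lemma linearity_relations_closed: "linearity_relations R L \<subseteq> carrier F"
proof
  fix x assume "x \<in> linearity_relations R L"
  then show "x \<in> carrier F"
    unfolding linearity_relations_iff by (elim disjE bexE) simp_all
qed

lemma ideal_T: "ideal (Idl\<^bsub>F\<^esub> (linearity_relations R L)) F"
  by (rule F.genideal_ideal[OF linearity_relations_closed])

sublocale T: assoc_algebra R TL
  unfolding tensor_algebra_def by (rule F.assoc_algebra_quotient[OF ideal_T])

sublocale QT: quotient_module R F "Idl\<^bsub>F\<^esub> (linearity_relations R L)"
  by (rule F.quotient_module[OF ideal_T])

lemma linear_proj_T: "linear_map R F TL \<pi>\<^sub>T"
  unfolding tensor_algebra_def by (rule QT.linear_quotient_proj)

lemma mult_proj_T: "\<lbrakk>a \<in> carrier F; b \<in> carrier F\<rbrakk> \<Longrightarrow> \<pi>\<^sub>T a \<otimes>\<^bsub>TL\<^esub> \<pi>\<^sub>T b = \<pi>\<^sub>T (a \<otimes>\<^bsub>F\<^esub> b)"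
  unfolding tensor_algebra_def by (rule F.mult_quotient[OF ideal_T])

lemma one_T: "\<one>\<^bsub>TL\<^esub> = \<pi>\<^sub>T \<one>\<^bsub>F\<^esub>"
  unfolding tensor_algebra_def by (rule F.one_quotient)

lemma carrier_T: "carrier TL = \<pi>\<^sub>T ` carrier F"
  unfolding tensor_algebra_def by (rule QT.carrier_quotient)

lemma tensor_gen_closed [simp]: "x \<in> carrier L \<Longrightarrow> tensor_gen R L x \<in> carrier TL"
  unfolding tensor_gen_def carrier_T by simp

lemma commutator_relations_closed: "commutator_relations \<subseteq> carrier TL"
  by auto

lemma enveloping_ideal_eq: "enveloping_ideal R L br = Idl\<^bsub>TL\<^esub> commutator_relations"
  unfolding enveloping_ideal_def Let_def ..

lemma ideal_U: "ideal (enveloping_ideal R L br) TL"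
  unfolding enveloping_ideal_eq by (rule T.genideal_ideal[OF commutator_relations_closed])

sublocale U: assoc_algebra R U
  unfolding enveloping_algebra_def by (rule T.assoc_algebra_quotient[OF ideal_U])

sublocale QU: quotient_module R TL "enveloping_ideal R L br"
  by (rule T.quotient_module[OF ideal_U])

lemma linear_proj_U: "linear_map R TL U \<pi>\<^sub>U"
  unfolding enveloping_algebra_def by (rule QU.linear_quotient_proj)

lemma mult_proj_U: "\<lbrakk>a \<in> carrier TL; b \<in> carrier TL\<rbrakk> \<Longrightarrow> \<pi>\<^sub>U a \<otimes>\<^bsub>U\<^esub> \<pi>\<^sub>U b = \<pi>\<^sub>U (a \<otimes>\<^bsub>TL\<^esub> b)"
  unfolding enveloping_algebra_def by (rule T.mult_quotient[OF ideal_U])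

lemma one_U: "\<one>\<^bsub>U\<^esub> = \<pi>\<^sub>U \<one>\<^bsub>TL\<^esub>"
  unfolding enveloping_algebra_def by (rule T.one_quotient)

lemma carrier_U: "carrier U = \<pi>\<^sub>U ` carrier TL"
  unfolding enveloping_algebra_def by (rule QU.carrier_quotient)

lemma gen_eq_word: "\<iota> x = word [x]"
  by (simp add: word_def enveloping_gen_def tensor_gen_def)

lemma proj_T_closed [simp]: "a \<in> carrier F \<Longrightarrow> \<pi>\<^sub>T a \<in> carrier TL"
  by (rule linear_map_closed[OF linear_proj_T])

lemma word_closed [simp]: "w \<in> words \<Longrightarrow> word w \<in> carrier U"
  unfolding word_def by (rule linear_map_closed[OF linear_proj_U]) simp

lemma gen_closed [simp]: "x \<in> carrier L \<Longrightarrow> \<iota> x \<in> carrier U"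
  by (simp add: gen_eq_word)

lemma word_Nil: "word [] = \<one>\<^bsub>U\<^esub>"
  by (simp add: word_def one_U one_T free_algebra_simps(5))

lemma word_append: "\<lbrakk>u \<in> words; v \<in> words\<rbrakk> \<Longrightarrow> word (u @ v) = word u \<otimes>\<^bsub>U\<^esub> word v"
  by (simp add: word_def mult_proj_U mult_proj_T R.basis_mult)

lemma word_Cons: "\<lbrakk>x \<in> carrier L; w \<in> words\<rbrakk> \<Longrightarrow> word (x # w) = \<iota> x \<otimes>\<^bsub>U\<^esub> word w"
  using word_append[of "[x]" w] by (simp add: gen_eq_word)

lemma word_snoc: "\<lbrakk>x \<in> carrier L; w \<in> words\<rbrakk> \<Longrightarrow> word (w @ [x]) = word w \<otimes>\<^bsub>U\<^esub> \<iota> x"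
  by (simp add: word_append gen_eq_word)

section \<open>Linear maps out of an enveloping algebra\<close>

lemma U_ext_words:
  assumes "module R P" "linear_map R U P f" "linear_map R U P g"
    and "\<And>w. w \<in> words \<Longrightarrow> f (word w) = g (word w)" and "u \<in> carrier U"
  shows "f u = g u"
proof -
  obtain a where "a \<in> carrier F" "u = \<pi>\<^sub>U (\<pi>\<^sub>T a)"
    using assms(5) unfolding carrier_U carrier_T by blast
  moreover have "f (\<pi>\<^sub>U (\<pi>\<^sub>T a)) = g (\<pi>\<^sub>U (\<pi>\<^sub>T a))" if "a \<in> carrier F" for a
    by (rule R.free_algebra_ext[OF assms(1)
          linear_map_comp[OF linear_map_comp[OF linear_proj_T linear_proj_U] assms(2)]
          linear_map_comp[OF linear_map_comp[OF linear_proj_T linear_proj_U] assms(3)] _ that])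
      (use assms(4) in \<open>simp add: word_def\<close>)
  ultimately show ?thesis by simp
qed

text \<open>Right multiplication by generators reaches all words from the unit. The right side is
  chosen because the maps to be compared are given by right actions.\<close>

lemma U_ext:
  assumes "module R P" and f: "linear_map R U P f" and g: "linear_map R U P g"
    and one: "f \<one>\<^bsub>U\<^esub> = g \<one>\<^bsub>U\<^esub>"
    and step: "\<And>u x. \<lbrakk>u \<in> carrier U; x \<in> carrier L; f u = g u\<rbrakk> \<Longrightarrow> f (u \<otimes>\<^bsub>U\<^esub> \<iota> x) = g (u \<otimes>\<^bsub>U\<^esub> \<iota> x)"
    and u: "u \<in> carrier U"
  shows "f u = g u"
proof (rule U_ext_words[OF assms(1-3) _ u])
  fix w assume "w \<in> words"
  then show "f (word w) = g (word w)"
    by (induction w rule: rev_induct) (simp_all add: word_Nil one word_snoc step)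
qed

lemma linear_tensor_gen: "linear_map R L TL (tensor_gen R L)"
proof -
  have sub: "linearity_relations R L \<subseteq> Idl\<^bsub>F\<^esub> (linearity_relations R L)"
    by (rule F.genideal_self[OF linearity_relations_closed])
  have "\<pi>\<^sub>T (basis_elem R [x \<oplus>\<^bsub>L\<^esub> y]) = \<pi>\<^sub>T (basis_elem R [x]) \<oplus>\<^bsub>TL\<^esub> \<pi>\<^sub>T (basis_elem R [y])"
    if [simp]: "x \<in> carrier L" "y \<in> carrier L" for x y
  proof -
    have "basis_elem R [x \<oplus>\<^bsub>L\<^esub> y] \<ominus>\<^bsub>F\<^esub> (basis_elem R [x] \<oplus>\<^bsub>F\<^esub> basis_elem R [y]) \<in> linearity_relations R L"
      unfolding linearity_relations_iff using that by blast
    then have "\<pi>\<^sub>T (basis_elem R [x \<oplus>\<^bsub>L\<^esub> y]) = \<pi>\<^sub>T (basis_elem R [x] \<oplus>\<^bsub>F\<^esub> basis_elem R [y])"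
      using sub by (subst QT.quotient_eq_iff) auto
    then show ?thesis by (simp add: linear_map_add[OF linear_proj_T])
  qed
  moreover have "\<pi>\<^sub>T (basis_elem R [r \<odot>\<^bsub>L\<^esub> x]) = r \<odot>\<^bsub>TL\<^esub> \<pi>\<^sub>T (basis_elem R [x])"
    if [simp]: "r \<in> carrier R" "x \<in> carrier L" for r x
  proof -
    have "basis_elem R [r \<odot>\<^bsub>L\<^esub> x] \<ominus>\<^bsub>F\<^esub> r \<odot>\<^bsub>F\<^esub> basis_elem R [x] \<in> linearity_relations R L"
      unfolding linearity_relations_iff using that by blast
    then have "\<pi>\<^sub>T (basis_elem R [r \<odot>\<^bsub>L\<^esub> x]) = \<pi>\<^sub>T (r \<odot>\<^bsub>F\<^esub> basis_elem R [x])"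
      using sub by (subst QT.quotient_eq_iff) auto
    then show ?thesis by (simp add: linear_map_smult[OF linear_proj_T])
  qed
  ultimately show ?thesis
    by (intro linear_mapI) (simp_all add: tensor_gen_def carrier_T)
qed

lemma linear_gen: "linear_map R L U \<iota>"
proof -
  have "\<iota> = (\<lambda>x. \<pi>\<^sub>U (tensor_gen R L x))"
    by (rule ext) (simp add: enveloping_gen_def)
  then show ?thesis
    using linear_map_comp[OF linear_tensor_gen linear_proj_U] by simp
qed

lemma gen_commutator:
  assumes "x \<in> carrier L" "y \<in> carrier L"
  shows "\<iota> x \<otimes>\<^bsub>U\<^esub> \<iota> y \<ominus>\<^bsub>U\<^esub> \<iota> y \<otimes>\<^bsub>U\<^esub> \<iota> x = \<iota> (br x y)"
proof -
  note [simp] = assms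
  let ?t = "tensor_gen R L"
  let ?c = "?t x \<otimes>\<^bsub>TL\<^esub> ?t y \<ominus>\<^bsub>TL\<^esub> ?t y \<otimes>\<^bsub>TL\<^esub> ?t x"
  have "?c \<ominus>\<^bsub>TL\<^esub> ?t (br x y) \<in> enveloping_ideal R L br"
    unfolding enveloping_ideal_eq using T.genideal_self[OF commutator_relations_closed] assms by blast
  then have "\<pi>\<^sub>U ?c = \<pi>\<^sub>U (?t (br x y))"
    by (subst QU.quotient_eq_iff) simp_all
  then show ?thesis
    by (simp add: enveloping_gen_def linear_map_diff[OF T.module_axioms U.module_axioms linear_proj_U] mult_proj_U)
qed

text \<open>Both ideals are spanned by relations multiplied by a word on the left and a word on the
  right. A linear map on the free algebra therefore descends to \<open>U\<close> once it kills
  relations placed inside words, and this is what \<open>f_add\<close>, \<open>f_smult\<close> and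
  \<open>f_br\<close> say.\<close>

lemma U_lift_words:
  assumes P: "module R P"
    and f_closed: "\<And>w. w \<in> words \<Longrightarrow> f w \<in> carrier P"
    and f_add: "\<And>u v x y. \<lbrakk>u \<in> words; v \<in> words; x \<in> carrier L; y \<in> carrier L\<rbrakk>
      \<Longrightarrow> f (u @ (x \<oplus>\<^bsub>L\<^esub> y) # v) = f (u @ x # v) \<oplus>\<^bsub>P\<^esub> f (u @ y # v)"
    and f_smult: "\<And>u v r x. \<lbrakk>u \<in> words; v \<in> words; r \<in> carrier R; x \<in> carrier L\<rbrakk>
      \<Longrightarrow> f (u @ (r \<odot>\<^bsub>L\<^esub> x) # v) = r \<odot>\<^bsub>P\<^esub> f (u @ x # v)"
    and f_br: "\<And>u v x y. \<lbrakk>u \<in> words; v \<in> words; x \<in> carrier L; y \<in> carrier L\<rbrakk>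
      \<Longrightarrow> f (u @ x # y # v) \<ominus>\<^bsub>P\<^esub> f (u @ y # x # v) = f (u @ br x y # v)"
  obtains G where "linear_map R U P G" "\<And>w. w \<in> words \<Longrightarrow> G (word w) = f w"
proof -
  interpret P: module R P by fact
  have fP: "f \<in> words \<rightarrow> carrier P" using f_closed by blast
  define F0 where "F0 = free_lift R P f"
  have F0: "linear_map R F P F0"
    unfolding F0_def R.linear_free_algebra by (rule R.free_lift_linear[OF P fP])
  have F0_basis: "F0 (basis_elem R w) = f w" if "w \<in> words" for w
    unfolding F0_def by (rule R.free_lift_basis[OF P fP that])
  note lin = linear_map_diff[OF F.module_axioms P F0] linear_map_add[OF F0] linear_map_smult[OF F0]
  note alg = F.l_distr F.r_distr F.minus_eq F.l_minus F.r_minus F.smult_mult_left F.smult_mult_right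
  \<comment> \<open>By linearity in the two outer factors it suffices to surround \<open>x\<close>
    by words.\<close>
  have bilin: "F0 (a \<otimes>\<^bsub>F\<^esub> x \<otimes>\<^bsub>F\<^esub> b) = \<zero>\<^bsub>P\<^esub>"
    if a: "a \<in> carrier F" and b: "b \<in> carrier F" and x [simp]: "x \<in> carrier F"
      and 0: "\<And>u v. u \<in> words \<Longrightarrow> v \<in> words \<Longrightarrow> F0 (basis_elem R u \<otimes>\<^bsub>F\<^esub> x \<otimes>\<^bsub>F\<^esub> basis_elem R v) = \<zero>\<^bsub>P\<^esub>" for a b x
  proof -
    have 1: "F0 (basis_elem R u \<otimes>\<^bsub>F\<^esub> x \<otimes>\<^bsub>F\<^esub> b) = \<zero>\<^bsub>P\<^esub>" if u: "u \<in> words" for u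
      by (rule R.free_algebra_ext[OF P linear_map_comp[OF F.linear_mult_right F0] linear_map_const_zero[OF P] _ b])
        (use u 0 in simp_all)
    show ?thesis
      by (rule R.free_algebra_ext[OF P linear_map_comp[OF linear_map_comp[OF F.linear_mult_left F.linear_mult_left] F0]
          linear_map_const_zero[OF P] _ a]) (use b 1 in simp_all)
  qed
  have rel_T: "F0 (a \<otimes>\<^bsub>F\<^esub> x \<otimes>\<^bsub>F\<^esub> b) = \<zero>\<^bsub>P\<^esub>"
    if a: "a \<in> carrier F" and x: "x \<in> linearity_relations R L" and b: "b \<in> carrier F" for a x b
  proof (rule bilin[OF a b])
    show "x \<in> carrier F" using linearity_relations_closed x by blast
    fix u v assume [simp]: "u \<in> words" "v \<in> words"
    show "F0 (basis_elem R u \<otimes>\<^bsub>F\<^esub> x \<otimes>\<^bsub>F\<^esub> basis_elem R v) = \<zero>\<^bsub>P\<^esub>"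
      using x unfolding linearity_relations_iff
    proof (elim disjE bexE)
      fix y z assume [simp]: "y \<in> carrier L" "z \<in> carrier L"
        and "x = basis_elem R [y \<oplus>\<^bsub>L\<^esub> z] \<ominus>\<^bsub>F\<^esub> (basis_elem R [y] \<oplus>\<^bsub>F\<^esub> basis_elem R [z])"
      then have "basis_elem R u \<otimes>\<^bsub>F\<^esub> x \<otimes>\<^bsub>F\<^esub> basis_elem R v =
        basis_elem R (u @ (y \<oplus>\<^bsub>L\<^esub> z) # v) \<ominus>\<^bsub>F\<^esub> (basis_elem R (u @ y # v) \<oplus>\<^bsub>F\<^esub> basis_elem R (u @ z # v))"
        by (simp add: alg R.basis_mult)
      then show ?thesis
        by (simp add: lin F0_basis f_add f_closed P.M.minus_eq_zero_iff)
    next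
      fix r y assume [simp]: "r \<in> carrier R" "y \<in> carrier L"
        and "x = basis_elem R [r \<odot>\<^bsub>L\<^esub> y] \<ominus>\<^bsub>F\<^esub> r \<odot>\<^bsub>F\<^esub> basis_elem R [y]"
      then have "basis_elem R u \<otimes>\<^bsub>F\<^esub> x \<otimes>\<^bsub>F\<^esub> basis_elem R v =
        basis_elem R (u @ (r \<odot>\<^bsub>L\<^esub> y) # v) \<ominus>\<^bsub>F\<^esub> r \<odot>\<^bsub>F\<^esub> basis_elem R (u @ y # v)"
        by (simp add: alg R.basis_mult)
      then show ?thesis
        by (simp add: lin F0_basis f_smult f_closed P.M.minus_eq_zero_iff)
    qed
  qed
  obtain F1 where F1: "linear_map R TL P F1" and F1_proj: "\<And>a. a \<in> carrier F \<Longrightarrow> F1 (\<pi>\<^sub>T a) = F0 a"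
    using F.genideal_factor[OF P F0 linearity_relations_closed rel_T] unfolding tensor_algebra_def[symmetric] by blast
  have rel_U: "F1 (a \<otimes>\<^bsub>TL\<^esub> x \<otimes>\<^bsub>TL\<^esub> b) = \<zero>\<^bsub>P\<^esub>"
    if a: "a \<in> carrier TL" and x: "x \<in> commutator_relations" and b: "b \<in> carrier TL" for a x b
  proof -
    obtain a0 b0 where a0 [simp]: "a0 \<in> carrier F" "b0 \<in> carrier F" and ab: "a = \<pi>\<^sub>T a0" "b = \<pi>\<^sub>T b0"
      using a b unfolding carrier_T by blast
    obtain y z where yz [simp]: "y \<in> carrier L" "z \<in> carrier L"
      and x_eq: "x = (tensor_gen R L y \<otimes>\<^bsub>TL\<^esub> tensor_gen R L z \<ominus>\<^bsub>TL\<^esub> tensor_gen R L z \<otimes>\<^bsub>TL\<^esub> tensor_gen R L y)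
        \<ominus>\<^bsub>TL\<^esub> tensor_gen R L (br y z)"
      using x by blast
    \<comment> \<open>A lift of the relation to the free algebra, where the value of the map can be
      read off from words.\<close>
    define x0 where "x0 = (basis_elem R [y, z] \<ominus>\<^bsub>F\<^esub> basis_elem R [z, y]) \<ominus>\<^bsub>F\<^esub> basis_elem R [br y z]"
    have x0 [simp]: "x0 \<in> carrier F" by (simp add: x0_def)
    have "x = \<pi>\<^sub>T x0"
      by (simp add: x_eq x0_def tensor_gen_def mult_proj_T R.basis_mult
          linear_map_diff[OF F.module_axioms T.module_axioms linear_proj_T])
    then have "a \<otimes>\<^bsub>TL\<^esub> x \<otimes>\<^bsub>TL\<^esub> b = \<pi>\<^sub>T (a0 \<otimes>\<^bsub>F\<^esub> x0 \<otimes>\<^bsub>F\<^esub> b0)"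
      by (simp add: ab mult_proj_T)
    moreover have "F0 (a0 \<otimes>\<^bsub>F\<^esub> x0 \<otimes>\<^bsub>F\<^esub> b0) = \<zero>\<^bsub>P\<^esub>"
    proof (rule bilin[OF a0 x0])
      fix u v assume [simp]: "u \<in> words" "v \<in> words"
      have "basis_elem R u \<otimes>\<^bsub>F\<^esub> x0 \<otimes>\<^bsub>F\<^esub> basis_elem R v =
        (basis_elem R (u @ y # z # v) \<ominus>\<^bsub>F\<^esub> basis_elem R (u @ z # y # v)) \<ominus>\<^bsub>F\<^esub> basis_elem R (u @ br y z # v)"
        by (simp add: x0_def alg R.basis_mult)
      then show "F0 (basis_elem R u \<otimes>\<^bsub>F\<^esub> x0 \<otimes>\<^bsub>F\<^esub> basis_elem R v) = \<zero>\<^bsub>P\<^esub>"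
        by (simp add: lin F0_basis f_br f_closed P.M.minus_eq_zero_iff)
    qed
    ultimately show ?thesis by (simp add: F1_proj)
  qed
  obtain G where "linear_map R U P G" and G: "\<And>a. a \<in> carrier TL \<Longrightarrow> G (\<pi>\<^sub>U a) = F1 a"
    using T.genideal_factor[OF P F1 commutator_relations_closed rel_U]
    unfolding enveloping_ideal_eq[symmetric] enveloping_algebra_def[symmetric] by blast
  moreover have "G (word w) = f w" if "w \<in> words" for w
    using that by (simp add: word_def G F1_proj F0_basis)
  ultimately show thesis using that by blast
qed

text \<open>The letters of a word act on \<open>m\<close> one after the other, the leftmost first.
  By \<open>comm\<close> this respects the commutator relation: the letters before it produce the
  vector \<open>p\<close>, and those after it act linearly on the result.\<close>

lemma U_rec:
  assumes P: "module R P" and m: "m \<in> carrier P"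
    and \<rho>: "bilinear_map R L P P \<rho>"
    and comm: "\<And>x y p. \<lbrakk>x \<in> carrier L; y \<in> carrier L; p \<in> carrier P\<rbrakk>
      \<Longrightarrow> \<rho> y (\<rho> x p) \<ominus>\<^bsub>P\<^esub> \<rho> x (\<rho> y p) = \<rho> (br x y) p"
  obtains G where "linear_map R U P G" "G \<one>\<^bsub>U\<^esub> = m"
    "\<And>u x. \<lbrakk>u \<in> carrier U; x \<in> carrier L\<rbrakk> \<Longrightarrow> G (u \<otimes>\<^bsub>U\<^esub> \<iota> x) = \<rho> x (G u)"
proof -
  interpret P: module R P by fact
  note L = bilinear_map_left[OF \<rho>] and R = bilinear_map_right[OF \<rho>]
  define f where "f p w = fold \<rho> w p" for p w
  have f_closed [simp]: "f p w \<in> carrier P" if "w \<in> words" "p \<in> carrier P" for p w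
    using that by (induction w arbitrary: p) (simp_all add: f_def bilinear_map_closed[OF \<rho>])
  have f_app: "f p (u @ v) = f (f p u) v" for p u v by (simp add: f_def)
  have f_Cons: "f p (x # v) = f (\<rho> x p) v" for p x v by (simp add: f_def)
  have f_lin: "linear_map R P P (\<lambda>p. f p w)" if "w \<in> words" for w
    using that
  proof (induction w)
    case Nil
    then show ?case by (simp add: f_def linear_map_ident)
  next
    case (Cons x w)
    have "linear_map R P P (\<lambda>p. f (\<rho> x p) w)"
      by (rule linear_map_comp[OF R]) (use Cons in simp_all)
    then show ?case by (simp add: f_Cons)
  qed
  note lin = linear_map_add[OF f_lin] linear_map_smult[OF f_lin] linear_map_diff[OF P P f_lin]
  obtain G where G: "linear_map R U P G" "\<And>w. w \<in> words \<Longrightarrow> G (word w) = f m w"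
  proof (rule U_lift_words[OF P, of "f m"])
    fix u v x y assume [simp]: "u \<in> words" "v \<in> words" "x \<in> carrier L" "y \<in> carrier L"
    note [simp] = m bilinear_map_closed[OF \<rho>]
    show "f m (u @ (x \<oplus>\<^bsub>L\<^esub> y) # v) = f m (u @ x # v) \<oplus>\<^bsub>P\<^esub> f m (u @ y # v)"
      by (simp add: f_app f_Cons linear_map_add[OF L] lin)
    show "f m (u @ (r \<odot>\<^bsub>L\<^esub> x) # v) = r \<odot>\<^bsub>P\<^esub> f m (u @ x # v)" if "r \<in> carrier R" for r
      using that by (simp add: f_app f_Cons linear_map_smult[OF L] lin)
    show "f m (u @ x # y # v) \<ominus>\<^bsub>P\<^esub> f m (u @ y # x # v) = f m (u @ br x y # v)"
      by (simp add: f_app f_Cons flip: lin(3) comm)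
  qed (use m in auto)
  have "G (u \<otimes>\<^bsub>U\<^esub> \<iota> x) = \<rho> x (G u)" if u: "u \<in> carrier U" and x [simp]: "x \<in> carrier L" for u x
  proof (rule U_ext_words[OF P linear_map_comp[OF U.linear_mult_left G(1)] linear_map_comp[OF G(1) R] _ u])
    fix w assume w: "w \<in> words"
    then show "G (word w \<otimes>\<^bsub>U\<^esub> \<iota> x) = \<rho> x (G (word w))"
      by (simp add: G(2) flip: word_snoc) (simp add: f_def)
  qed simp_all
  moreover have "G \<one>\<^bsub>U\<^esub> = m"
    using G(2)[of "[]"] by (simp add: word_Nil f_def)
  ultimately show thesis using G(1) that by blast
qed

text \<open>Each \<open>x\<close> acts on \<open>B\<close> as right multiplication by
  \<open>h x\<close>, and the map is the orbit of the unit under this right action. Multiplicativity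
  follows by building up the second factor generator by generator.\<close>

lemma U_alg_hom:
  assumes "assoc_algebra R B" and h: "linear_map R L B h"
    and comm: "\<And>x y. \<lbrakk>x \<in> carrier L; y \<in> carrier L\<rbrakk>
      \<Longrightarrow> h x \<otimes>\<^bsub>B\<^esub> h y \<ominus>\<^bsub>B\<^esub> h y \<otimes>\<^bsub>B\<^esub> h x = h (br x y)"
  shows "\<exists>G. alg_hom R U B G \<and> (\<forall>x\<in>carrier L. G (\<iota> x) = h x)"
proof -
  interpret B: assoc_algebra R B by fact
  note h_closed [simp] = linear_map_closed[OF h]
  have "bilinear_map R L B B (\<lambda>x b. b \<otimes>\<^bsub>B\<^esub> h x)"
    by (rule bilinear_mapI) (auto intro: linear_map_comp[OF h B.linear_mult_right] B.linear_mult_left)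
  then obtain G where G: "linear_map R U B G" "G \<one>\<^bsub>U\<^esub> = \<one>\<^bsub>B\<^esub>"
    and step: "\<And>u x. \<lbrakk>u \<in> carrier U; x \<in> carrier L\<rbrakk> \<Longrightarrow> G (u \<otimes>\<^bsub>U\<^esub> \<iota> x) = G u \<otimes>\<^bsub>B\<^esub> h x"
  proof (rule U_rec[OF B.module_axioms B.one_closed])
    fix x y b assume "x \<in> carrier L" "y \<in> carrier L" "b \<in> carrier B"
    then show "b \<otimes>\<^bsub>B\<^esub> h x \<otimes>\<^bsub>B\<^esub> h y \<ominus>\<^bsub>B\<^esub> b \<otimes>\<^bsub>B\<^esub> h y \<otimes>\<^bsub>B\<^esub> h x = b \<otimes>\<^bsub>B\<^esub> h (br x y)"
      by (simp add: B.m_assoc B.minus_eq B.r_distr B.r_minus flip: comm)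
  qed blast
  note G_closed [simp] = linear_map_closed[OF G(1)]
  have "G (u \<otimes>\<^bsub>U\<^esub> v) = G u \<otimes>\<^bsub>B\<^esub> G v" if u [simp]: "u \<in> carrier U" and v: "v \<in> carrier U" for u v
  proof (rule U_ext[OF B.module_axioms linear_map_comp[OF U.linear_mult_right G(1)]
        linear_map_comp[OF G(1) B.linear_mult_right] _ _ v])
    fix v x assume [simp]: "v \<in> carrier U" "x \<in> carrier L" and "G (u \<otimes>\<^bsub>U\<^esub> v) = G u \<otimes>\<^bsub>B\<^esub> G v"
    then have "G (u \<otimes>\<^bsub>U\<^esub> v \<otimes>\<^bsub>U\<^esub> \<iota> x) = G u \<otimes>\<^bsub>B\<^esub> (G v \<otimes>\<^bsub>B\<^esub> h x)"
      by (simp add: step B.m_assoc)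
    then show "G (u \<otimes>\<^bsub>U\<^esub> (v \<otimes>\<^bsub>U\<^esub> \<iota> x)) = G u \<otimes>\<^bsub>B\<^esub> G (v \<otimes>\<^bsub>U\<^esub> \<iota> x)"
      by (simp add: step U.m_assoc)
  qed (use G(2) in simp_all)
  then have "alg_hom R U B G"
    unfolding alg_hom_def using G by (auto intro!: ring_hom_memI simp: linear_map_add)
  moreover have "G (\<iota> x) = h x" if "x \<in> carrier L" for x
    using step[of "\<one>\<^bsub>U\<^esub>" x] that G(2) by simp
  ultimately show ?thesis by blast
qed

lemma linear_word_slot:
  assumes [simp]: "u \<in> words" "v \<in> words"
  shows "linear_map R L U (\<lambda>x. word (u @ x # v))"
proof (rule linear_map_cong)
  show "linear_map R L U (\<lambda>x. word u \<otimes>\<^bsub>U\<^esub> (\<iota> x \<otimes>\<^bsub>U\<^esub> word v))"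
    by (rule linear_map_comp[OF linear_map_comp[OF linear_gen U.linear_mult_left] U.linear_mult_right]) simp_all
  show "word u \<otimes>\<^bsub>U\<^esub> (\<iota> x \<otimes>\<^bsub>U\<^esub> word v) = word (u @ x # v)" if "x \<in> carrier L" for x
    using that by (simp add: word_append word_Cons)
qed (rule module_axioms)

end

section \<open>Dependence on the record fields\<close>

text \<open>A Hopf record and the algebra record under it are different objects with equal fields.
  The constructions see only the fields, so facts about the algebra are moved to the Hopf record by
  rewriting.\<close>

lemma tensor_module_cong:
  assumes "carrier M' = carrier M" "add M' = add M" "smult M' = smult M"
    and "carrier N' = carrier N" "add N' = add N" "smult N' = smult N"
  shows "tensor_module R M' N' = tensor_module R M N" and "tensor R M' N' = tensor R M N"
  using assms by (simp_all add: tensor_module_def tensor_def tensor_kernel_def tensor_relations_def fun_eq_iff)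

lemma tensor_lift_struct_cong:
  assumes "carrier P' = carrier P" "add P' = add P" "smult P' = smult P" "zero P' = zero P"
  shows "tensor_lift R P' \<beta> = tensor_lift R P \<beta>"
  by (rule ext) (simp add: tensor_lift_def finsum_def finprod_def Let_def assms)

lemma tensor_product_algebra_cong:
  assumes "carrier M' = carrier M" "add M' = add M" "smult M' = smult M" "mult M' = mult M" "one M' = one M"
  shows "tensor_product_algebra R M' M' = tensor_product_algebra R M M"
  using assms by (simp add: tensor_product_algebra_def tensor_module_cong[of M' M M' M])

lemma assoc_algebra_cong:
  assumes "assoc_algebra R A" "carrier A' = carrier A" "zero A' = zero A" "add A' = add A" "smult A' = smult A"
    "mult A' = mult A" "one A' = one A"
  shows "assoc_algebra R A'"
proof -
  interpret assoc_algebra R A by fact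
  show ?thesis
    by (rule assoc_algebraI[OF module_cong[OF module_axioms]])
      (use assms(2-) bilinear_mult m_assoc in \<open>simp_all add: bilinear_map_def linear_map_def\<close>)
qed

text \<open>The axioms are stated over the algebra \<open>A\<close> in place of the record
  \<open>H\<close>, so that they can be proved inside the locales for tensor products of
  \<open>A\<close> and are moved to \<open>H\<close> once and for all.\<close>

lemma hopf_algebraI:
  assumes A: "assoc_algebra R A"
    and eq: "carrier H = carrier A" "zero H = zero A" "add H = add A" "smult H = smult A"
      "mult H = mult A" "one H = one A"
    and comult: "alg_hom R A (tensor_product_algebra R A A) (comult H)"
    and counit: "alg_hom R A (base_algebra R) (counit H)"
    and coassoc: "\<And>x. x \<in> carrier A \<Longrightarrow>
      tensor_lift R (tensor_module R (tensor_module R A A) A)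
        (\<lambda>a b. tensor R (tensor_module R A A) A (comult H a) b) (comult H x) =
      tensor_lift R (tensor_module R (tensor_module R A A) A)
        (\<lambda>a b. tensor_lift R (tensor_module R (tensor_module R A A) A)
          (\<lambda>c d. tensor R (tensor_module R A A) A (tensor R A A a c) d) (comult H b))
        (comult H x)"
    and counit_left: "\<And>x. x \<in> carrier A \<Longrightarrow>
      tensor_lift R A (\<lambda>a b. counit H a \<odot>\<^bsub>A\<^esub> b) (comult H x) = x"
    and counit_right: "\<And>x. x \<in> carrier A \<Longrightarrow>
      tensor_lift R A (\<lambda>a b. counit H b \<odot>\<^bsub>A\<^esub> a) (comult H x) = x"
    and S: "linear_map R A A S"
    and S_left: "\<And>x. x \<in> carrier A \<Longrightarrow>
      tensor_lift R A (\<lambda>a b. S a \<otimes>\<^bsub>A\<^esub> b) (comult H x) = counit H x \<odot>\<^bsub>A\<^esub> \<one>\<^bsub>A\<^esub>"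
    and S_right: "\<And>x. x \<in> carrier A \<Longrightarrow>
      tensor_lift R A (\<lambda>a b. a \<otimes>\<^bsub>A\<^esub> S b) (comult H x) = counit H x \<odot>\<^bsub>A\<^esub> \<one>\<^bsub>A\<^esub>"
  shows "hopf_algebra R H"
proof -
  have T: "tensor_module R H H = tensor_module R A A" "tensor R H H = tensor R A A"
    by (rule tensor_module_cong; simp add: eq)+
  have TT: "tensor_module R (tensor_module R A A) H = tensor_module R (tensor_module R A A) A"
    "tensor R (tensor_module R A A) H = tensor R (tensor_module R A A) A"
    by (rule tensor_module_cong; simp add: eq)+
  have TA: "tensor_product_algebra R H H = tensor_product_algebra R A A"
    by (rule tensor_product_algebra_cong; simp add: eq)
  have lift: "tensor_lift R H \<beta> = tensor_lift R A \<beta>" for \<beta> :: "'f \<Rightarrow> 'g \<Rightarrow> 'c"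
    by (rule tensor_lift_struct_cong; simp add: eq)
  show ?thesis
  proof (intro hopf_algebra.intro hopf_algebra_axioms.intro assoc_algebra_cong[OF A] eq)
    show "alg_hom R H (tensor_product_algebra R H H) (comult H)"
      using comult unfolding TA alg_hom_def by (simp add: linear_map_def ring_hom_def eq)
    show "alg_hom R H (base_algebra R) (counit H)"
      using counit unfolding alg_hom_def by (simp add: linear_map_def ring_hom_def eq)
    show "\<exists>S. linear_map R H H S \<and>
      (\<forall>x\<in>carrier H.
        tensor_lift R H (\<lambda>a b. S a \<otimes>\<^bsub>H\<^esub> b) (comult H x) = counit H x \<odot>\<^bsub>H\<^esub> \<one>\<^bsub>H\<^esub> \<and>
        tensor_lift R H (\<lambda>a b. a \<otimes>\<^bsub>H\<^esub> S b) (comult H x) = counit H x \<odot>\<^bsub>H\<^esub> \<one>\<^bsub>H\<^esub>)"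
      using S S_left S_right unfolding lift eq
      by (intro exI[of _ S]) (simp add: linear_map_def eq)
  qed (unfold T TT lift eq, (rule coassoc counit_left counit_right, assumption)+)
qed

lemma (in cring) assoc_algebra_base: "assoc_algebra R (base_algebra R)"
proof -
  have s: "carrier (base_algebra R) = carrier R" "zero (base_algebra R) = \<zero>" "add (base_algebra R) = add R"
    "smult (base_algebra R) = mult R" "mult (base_algebra R) = mult R" "one (base_algebra R) = \<one>"
    by (simp_all add: base_algebra_def)
  have "abelian_group (base_algebra R)"
    by (rule abelian_groupI) (auto simp: s a_ac intro: bexI[of _ "\<ominus> _"] l_neg)
  then have m: "module R (base_algebra R)"
    by (intro moduleI is_cring) (simp_all add: s l_distr r_distr m_assoc)
  show ?thesis
    by (rule assoc_algebraI[OF m])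
      (simp_all add: bilinear_map_def linear_map_def s l_distr r_distr m_ac)
qed

section \<open>The Hopf algebra structure of an enveloping algebra\<close>

context bracket_module
begin

sublocale UU: tensor_alg R U U by unfold_locales

abbreviation tens (infixl \<open>\<diamondop>\<close> 75) where "x \<diamondop> y \<equiv> tensor R U U x y"

abbreviation primitive :: "'c \<Rightarrow> ((('c list \<Rightarrow> 'a) set set \<times> ('c list \<Rightarrow> 'a) set set) \<Rightarrow> 'a) set" where
  "primitive x \<equiv> \<iota> x \<diamondop> \<one>\<^bsub>U\<^esub> \<oplus>\<^bsub>UU.TA\<^esub> \<one>\<^bsub>U\<^esub> \<diamondop> \<iota> x"

definition Delta (\<open>\<Delta>\<close>) where "\<Delta> = hom_on_gens R L U UU.TA \<iota> primitive"
definition Eps (\<open>\<epsilon>\<close>) where "\<epsilon> = hom_on_gens R L U (base_algebra R) \<iota> (\<lambda>x. \<zero>)"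

lemma primitive_hopf_simps:
  "carrier (primitive_hopf R L U \<iota>) = carrier U" "zero (primitive_hopf R L U \<iota>) = zero U"
  "add (primitive_hopf R L U \<iota>) = add U" "smult (primitive_hopf R L U \<iota>) = smult U"
  "mult (primitive_hopf R L U \<iota>) = mult U" "one (primitive_hopf R L U \<iota>) = one U"
  "comult (primitive_hopf R L U \<iota>) = \<Delta>" "counit (primitive_hopf R L U \<iota>) = \<epsilon>"
  by (simp_all add: primitive_hopf_def Delta_def Eps_def)

lemma linear_primitive: "linear_map R L UU.T primitive"
  using linear_map_plus[OF UU.T.module_axioms
      linear_map_comp[OF linear_gen UU.linear_tensor_left[OF U.one_closed]]
      linear_map_comp[OF linear_gen UU.linear_tensor_right[OF U.one_closed]]]
  by simp

text \<open>The mixed terms of the two products have the same sum, so the commutator retains only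
  the commutators inside a single tensor factor.\<close>

lemma primitive_commutator:
  assumes [simp]: "x \<in> carrier L" "y \<in> carrier L"
  shows "primitive x \<otimes>\<^bsub>UU.TA\<^esub> primitive y \<ominus>\<^bsub>UU.TA\<^esub> primitive y \<otimes>\<^bsub>UU.TA\<^esub> primitive x = primitive (br x y)"
proof -
  interpret TA: assoc_algebra R UU.TA by (rule UU.assoc_algebra_TA)
  have c: "a \<diamondop> b \<in> carrier UU.TA" if "a \<in> carrier U" "b \<in> carrier U" for a b using that by simp
  have p: "primitive a \<otimes>\<^bsub>UU.TA\<^esub> primitive b =
    (((\<iota> a \<otimes>\<^bsub>U\<^esub> \<iota> b) \<diamondop> \<one>\<^bsub>U\<^esub>) \<oplus>\<^bsub>UU.TA\<^esub> \<iota> b \<diamondop> \<iota> a) \<oplus>\<^bsub>UU.TA\<^esub> (\<iota> a \<diamondop> \<iota> b \<oplus>\<^bsub>UU.TA\<^esub> (\<one>\<^bsub>U\<^esub> \<diamondop> (\<iota> a \<otimes>\<^bsub>U\<^esub> \<iota> b)))"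
    if [simp]: "a \<in> carrier L" "b \<in> carrier L" for a b
    by (simp add: TA.l_distr TA.r_distr c UU.mult_tens del: UU.TA_simps)
  have "(\<iota> x \<otimes>\<^bsub>U\<^esub> \<iota> y) \<diamondop> \<one>\<^bsub>U\<^esub> \<ominus>\<^bsub>UU.TA\<^esub> (\<iota> y \<otimes>\<^bsub>U\<^esub> \<iota> x) \<diamondop> \<one>\<^bsub>U\<^esub> = \<iota> (br x y) \<diamondop> \<one>\<^bsub>U\<^esub>"
    using linear_map_diff[OF U.module_axioms UU.module_TA, of "\<lambda>a. a \<diamondop> \<one>\<^bsub>U\<^esub>" "\<iota> x \<otimes>\<^bsub>U\<^esub> \<iota> y" "\<iota> y \<otimes>\<^bsub>U\<^esub> \<iota> x"]
    by (simp add: UU.linear_tensor_left gen_commutator)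
  moreover have "\<one>\<^bsub>U\<^esub> \<diamondop> (\<iota> x \<otimes>\<^bsub>U\<^esub> \<iota> y) \<ominus>\<^bsub>UU.TA\<^esub> \<one>\<^bsub>U\<^esub> \<diamondop> (\<iota> y \<otimes>\<^bsub>U\<^esub> \<iota> x) = \<one>\<^bsub>U\<^esub> \<diamondop> \<iota> (br x y)"
    using linear_map_diff[OF U.module_axioms UU.module_TA, of "\<lambda>a. \<one>\<^bsub>U\<^esub> \<diamondop> a" "\<iota> x \<otimes>\<^bsub>U\<^esub> \<iota> y" "\<iota> y \<otimes>\<^bsub>U\<^esub> \<iota> x"]
    by (simp add: UU.linear_tensor_right gen_commutator)
  ultimately show ?thesis
    unfolding p[OF assms] p[OF assms(2,1)]
    by (subst TA.cross_terms_cancel) (simp_all add: c del: UU.TA_simps)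
qed

text \<open>The coproduct is an arbitrary choice among the algebra morphisms with the given values
  on generators. The universal property provides one, so the chosen morphism meets its
  specification.\<close>

lemma alg_hom_Delta: "alg_hom R U UU.TA \<Delta>"
  and Delta_gen: "x \<in> carrier L \<Longrightarrow> \<Delta> (\<iota> x) = primitive x"
proof -
  have "\<exists>G. alg_hom R U UU.TA G \<and> (\<forall>x\<in>carrier L. G (\<iota> x) = primitive x)"
    by (rule U_alg_hom[OF UU.assoc_algebra_TA _ primitive_commutator])
      (simp_all add: linear_primitive[simplified])
  from someI_ex[OF this] show "alg_hom R U UU.TA \<Delta>" "x \<in> carrier L \<Longrightarrow> \<Delta> (\<iota> x) = primitive x"
    unfolding Delta_def hom_on_gens_def by blast+
qed

lemma alg_hom_Eps: "alg_hom R U (base_algebra R) \<epsilon>"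
  and Eps_gen: "x \<in> carrier L \<Longrightarrow> \<epsilon> (\<iota> x) = \<zero>"
proof -
  interpret B: assoc_algebra R "base_algebra R" by (rule R.assoc_algebra_base)
  have z: "\<zero>\<^bsub>base_algebra R\<^esub> = \<zero>" by (simp add: base_algebra_def)
  have "\<exists>G. alg_hom R U (base_algebra R) G \<and> (\<forall>x\<in>carrier L. G (\<iota> x) = \<zero>\<^bsub>base_algebra R\<^esub>)"
    by (rule U_alg_hom[OF R.assoc_algebra_base linear_map_const_zero[OF B.module_axioms]])
      (simp add: B.minus_eq)
  from someI_ex[OF this] show "alg_hom R U (base_algebra R) \<epsilon>" "x \<in> carrier L \<Longrightarrow> \<epsilon> (\<iota> x) = \<zero>"
    unfolding Eps_def hom_on_gens_def z by blast+
qed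

lemma linear_Delta: "linear_map R U UU.T \<Delta>"
  using alg_hom_Delta by (simp add: alg_hom_def)

lemma Delta_closed [simp]: "u \<in> carrier U \<Longrightarrow> \<Delta> u \<in> carrier UU.T"
  by (rule linear_map_closed[OF linear_Delta])

lemma Delta_one: "\<Delta> \<one>\<^bsub>U\<^esub> = \<one>\<^bsub>U\<^esub> \<diamondop> \<one>\<^bsub>U\<^esub>"
  using alg_hom_Delta by (simp add: alg_hom_def ring_hom_def)

lemma Delta_mult: "\<lbrakk>u \<in> carrier U; v \<in> carrier U\<rbrakk> \<Longrightarrow> \<Delta> (u \<otimes>\<^bsub>U\<^esub> v) = \<Delta> u \<otimes>\<^bsub>UU.TA\<^esub> \<Delta> v"
  using alg_hom_Delta by (simp add: alg_hom_def ring_hom_def)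

lemma linear_Eps: "linear_map R U (base_algebra R) \<epsilon>"
  using alg_hom_Eps by (simp add: alg_hom_def)

lemma Eps_closed [simp]: "u \<in> carrier U \<Longrightarrow> \<epsilon> u \<in> carrier R"
  using linear_map_closed[OF linear_Eps] by (simp add: base_algebra_def)

lemma Eps_one: "\<epsilon> \<one>\<^bsub>U\<^esub> = \<one>"
  using alg_hom_Eps by (simp add: alg_hom_def ring_hom_def base_algebra_def)

lemma Eps_step: "\<lbrakk>u \<in> carrier U; x \<in> carrier L\<rbrakk> \<Longrightarrow> \<epsilon> (u \<otimes>\<^bsub>U\<^esub> \<iota> x) = \<zero>"
  using alg_hom_Eps by (simp add: alg_hom_def ring_hom_def base_algebra_def Eps_gen)

lemma bilinear_Eps:
  assumes P: "module R P" and f: "linear_map R M P f"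
  shows "bilinear_map R U M P (\<lambda>a b. \<epsilon> a \<odot>\<^bsub>P\<^esub> f b)"
proof -
  interpret P: module R P by fact
  have e: "\<epsilon> (a \<oplus>\<^bsub>U\<^esub> b) = \<epsilon> a \<oplus> \<epsilon> b" if "a \<in> carrier U" "b \<in> carrier U" for a b
    using linear_map_add[OF linear_Eps that] by (simp add: base_algebra_def)
  have e': "\<epsilon> (r \<odot>\<^bsub>U\<^esub> a) = r \<otimes> \<epsilon> a" if "r \<in> carrier R" "a \<in> carrier U" for a r
    using linear_map_smult[OF linear_Eps that] by (simp add: base_algebra_def)
  show ?thesis
    by (intro bilinear_mapI linear_map_scale[OF P f] linear_mapI)
      (simp_all add: e e' linear_map_closed[OF f] P.smult_l_distr P.smult_assoc1)
qed

section \<open>Sweedler calculus by induction along right multiplication by generators\<close>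

lemma Delta_lift_one:
  "\<lbrakk>module R P; bilinear_map R U U P \<beta>\<rbrakk> \<Longrightarrow> tensor_lift R P \<beta> (\<Delta> \<one>\<^bsub>U\<^esub>) = \<beta> \<one>\<^bsub>U\<^esub> \<one>\<^bsub>U\<^esub>"
  by (simp add: Delta_one UU.tensor_lift_tensor)

text \<open>In Sweedler notation: \<open>\<Delta>(uX) = u\<^sub>1 X \<otimes> u\<^sub>2 + u\<^sub>1 \<otimes> u\<^sub>2 X\<close>.\<close>

lemma Delta_lift_step:
  assumes P: "module R P" and \<beta>: "bilinear_map R U U P \<beta>"
    and u [simp]: "u \<in> carrier U" and x [simp]: "x \<in> carrier L"
  shows "tensor_lift R P \<beta> (\<Delta> (u \<otimes>\<^bsub>U\<^esub> \<iota> x)) =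
    tensor_lift R P (\<lambda>a b. \<beta> (a \<otimes>\<^bsub>U\<^esub> \<iota> x) b \<oplus>\<^bsub>P\<^esub> \<beta> a (b \<otimes>\<^bsub>U\<^esub> \<iota> x)) (\<Delta> u)"
proof -
  have l: "bilinear_map R U U Q (\<lambda>a b. \<gamma> (a \<otimes>\<^bsub>U\<^esub> \<iota> x) b)"
    and r: "bilinear_map R U U Q (\<lambda>a b. \<gamma> a (b \<otimes>\<^bsub>U\<^esub> \<iota> x))"
    if "bilinear_map R U U Q \<gamma>" for \<gamma> and Q :: "('a, 'z, 'y) module_scheme"
    by (rule bilinear_map_comp2[OF that U.linear_mult_left linear_map_ident], simp)
      (rule bilinear_map_comp2[OF that linear_map_ident U.linear_mult_left], simp)
  note T = UU.T.module_axioms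
  have "\<Delta> (u \<otimes>\<^bsub>U\<^esub> \<iota> x) = \<Delta> u \<otimes>\<^bsub>UU.TA\<^esub> (\<iota> x \<diamondop> \<one>\<^bsub>U\<^esub>) \<oplus>\<^bsub>UU.T\<^esub> \<Delta> u \<otimes>\<^bsub>UU.TA\<^esub> (\<one>\<^bsub>U\<^esub> \<diamondop> \<iota> x)"
    by (simp add: Delta_mult Delta_gen linear_map_add[OF UU.linear_TA_right])
  also have "\<Delta> u \<otimes>\<^bsub>UU.TA\<^esub> (\<iota> x \<diamondop> \<one>\<^bsub>U\<^esub>) = tensor_lift R UU.T (\<lambda>a b. (a \<otimes>\<^bsub>U\<^esub> \<iota> x) \<diamondop> b) (\<Delta> u)"
    unfolding UU.mult_TA_tens[OF Delta_closed[OF u] gen_closed[OF x] U.one_closed]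
    by (rule UU.tensor_lift_cong[OF T l[OF UU.bilinear_tensor] _ Delta_closed[OF u], symmetric]) simp
  also have "\<Delta> u \<otimes>\<^bsub>UU.TA\<^esub> (\<one>\<^bsub>U\<^esub> \<diamondop> \<iota> x) = tensor_lift R UU.T (\<lambda>a b. a \<diamondop> (b \<otimes>\<^bsub>U\<^esub> \<iota> x)) (\<Delta> u)"
    unfolding UU.mult_TA_tens[OF Delta_closed[OF u] U.one_closed gen_closed[OF x]]
    by (rule UU.tensor_lift_cong[OF T r[OF UU.bilinear_tensor] _ Delta_closed[OF u], symmetric]) simp
  finally show ?thesis
    by (simp add: linear_map_add[OF UU.linear_tensor_lift[OF P \<beta>]] UU.tensor_lift_plus[OF P l[OF \<beta>] r[OF \<beta>]]
        UU.tensor_lift_closed[OF T l[OF UU.bilinear_tensor]] UU.tensor_lift_closed[OF T r[OF UU.bilinear_tensor]]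
        UU.tensor_lift_map[OF U.module_axioms U.module_axioms P U.linear_mult_left linear_map_ident \<beta>]
        UU.tensor_lift_map[OF U.module_axioms U.module_axioms P linear_map_ident U.linear_mult_left \<beta>])
qed

text \<open>Both sides obey the same recursion, \<open>\<kappa> x\<close> being the operator on
  \<open>P\<close> that appending \<open>x\<close> induces. An identity for a Sweedler sum is thus
  reduced to a check on a single pair \<open>a\<close>, \<open>b\<close>.\<close>

lemma Delta_lift_eqI:
  assumes P: "module R P" and \<beta>: "bilinear_map R U U P \<beta>" and g: "linear_map R U P g"
    and \<kappa>: "\<And>x. x \<in> carrier L \<Longrightarrow> linear_map R P P (\<kappa> x)"
    and one: "\<beta> \<one>\<^bsub>U\<^esub> \<one>\<^bsub>U\<^esub> = g \<one>\<^bsub>U\<^esub>"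
    and \<beta>_step: "\<And>x a b. \<lbrakk>x \<in> carrier L; a \<in> carrier U; b \<in> carrier U\<rbrakk>
      \<Longrightarrow> \<kappa> x (\<beta> a b) = \<beta> (a \<otimes>\<^bsub>U\<^esub> \<iota> x) b \<oplus>\<^bsub>P\<^esub> \<beta> a (b \<otimes>\<^bsub>U\<^esub> \<iota> x)"
    and g_step: "\<And>x u. \<lbrakk>x \<in> carrier L; u \<in> carrier U\<rbrakk> \<Longrightarrow> g (u \<otimes>\<^bsub>U\<^esub> \<iota> x) = \<kappa> x (g u)"
    and u: "u \<in> carrier U"
  shows "tensor_lift R P \<beta> (\<Delta> u) = g u"
proof (rule U_ext[OF P linear_map_comp[OF linear_Delta UU.linear_tensor_lift[OF P \<beta>]] g _ _ u])
  show "tensor_lift R P \<beta> (\<Delta> \<one>\<^bsub>U\<^esub>) = g \<one>\<^bsub>U\<^esub>"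
    by (simp only: Delta_lift_one[OF P \<beta>] one)
  fix u x assume u: "u \<in> carrier U" and x: "x \<in> carrier L" and IH: "tensor_lift R P \<beta> (\<Delta> u) = g u"
  have "tensor_lift R P \<beta> (\<Delta> (u \<otimes>\<^bsub>U\<^esub> \<iota> x)) = tensor_lift R P (\<lambda>a b. \<kappa> x (\<beta> a b)) (\<Delta> u)"
    unfolding Delta_lift_step[OF P \<beta> u x]
    by (rule UU.tensor_lift_cong[OF P bilinear_map_comp[OF \<beta> \<kappa>[OF x]] \<beta>_step[OF x] Delta_closed[OF u], symmetric])
  also have "\<dots> = \<kappa> x (tensor_lift R P \<beta> (\<Delta> u))"
    by (rule UU.linear_map_tensor_lift[OF P P \<beta> \<kappa>[OF x] Delta_closed[OF u], symmetric])
  finally show "tensor_lift R P \<beta> (\<Delta> (u \<otimes>\<^bsub>U\<^esub> \<iota> x)) = g (u \<otimes>\<^bsub>U\<^esub> \<iota> x)"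
    by (simp only: IH g_step[OF x u])
qed

lemma tens_mult_primitive:
  assumes [simp]: "a \<in> carrier U" "b \<in> carrier U" "x \<in> carrier L"
  shows "(a \<diamondop> b) \<otimes>\<^bsub>UU.TA\<^esub> primitive x = (a \<otimes>\<^bsub>U\<^esub> \<iota> x) \<diamondop> b \<oplus>\<^bsub>UU.T\<^esub> a \<diamondop> (b \<otimes>\<^bsub>U\<^esub> \<iota> x)"
  by (simp add: linear_map_add[OF UU.linear_TA_right] UU.mult_tens)

lemma primitive_closed: "x \<in> carrier L \<Longrightarrow> primitive x \<in> carrier UU.T"
  by simp

lemma Delta_lift_gen:
  assumes "module R P" "bilinear_map R U U P \<beta>" and [simp]: "x \<in> carrier L"
  shows "tensor_lift R P \<beta> (\<Delta> (\<iota> x)) = \<beta> (\<iota> x) \<one>\<^bsub>U\<^esub> \<oplus>\<^bsub>P\<^esub> \<beta> \<one>\<^bsub>U\<^esub> (\<iota> x)"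
  by (simp add: Delta_gen linear_map_add[OF UU.linear_tensor_lift[OF assms(1,2)]] UU.tensor_lift_tensor[OF assms(1,2)])

text \<open>The coproduct of a word is a sum of tensors of words none of which is longer. An
  induction on length may therefore rewrite under a Sweedler sum with a hypothesis known for short
  words only.\<close>

lemma Delta_lift_word_cong:
  assumes P: "module R P" and "bilinear_map R U U P \<beta>" "bilinear_map R U U P \<gamma>" and w: "w \<in> words"
    and "\<And>u v. \<lbrakk>u \<in> words; v \<in> words; length u \<le> length w; length v \<le> length w\<rbrakk>
      \<Longrightarrow> \<beta> (word u) (word v) = \<gamma> (word u) (word v)"
  shows "tensor_lift R P \<beta> (\<Delta> (word w)) = tensor_lift R P \<gamma> (\<Delta> (word w))"
  using w assms(2,3,5)
proof (induction w arbitrary: \<beta> \<gamma> rule: rev_induct)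
  case Nil
  then show ?case
    using Nil.prems(4)[of "[]" "[]"]
    by (simp add: word_Nil Delta_lift_one[OF P Nil.prems(2)] Delta_lift_one[OF P Nil.prems(3)])
next
  case (snoc x w)
  have x [simp]: "x \<in> carrier L" and w: "w \<in> words" using snoc.prems(1) by simp_all
  have bil: "bilinear_map R U U P (\<lambda>a b. \<delta> (a \<otimes>\<^bsub>U\<^esub> \<iota> x) b \<oplus>\<^bsub>P\<^esub> \<delta> a (b \<otimes>\<^bsub>U\<^esub> \<iota> x))"
    if "bilinear_map R U U P \<delta>" for \<delta>
    by (intro bilinear_map_plus P bilinear_map_comp2[OF that] U.linear_mult_left linear_map_ident gen_closed x)
  have "tensor_lift R P (\<lambda>a b. \<beta> (a \<otimes>\<^bsub>U\<^esub> \<iota> x) b \<oplus>\<^bsub>P\<^esub> \<beta> a (b \<otimes>\<^bsub>U\<^esub> \<iota> x)) (\<Delta> (word w)) =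
    tensor_lift R P (\<lambda>a b. \<gamma> (a \<otimes>\<^bsub>U\<^esub> \<iota> x) b \<oplus>\<^bsub>P\<^esub> \<gamma> a (b \<otimes>\<^bsub>U\<^esub> \<iota> x)) (\<Delta> (word w))"
  proof (rule snoc.IH[OF w bil[OF snoc.prems(2)] bil[OF snoc.prems(3)]])
    fix u v assume "u \<in> words" "v \<in> words" "length u \<le> length w" "length v \<le> length w"
    then show "\<beta> (word u \<otimes>\<^bsub>U\<^esub> \<iota> x) (word v) \<oplus>\<^bsub>P\<^esub> \<beta> (word u) (word v \<otimes>\<^bsub>U\<^esub> \<iota> x) =
      \<gamma> (word u \<otimes>\<^bsub>U\<^esub> \<iota> x) (word v) \<oplus>\<^bsub>P\<^esub> \<gamma> (word u) (word v \<otimes>\<^bsub>U\<^esub> \<iota> x)"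
      using snoc.prems(4)[of "u @ [x]" v] snoc.prems(4)[of u "v @ [x]"] by (simp add: word_snoc)
  qed
  with w show ?case
    by (simp add: word_snoc Delta_lift_step[OF P snoc.prems(2)] Delta_lift_step[OF P snoc.prems(3)])
qed

section \<open>Coassociativity, counit and antipode\<close>

lemma coassoc_U:
  assumes u: "u \<in> carrier U"
  shows "tensor_lift R (tensor_module R UU.T U) (\<lambda>a b. tensor R UU.T U (\<Delta> a) b) (\<Delta> u) =
    tensor_lift R (tensor_module R UU.T U)
      (\<lambda>a b. tensor_lift R (tensor_module R UU.T U) (\<lambda>c d. tensor R UU.T U (a \<diamondop> c) d) (\<Delta> b)) (\<Delta> u)"
proof -
  interpret T3: tensor_prod R UU.T U by unfold_locales
  let ?t = "tensor R UU.T U"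
  note P = T3.T.module_axioms
  note m = U.module_axioms
  have b1: "bilinear_map R U U T3.T (\<lambda>a b. ?t (\<Delta> a) b)"
    by (rule bilinear_map_comp2[OF T3.bilinear_tensor linear_Delta linear_map_ident])
  have b2: "bilinear_map R U U T3.T (\<lambda>c d. ?t (a \<diamondop> c) d)" if "a \<in> carrier U" for a
    by (rule bilinear_map_comp2[OF T3.bilinear_tensor UU.linear_tensor_right linear_map_ident]) (rule that)
  have b3: "bilinear_map R U U T3.T (\<lambda>a b. tensor_lift R T3.T (\<lambda>c d. ?t (a \<diamondop> c) d) (\<Delta> b))"
  proof (rule bilinear_mapI)
    show "linear_map R U T3.T (\<lambda>b. tensor_lift R T3.T (\<lambda>c d. ?t (a \<diamondop> c) d) (\<Delta> b))" if "a \<in> carrier U" for a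
      by (rule linear_map_comp[OF linear_Delta UU.linear_tensor_lift[OF P b2[OF that]]])
    show "linear_map R U T3.T (\<lambda>a. tensor_lift R T3.T (\<lambda>c d. ?t (a \<diamondop> c) d) (\<Delta> b))" if "b \<in> carrier U" for b
      by (rule UU.linear_tensor_lift_param[OF P m b2 _ Delta_closed[OF that]])
        (assumption, rule linear_map_comp[OF UU.linear_tensor_left T3.linear_tensor_left])
  qed
  have \<tau>_bil: "bilinear_map R U U UU.T (\<lambda>c d. (c \<otimes>\<^bsub>U\<^esub> \<iota> x) \<diamondop> d \<oplus>\<^bsub>UU.T\<^esub> c \<diamondop> (d \<otimes>\<^bsub>U\<^esub> \<iota> x))" if "x \<in> carrier L" for x
    using that
    by (intro bilinear_map_plus UU.T.module_axioms UU.bilinear_tensor_map m U.linear_mult_left linear_map_ident gen_closed)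
  \<comment> \<open>\<open>\<tau> x\<close> is the action of \<open>x\<close> on the tensor square
    by right multiplication in each factor; the coproduct intertwines right multiplication by the
    generator with it. \<open>\<sigma> x\<close> is the analogue on the tensor cube, and both sides
    of coassociativity are recursions along \<open>\<sigma>\<close>.\<close>
  define \<tau> where "\<tau> x = tensor_lift R UU.T (\<lambda>c d. (c \<otimes>\<^bsub>U\<^esub> \<iota> x) \<diamondop> d \<oplus>\<^bsub>UU.T\<^esub> c \<diamondop> (d \<otimes>\<^bsub>U\<^esub> \<iota> x))" for x
  have \<tau>: "linear_map R UU.T UU.T (\<tau> x)" if "x \<in> carrier L" for x
    unfolding \<tau>_def by (rule UU.linear_tensor_lift[OF UU.T.module_axioms \<tau>_bil[OF that]])
  have \<tau>_Delta: "\<Delta> (u \<otimes>\<^bsub>U\<^esub> \<iota> x) = \<tau> x (\<Delta> u)" if "u \<in> carrier U" "x \<in> carrier L" for u x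
    using Delta_lift_step[OF UU.T.module_axioms UU.bilinear_tensor that]
    by (simp add: \<tau>_def UU.tensor_lift_self that)
  have \<tau>_tens: "\<tau> x (a \<diamondop> b) = (a \<otimes>\<^bsub>U\<^esub> \<iota> x) \<diamondop> b \<oplus>\<^bsub>UU.T\<^esub> a \<diamondop> (b \<otimes>\<^bsub>U\<^esub> \<iota> x)"
    if "x \<in> carrier L" "a \<in> carrier U" "b \<in> carrier U" for x a b
    unfolding \<tau>_def by (rule UU.tensor_lift_tensor[OF UU.T.module_axioms \<tau>_bil[OF that(1)] that(2,3)])
  have \<sigma>_bil: "bilinear_map R UU.T U T3.T (\<lambda>t b. ?t (\<tau> x t) b \<oplus>\<^bsub>T3.T\<^esub> ?t t (b \<otimes>\<^bsub>U\<^esub> \<iota> x))" if "x \<in> carrier L" for x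
    using that
    by (intro bilinear_map_plus P T3.bilinear_tensor_map UU.T.module_axioms m \<tau> U.linear_mult_left linear_map_ident gen_closed)
  define \<sigma> where "\<sigma> x = tensor_lift R T3.T (\<lambda>t b. ?t (\<tau> x t) b \<oplus>\<^bsub>T3.T\<^esub> ?t t (b \<otimes>\<^bsub>U\<^esub> \<iota> x))" for x
  have \<sigma>: "linear_map R T3.T T3.T (\<sigma> x)" if "x \<in> carrier L" for x
    unfolding \<sigma>_def by (rule T3.linear_tensor_lift[OF P \<sigma>_bil[OF that]])
  have \<sigma>_tens: "\<sigma> x (?t t b) = ?t (\<tau> x t) b \<oplus>\<^bsub>T3.T\<^esub> ?t t (b \<otimes>\<^bsub>U\<^esub> \<iota> x)"
    if "x \<in> carrier L" "t \<in> carrier UU.T" "b \<in> carrier U" for x t b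
    unfolding \<sigma>_def by (rule T3.tensor_lift_tensor[OF P \<sigma>_bil[OF that(1)] that(2,3)])
  let ?h = "\<lambda>a b. tensor_lift R T3.T (\<lambda>c d. ?t (a \<diamondop> c) d) (\<Delta> b)"
  let ?g = "\<lambda>u. tensor_lift R T3.T ?h (\<Delta> u)"
  have h_closed [simp]: "?h a b \<in> carrier T3.T" if "a \<in> carrier U" "b \<in> carrier U" for a b
    by (rule bilinear_map_closed[OF b3 that])
  have h_step: "\<sigma> x (?h a b) = ?h (a \<otimes>\<^bsub>U\<^esub> \<iota> x) b \<oplus>\<^bsub>T3.T\<^esub> ?h a (b \<otimes>\<^bsub>U\<^esub> \<iota> x)"
    if a [simp]: "a \<in> carrier U" and b: "b \<in> carrier U" and x [simp]: "x \<in> carrier L" for a b x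
  proof -
    have ax: "a \<otimes>\<^bsub>U\<^esub> \<iota> x \<in> carrier U" by simp
    have bm: "bilinear_map R U U T3.T (\<lambda>c d. ?t (a \<diamondop> (c \<otimes>\<^bsub>U\<^esub> \<iota> x)) d \<oplus>\<^bsub>T3.T\<^esub> ?t (a \<diamondop> c) (d \<otimes>\<^bsub>U\<^esub> \<iota> x))"
      by (intro bilinear_map_plus P bilinear_map_comp2[OF b2[OF a]] U.linear_mult_left linear_map_ident gen_closed x)
    have "\<sigma> x (?h a b) = tensor_lift R T3.T (\<lambda>c d. \<sigma> x (?t (a \<diamondop> c) d)) (\<Delta> b)"
      by (rule UU.linear_map_tensor_lift[OF P P b2[OF a] \<sigma>[OF x] Delta_closed[OF b]])
    also have "\<dots> = tensor_lift R T3.T (\<lambda>c d. ?t ((a \<otimes>\<^bsub>U\<^esub> \<iota> x) \<diamondop> c) d \<oplus>\<^bsub>T3.T\<^esub>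
        (?t (a \<diamondop> (c \<otimes>\<^bsub>U\<^esub> \<iota> x)) d \<oplus>\<^bsub>T3.T\<^esub> ?t (a \<diamondop> c) (d \<otimes>\<^bsub>U\<^esub> \<iota> x))) (\<Delta> b)"
      by (rule UU.tensor_lift_cong[OF P bilinear_map_comp[OF b2[OF a] \<sigma>[OF x]] _ Delta_closed[OF b]])
        (simp add: \<sigma>_tens \<tau>_tens linear_map_add[OF T3.linear_tensor_left] T3.T.M.a_assoc)
    also have "\<dots> = ?h (a \<otimes>\<^bsub>U\<^esub> \<iota> x) b \<oplus>\<^bsub>T3.T\<^esub>
      tensor_lift R T3.T (\<lambda>c d. ?t (a \<diamondop> (c \<otimes>\<^bsub>U\<^esub> \<iota> x)) d \<oplus>\<^bsub>T3.T\<^esub> ?t (a \<diamondop> c) (d \<otimes>\<^bsub>U\<^esub> \<iota> x)) (\<Delta> b)"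
      by (rule UU.tensor_lift_plus[OF P b2[OF ax] bm Delta_closed[OF b]])
    also have "tensor_lift R T3.T (\<lambda>c d. ?t (a \<diamondop> (c \<otimes>\<^bsub>U\<^esub> \<iota> x)) d \<oplus>\<^bsub>T3.T\<^esub> ?t (a \<diamondop> c) (d \<otimes>\<^bsub>U\<^esub> \<iota> x)) (\<Delta> b) =
      ?h a (b \<otimes>\<^bsub>U\<^esub> \<iota> x)"
      by (rule Delta_lift_step[OF P b2[OF a] b x, symmetric])
    finally show ?thesis .
  qed
  have g_step: "?g (u \<otimes>\<^bsub>U\<^esub> \<iota> x) = \<sigma> x (?g u)" if u: "u \<in> carrier U" and x: "x \<in> carrier L" for u x
  proof -
    have "\<sigma> x (?g u) = tensor_lift R T3.T (\<lambda>a b. \<sigma> x (?h a b)) (\<Delta> u)"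
      by (rule UU.linear_map_tensor_lift[OF P P b3 \<sigma>[OF x] Delta_closed[OF u]])
    also have "\<dots> = tensor_lift R T3.T (\<lambda>a b. ?h (a \<otimes>\<^bsub>U\<^esub> \<iota> x) b \<oplus>\<^bsub>T3.T\<^esub> ?h a (b \<otimes>\<^bsub>U\<^esub> \<iota> x)) (\<Delta> u)"
      by (rule UU.tensor_lift_cong[OF P bilinear_map_comp[OF b3 \<sigma>[OF x]] h_step[OF _ _ x] Delta_closed[OF u]])
    also have "\<dots> = ?g (u \<otimes>\<^bsub>U\<^esub> \<iota> x)"
      by (rule Delta_lift_step[OF P b3 u x, symmetric])
    finally show ?thesis by (rule sym)
  qed
  show "tensor_lift R T3.T (\<lambda>a b. ?t (\<Delta> a) b) (\<Delta> u) = ?g u"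
  proof (rule Delta_lift_eqI[OF P b1 linear_map_comp[OF linear_Delta UU.linear_tensor_lift[OF P b3]] \<sigma> _ _ g_step assms])
    show "?t (\<Delta> \<one>\<^bsub>U\<^esub>) \<one>\<^bsub>U\<^esub> = ?g \<one>\<^bsub>U\<^esub>"
      by (simp only: Delta_lift_one[OF P b3] Delta_lift_one[OF P b2[OF U.one_closed]]) (simp only: Delta_one)
  qed (simp_all add: \<sigma>_tens \<tau>_Delta)
qed

lemma bilinear_smult_Eps_right: "bilinear_map R U U U (\<lambda>a b. \<epsilon> b \<odot>\<^bsub>U\<^esub> a)"
  using bilinear_Eps[OF U.module_axioms linear_map_ident] by (simp add: bilinear_map_def)

lemma counit_left_U: "u \<in> carrier U \<Longrightarrow> tensor_lift R U (\<lambda>a b. \<epsilon> a \<odot>\<^bsub>U\<^esub> b) (\<Delta> u) = u"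
  by (rule Delta_lift_eqI[OF U.module_axioms bilinear_Eps[OF U.module_axioms linear_map_ident] linear_map_ident
        U.linear_mult_left[OF gen_closed]])
    (simp_all add: Eps_one Eps_step U.smult_mult_left)

lemma counit_right_U: "u \<in> carrier U \<Longrightarrow> tensor_lift R U (\<lambda>a b. \<epsilon> b \<odot>\<^bsub>U\<^esub> a) (\<Delta> u) = u"
  by (rule Delta_lift_eqI[OF U.module_axioms bilinear_smult_Eps_right linear_map_ident
        U.linear_mult_left[OF gen_closed]])
    (simp_all add: Eps_one Eps_step U.smult_mult_left)

lemma antipode_U:
  obtains S where "linear_map R U U S"
    "\<And>u. u \<in> carrier U \<Longrightarrow> tensor_lift R U (\<lambda>a b. S a \<otimes>\<^bsub>U\<^esub> b) (\<Delta> u) = \<epsilon> u \<odot>\<^bsub>U\<^esub> \<one>\<^bsub>U\<^esub>"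
    "\<And>u. u \<in> carrier U \<Longrightarrow> tensor_lift R U (\<lambda>a b. a \<otimes>\<^bsub>U\<^esub> S b) (\<Delta> u) = \<epsilon> u \<odot>\<^bsub>U\<^esub> \<one>\<^bsub>U\<^esub>"
proof -
  note m = U.module_axioms
  \<comment> \<open>The antipode is the antihomomorphism that negates generators. It comes from the
    right action in which \<open>x\<close> sends \<open>u\<close> to \<open>- x u\<close>.\<close>
  have \<rho>: "bilinear_map R L U U (\<lambda>x u. \<ominus>\<^bsub>U\<^esub> (\<iota> x \<otimes>\<^bsub>U\<^esub> u))"
    by (rule bilinear_mapI; rule linear_map_neg[OF m])
      (auto intro: U.linear_mult_right linear_map_comp[OF linear_gen U.linear_mult_left])
  obtain S where S: "linear_map R U U S" and S_one: "S \<one>\<^bsub>U\<^esub> = \<one>\<^bsub>U\<^esub>"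
    and S_step: "\<And>u x. \<lbrakk>u \<in> carrier U; x \<in> carrier L\<rbrakk> \<Longrightarrow> S (u \<otimes>\<^bsub>U\<^esub> \<iota> x) = \<ominus>\<^bsub>U\<^esub> (\<iota> x \<otimes>\<^bsub>U\<^esub> S u)"
  proof (rule U_rec[OF m U.one_closed \<rho>])
    fix x y p assume [simp]: "x \<in> carrier L" "y \<in> carrier L" "p \<in> carrier U"
    have "\<ominus>\<^bsub>U\<^esub> (\<iota> y \<otimes>\<^bsub>U\<^esub> (\<ominus>\<^bsub>U\<^esub> (\<iota> x \<otimes>\<^bsub>U\<^esub> p))) \<ominus>\<^bsub>U\<^esub> \<ominus>\<^bsub>U\<^esub> (\<iota> x \<otimes>\<^bsub>U\<^esub> (\<ominus>\<^bsub>U\<^esub> (\<iota> y \<otimes>\<^bsub>U\<^esub> p))) =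
      \<ominus>\<^bsub>U\<^esub> ((\<iota> x \<otimes>\<^bsub>U\<^esub> \<iota> y \<ominus>\<^bsub>U\<^esub> \<iota> y \<otimes>\<^bsub>U\<^esub> \<iota> x) \<otimes>\<^bsub>U\<^esub> p)"
      by (simp add: U.minus_eq U.l_distr U.r_minus U.l_minus U.m_assoc U.minus_add U.a_comm)
    then show "\<ominus>\<^bsub>U\<^esub> (\<iota> y \<otimes>\<^bsub>U\<^esub> (\<ominus>\<^bsub>U\<^esub> (\<iota> x \<otimes>\<^bsub>U\<^esub> p))) \<ominus>\<^bsub>U\<^esub> \<ominus>\<^bsub>U\<^esub> (\<iota> x \<otimes>\<^bsub>U\<^esub> (\<ominus>\<^bsub>U\<^esub> (\<iota> y \<otimes>\<^bsub>U\<^esub> p))) =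
      \<ominus>\<^bsub>U\<^esub> (\<iota> (br x y) \<otimes>\<^bsub>U\<^esub> p)"
      by (simp add: gen_commutator)
  qed blast
  note S_closed [simp] = linear_map_closed[OF S]
  have r: "linear_map R U U (\<lambda>u. \<epsilon> u \<odot>\<^bsub>U\<^esub> \<one>\<^bsub>U\<^esub>)"
    by (rule bilinear_map_left[OF bilinear_Eps[OF m linear_map_ident] U.one_closed])
  have bl: "bilinear_map R U U U (\<lambda>a b. S a \<otimes>\<^bsub>U\<^esub> b)"
    by (rule bilinear_map_comp2[OF U.bilinear_mult S linear_map_ident])
  have br: "bilinear_map R U U U (\<lambda>a b. a \<otimes>\<^bsub>U\<^esub> S b)"
    by (rule bilinear_map_comp2[OF U.bilinear_mult linear_map_ident S])
  have left: "tensor_lift R U (\<lambda>a b. S a \<otimes>\<^bsub>U\<^esub> b) (\<Delta> u) = \<epsilon> u \<odot>\<^bsub>U\<^esub> \<one>\<^bsub>U\<^esub>" if u: "u \<in> carrier U" for u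
  proof (rule Delta_lift_eqI[OF m bl r _ _ _ _ u])
    \<comment> \<open>Appending \<open>x\<close> replaces the convolution \<open>S(a) b\<close> by
      its commutator with \<open>x\<close>, and multiples of the unit have zero commutator.\<close>
    show "linear_map R U U (\<lambda>c. c \<otimes>\<^bsub>U\<^esub> \<iota> x \<ominus>\<^bsub>U\<^esub> \<iota> x \<otimes>\<^bsub>U\<^esub> c)" if "x \<in> carrier L" for x
      by (intro linear_map_minus m U.linear_mult_left U.linear_mult_right gen_closed that)
  qed (simp_all add: Eps_one S_one S_step Eps_step U.minus_eq U.l_minus U.m_assoc U.a_comm U.r_neg
      U.smult_mult_left U.smult_mult_right)
  \<comment> \<open>Here the two terms created by \<open>x\<close> cancel, \<open>a x S(b)\<close>
    against \<open>- a x S(b)\<close>, so the operator of the recursion is zero.\<close>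
  have right: "tensor_lift R U (\<lambda>a b. a \<otimes>\<^bsub>U\<^esub> S b) (\<Delta> u) = \<epsilon> u \<odot>\<^bsub>U\<^esub> \<one>\<^bsub>U\<^esub>" if u: "u \<in> carrier U" for u
    by (rule Delta_lift_eqI[OF m br r linear_map_const_zero[OF m] _ _ _ u])
      (simp_all add: Eps_one S_one S_step Eps_step U.r_minus U.m_assoc U.r_neg)
  show thesis by (rule that[OF S left right])
qed

lemma hopf_algebra_primitive: "hopf_algebra R (primitive_hopf R L U \<iota>)"
proof -
  obtain S where S: "linear_map R U U S"
    "\<And>u. u \<in> carrier U \<Longrightarrow> tensor_lift R U (\<lambda>a b. S a \<otimes>\<^bsub>U\<^esub> b) (\<Delta> u) = \<epsilon> u \<odot>\<^bsub>U\<^esub> \<one>\<^bsub>U\<^esub>"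
    "\<And>u. u \<in> carrier U \<Longrightarrow> tensor_lift R U (\<lambda>a b. a \<otimes>\<^bsub>U\<^esub> S b) (\<Delta> u) = \<epsilon> u \<odot>\<^bsub>U\<^esub> \<one>\<^bsub>U\<^esub>"
    using antipode_U by blast
  show ?thesis
    by (rule hopf_algebraI[OF U.assoc_algebra_axioms primitive_hopf_simps(1-6), unfolded primitive_hopf_simps(7,8),
          OF alg_hom_Delta alg_hom_Eps coassoc_U counit_left_U counit_right_U S])
qed

end

section \<open>The symmetric algebra of a pre-Lie algebra\<close>

context pre_lie_algebra
begin

lemma pl_closed [simp, intro]: "\<lbrakk>x \<in> carrier L; y \<in> carrier L\<rbrakk> \<Longrightarrow> x \<star> y \<in> carrier L"
  by (rule bilinear_map_closed[OF pl_bilinear])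

lemma lie_bracket_closed: "\<lbrakk>x \<in> carrier L; y \<in> carrier L\<rbrakk> \<Longrightarrow> lie_bracket L pl x y \<in> carrier L"
  by (simp add: lie_bracket_def)

sublocale S: bracket_module R L "\<lambda>_ _. \<zero>\<^bsub>L\<^esub>"
  by unfold_locales simp

sublocale E: bracket_module R L "lie_bracket L pl"
  by unfold_locales (rule lie_bracket_closed)

abbreviation "SL \<equiv> S.U"
abbreviation "EL \<equiv> E.U"
abbreviation times_S (infixl \<open>\<cdot>\<close> 70) where "u \<cdot> v \<equiv> u \<otimes>\<^bsub>SL\<^esub> v"
abbreviation words where "words \<equiv> lists (carrier L)"
abbreviation sgen (\<open>\<sigma>\<close>) where "\<sigma> \<equiv> S.gen"
abbreviation egen (\<open>\<upsilon>\<close>) where "\<upsilon> \<equiv> E.gen"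

text \<open>The commutator relation of the zero bracket subtracts the generator of zero, which
  vanishes by linearity; the two ideals then have the same generators.\<close>

lemma symmetric_algebra_eq: "symmetric_algebra R L = SL" and symmetric_gen_eq: "symmetric_gen R L = \<sigma>"
proof -
  have z: "tensor_gen R L \<zero>\<^bsub>L\<^esub> = \<zero>\<^bsub>S.TL\<^esub>"
    by (rule linear_map_zero[OF module_axioms S.T.module_axioms S.linear_tensor_gen])
  have [simp]: "a \<ominus>\<^bsub>S.TL\<^esub> \<zero>\<^bsub>S.TL\<^esub> = a" if "a \<in> carrier S.TL" for a
    using that by (simp add: S.T.minus_eq)
  have "enveloping_ideal R L (\<lambda>_ _. \<zero>\<^bsub>L\<^esub>) = symmetric_ideal R L"
    unfolding enveloping_ideal_def symmetric_ideal_def Let_def z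
    by (rule arg_cong[of _ _ "genideal S.TL"]) (rule Collect_cong, intro ex_cong1, auto)
  then show "symmetric_algebra R L = SL" "symmetric_gen R L = \<sigma>"
    by (simp_all add: symmetric_algebra_def enveloping_algebra_def symmetric_gen_def enveloping_gen_def fun_eq_iff)
qed

section \<open>Commutativity of the symmetric algebra\<close>

lemma sgen_commute: "\<lbrakk>x \<in> carrier L; y \<in> carrier L\<rbrakk> \<Longrightarrow> \<sigma> x \<cdot> \<sigma> y = \<sigma> y \<cdot> \<sigma> x"
  using S.gen_commutator[of x y] linear_map_zero[OF module_axioms S.U.module_axioms S.linear_gen]
  by (simp add: S.U.minus_eq_zero_iff)

lemma S_gen_commute:
  assumes u: "u \<in> carrier SL" and x [simp]: "x \<in> carrier L"
  shows "u \<cdot> \<sigma> x = \<sigma> x \<cdot> u"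
proof (rule S.U_ext[OF S.U.module_axioms S.U.linear_mult_left S.U.linear_mult_right _ _ u])
  fix u y assume [simp]: "u \<in> carrier SL" "y \<in> carrier L" and IH: "u \<cdot> \<sigma> x = \<sigma> x \<cdot> u"
  have "u \<cdot> \<sigma> y \<cdot> \<sigma> x = u \<cdot> \<sigma> x \<cdot> \<sigma> y"
    by (simp add: S.U.m_assoc sgen_commute[of y x])
  then show "u \<cdot> \<sigma> y \<cdot> \<sigma> x = \<sigma> x \<cdot> (u \<cdot> \<sigma> y)"
    by (simp add: IH S.U.m_assoc)
qed simp_all

lemma S_commute:
  assumes u: "u \<in> carrier SL" and v: "v \<in> carrier SL"
  shows "u \<cdot> v = v \<cdot> u"
proof (rule S.U_ext[OF S.U.module_axioms S.U.linear_mult_right[OF u] S.U.linear_mult_left[OF u] _ _ v])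
  fix v x assume [simp]: "v \<in> carrier SL" "x \<in> carrier L" and IH: "u \<cdot> v = v \<cdot> u"
  have "u \<cdot> (v \<cdot> \<sigma> x) = v \<cdot> (u \<cdot> \<sigma> x)"
    using u by (metis IH S.U.m_assoc S.gen_closed \<open>v \<in> carrier SL\<close> \<open>x \<in> carrier L\<close>)
  then show "u \<cdot> (v \<cdot> \<sigma> x) = v \<cdot> \<sigma> x \<cdot> u"
    using u by (simp add: S.U.m_assoc flip: S_gen_commute)
qed (use u in simp_all)

lemma S_lcomm:
  "\<lbrakk>u \<in> carrier SL; v \<in> carrier SL; w \<in> carrier SL\<rbrakk> \<Longrightarrow> u \<cdot> (v \<cdot> w) = v \<cdot> (u \<cdot> w)"
  by (simp add: S_commute[of u v] flip: S.U.m_assoc)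

lemma S_word_gen: "\<lbrakk>w \<in> words; x \<in> carrier L\<rbrakk> \<Longrightarrow> S.word w \<cdot> \<sigma> x = S.word (x # w)"
  by (simp add: S.word_Cons S_gen_commute)

lemma S_word_swap:
  "\<lbrakk>u \<in> words; v \<in> words; x \<in> carrier L; y \<in> carrier L\<rbrakk>
    \<Longrightarrow> S.word (u @ x # y # v) = S.word (u @ y # x # v)"
  by (simp add: S.word_append S.word_Cons S_lcomm)

lemma S_word_zero: "\<lbrakk>u \<in> words; v \<in> words\<rbrakk> \<Longrightarrow> S.word (u @ \<zero>\<^bsub>L\<^esub> # v) = \<zero>\<^bsub>SL\<^esub>"
  by (rule linear_map_zero[OF module_axioms S.U.module_axioms S.linear_word_slot])

text \<open>\<open>der x\<close> is the derivation \<open>u \<mapsto> u \<circ> x\<close> of the symmetric algebra.\<close>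

primrec der_word :: "'c \<Rightarrow> 'c list \<Rightarrow> ('c list \<Rightarrow> 'a) set set" where
  "der_word x [] = \<zero>\<^bsub>SL\<^esub>"
| "der_word x (y # w) = S.word ((y \<star> x) # w) \<oplus>\<^bsub>SL\<^esub> \<sigma> y \<cdot> der_word x w"

text \<open>The Leibniz rule on words passes to \<open>S(L)\<close> because it is linear in each
  letter and insensitive to an exchange of neighbours. A word with a letter zero is sent to zero by
  linearity, as the relation for the zero bracket demands.\<close>

lemma der_exists:
  assumes [simp]: "x \<in> carrier L"
  shows "\<exists>G. linear_map R SL SL G \<and> (\<forall>w\<in>words. G (S.word w) = der_word x w)"
proof -
  note m = S.U.module_axioms
  have closed [simp]: "der_word x w \<in> carrier SL" if "w \<in> words" for w
    using that by (induction w) auto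
  have lin: "linear_map R L SL (\<lambda>y. der_word x (u @ y # v))" if "u \<in> words" and v [simp]: "v \<in> words" for u v
    using that(1)
  proof (induction u)
    case Nil
    have "linear_map R L SL (\<lambda>y. S.word ((y \<star> x) # v))"
      using linear_map_comp[OF bilinear_map_left[OF pl_bilinear] S.linear_word_slot[of "[]" v]] by simp
    moreover have "linear_map R L SL (\<lambda>y. \<sigma> y \<cdot> der_word x v)"
      by (rule linear_map_comp[OF S.linear_gen S.U.linear_mult_left]) simp
    ultimately show ?case by (simp add: linear_map_plus[OF m])
  next
    case (Cons z u)
    then have "linear_map R L SL (\<lambda>y. S.word (((z \<star> x) # u) @ y # v))"
      by (intro S.linear_word_slot) auto
    moreover have "linear_map R L SL (\<lambda>y. \<sigma> z \<cdot> der_word x (u @ y # v))"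
      by (rule linear_map_comp[OF _ S.U.linear_mult_right]) (use Cons in simp_all)
    ultimately show ?case by (simp add: linear_map_plus[OF m])
  qed
  \<comment> \<open>An exchange at the head only reorders the terms in which one of the two letters
    is differentiated and the remaining one. Deeper in the word, commutativity settles the first
    summand and the induction hypothesis the second.\<close>
  have swap: "der_word x (u @ y # z # v) = der_word x (u @ z # y # v)"
    if "u \<in> words" and [simp]: "v \<in> words" "y \<in> carrier L" "z \<in> carrier L" for u v y z
    using that(1)
  proof (induction u)
    case Nil
    show ?case
      by (simp add: S.U.r_distr S.word_Cons S_lcomm S.U.a_lcomm)
  next
    case (Cons a u)
    then show ?case
      using S_word_swap[of "(a \<star> x) # u" v y z] by auto
  qed
  obtain G where "linear_map R SL SL G" "\<And>w. w \<in> words \<Longrightarrow> G (S.word w) = der_word x w"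
  proof (rule S.U_lift_words[OF m, of "der_word x"])
    fix u v y z assume [simp]: "u \<in> words" "v \<in> words" "y \<in> carrier L" "z \<in> carrier L"
    show "der_word x (u @ y # z # v) \<ominus>\<^bsub>SL\<^esub> der_word x (u @ z # y # v) = der_word x (u @ \<zero>\<^bsub>L\<^esub> # v)"
      using linear_map_zero[OF module_axioms m lin[of u v]] by (simp add: swap S.U.minus_eq_zero_iff)
  qed (use linear_map_add[OF lin] linear_map_smult[OF lin] in simp_all)
  then show ?thesis by blast
qed

definition der :: "'c \<Rightarrow> ('c list \<Rightarrow> 'a) set set \<Rightarrow> ('c list \<Rightarrow> 'a) set set" where
  "der x = (SOME G. linear_map R SL SL G \<and> (\<forall>w\<in>words. G (S.word w) = der_word x w))"

lemma linear_der: "x \<in> carrier L \<Longrightarrow> linear_map R SL SL (der x)"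
  and der_word: "\<lbrakk>x \<in> carrier L; w \<in> words\<rbrakk> \<Longrightarrow> der x (S.word w) = der_word x w"
  using someI_ex[OF der_exists] unfolding der_def by blast+

lemma der_closed [simp]: "\<lbrakk>x \<in> carrier L; u \<in> carrier SL\<rbrakk> \<Longrightarrow> der x u \<in> carrier SL"
  by (rule linear_map_closed[OF linear_der])

lemma der_one: "x \<in> carrier L \<Longrightarrow> der x \<one>\<^bsub>SL\<^esub> = \<zero>\<^bsub>SL\<^esub>"
  using der_word[of x "[]"] by (simp add: S.word_Nil)

lemma der_word_Cons:
  "\<lbrakk>x \<in> carrier L; y \<in> carrier L; w \<in> words\<rbrakk>
    \<Longrightarrow> der x (S.word (y # w)) = S.word ((y \<star> x) # w) \<oplus>\<^bsub>SL\<^esub> \<sigma> y \<cdot> der x (S.word w)"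
  by (simp add: der_word)

text \<open>The rule on words peels off the first letter. Commutativity turns it into a rule for the
  last factor, the form that induction along right multiplication needs.\<close>

lemma der_step:
  assumes x [simp]: "x \<in> carrier L" and u: "u \<in> carrier SL" and y [simp]: "y \<in> carrier L"
  shows "der x (u \<cdot> \<sigma> y) = der x u \<cdot> \<sigma> y \<oplus>\<^bsub>SL\<^esub> u \<cdot> \<sigma> (y \<star> x)"
proof (rule S.U_ext_words[OF S.U.module_axioms _ _ _ u])
  show "linear_map R SL SL (\<lambda>u. der x (u \<cdot> \<sigma> y))"
    by (rule linear_map_comp[OF S.U.linear_mult_left linear_der]) simp_all
  show "linear_map R SL SL (\<lambda>u. der x u \<cdot> \<sigma> y \<oplus>\<^bsub>SL\<^esub> u \<cdot> \<sigma> (y \<star> x))"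
    by (intro linear_map_plus S.U.module_axioms S.U.linear_mult_left linear_map_comp[OF linear_der S.U.linear_mult_left])
      simp_all
  fix w assume "w \<in> words"
  then show "der x (S.word w \<cdot> \<sigma> y) = der x (S.word w) \<cdot> \<sigma> y \<oplus>\<^bsub>SL\<^esub> S.word w \<cdot> \<sigma> (y \<star> x)"
    by (simp add: S_word_gen der_word_Cons) (simp add: S_gen_commute S.U.a_comm)
qed

lemma der_gen: "\<lbrakk>x \<in> carrier L; y \<in> carrier L\<rbrakk> \<Longrightarrow> der x (\<sigma> y) = \<sigma> (y \<star> x)"
  using der_step[of x "\<one>\<^bsub>SL\<^esub>" y] by (simp add: der_one)

lemma bilinear_der: "bilinear_map R L SL SL der"
proof (rule bilinear_mapI[OF linear_der])
  fix u assume u: "u \<in> carrier SL"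
  note m = S.U.module_axioms
  show "linear_map R L SL (\<lambda>x. der x u)"
  proof (rule linear_mapI)
    fix x assume x [simp]: "x \<in> carrier L"
    show "der (x \<oplus>\<^bsub>L\<^esub> y) u = der x u \<oplus>\<^bsub>SL\<^esub> der y u" if y [simp]: "y \<in> carrier L" for y
    proof (rule S.U_ext[OF m linear_der linear_map_plus[OF m linear_der linear_der] _ _ u])
      fix u z assume [simp]: "u \<in> carrier SL" "z \<in> carrier L" and IH: "der (x \<oplus>\<^bsub>L\<^esub> y) u = der x u \<oplus>\<^bsub>SL\<^esub> der y u"
      show "der (x \<oplus>\<^bsub>L\<^esub> y) (u \<cdot> \<sigma> z) = der x (u \<cdot> \<sigma> z) \<oplus>\<^bsub>SL\<^esub> der y (u \<cdot> \<sigma> z)"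
        by (simp add: der_step IH S.U.l_distr S.U.r_distr linear_map_add[OF bilinear_map_right[OF pl_bilinear]]
            linear_map_add[OF S.linear_gen] S.U.a_ac)
    qed (simp_all add: der_one)
    show "der (r \<odot>\<^bsub>L\<^esub> x) u = r \<odot>\<^bsub>SL\<^esub> der x u" if r [simp]: "r \<in> carrier R" for r
    proof (rule S.U_ext[OF m linear_der linear_map_scale[OF m linear_der] _ _ u])
      fix u z assume [simp]: "u \<in> carrier SL" "z \<in> carrier L" and IH: "der (r \<odot>\<^bsub>L\<^esub> x) u = r \<odot>\<^bsub>SL\<^esub> der x u"
      show "der (r \<odot>\<^bsub>L\<^esub> x) (u \<cdot> \<sigma> z) = r \<odot>\<^bsub>SL\<^esub> der x (u \<cdot> \<sigma> z)"
        by (simp add: der_step IH S.U.smult_r_distr linear_map_smult[OF bilinear_map_right[OF pl_bilinear]]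
            linear_map_smult[OF S.linear_gen] S.U.smult_mult_left S.U.smult_mult_right)
    qed (simp_all add: der_one)
  qed (use u in simp)
qed

lemma der_mult:
  assumes x [simp]: "x \<in> carrier L" and u [simp]: "u \<in> carrier SL" and v: "v \<in> carrier SL"
  shows "der x (u \<cdot> v) = der x u \<cdot> v \<oplus>\<^bsub>SL\<^esub> u \<cdot> der x v"
proof (rule S.U_ext[OF S.U.module_axioms _ _ _ _ v])
  show "linear_map R SL SL (\<lambda>v. der x (u \<cdot> v))"
    by (rule linear_map_comp[OF S.U.linear_mult_right linear_der]) simp_all
  show "linear_map R SL SL (\<lambda>v. der x u \<cdot> v \<oplus>\<^bsub>SL\<^esub> u \<cdot> der x v)"
    by (intro linear_map_plus S.U.module_axioms S.U.linear_mult_right linear_map_comp[OF linear_der S.U.linear_mult_right])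
      simp_all
  fix v y assume [simp]: "v \<in> carrier SL" "y \<in> carrier L"
    and IH: "der x (u \<cdot> v) = der x u \<cdot> v \<oplus>\<^bsub>SL\<^esub> u \<cdot> der x v"
  have "der x (u \<cdot> v \<cdot> \<sigma> y) = der x (u \<cdot> v) \<cdot> \<sigma> y \<oplus>\<^bsub>SL\<^esub> (u \<cdot> v) \<cdot> \<sigma> (y \<star> x)"
    by (rule der_step) simp_all
  also have "\<dots> = der x u \<cdot> (v \<cdot> \<sigma> y) \<oplus>\<^bsub>SL\<^esub> u \<cdot> der x (v \<cdot> \<sigma> y)"
    by (simp add: der_step IH S.U.l_distr S.U.r_distr S.U.m_assoc S.U.a_assoc)
  finally show "der x (u \<cdot> (v \<cdot> \<sigma> y)) =
    der x u \<cdot> (v \<cdot> \<sigma> y) \<oplus>\<^bsub>SL\<^esub> u \<cdot> der x (v \<cdot> \<sigma> y)"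
    by (simp add: S.U.m_assoc)
qed (simp add: der_one)

text \<open>The pre-Lie identity enters only here, as the statement that right multiplications form
  a right action of the Lie algebra.\<close>

lemma pl_right_action:
  assumes [simp]: "x \<in> carrier L" "y \<in> carrier L" "z \<in> carrier L"
  shows "((z \<star> x) \<star> y) \<ominus>\<^bsub>L\<^esub> ((z \<star> y) \<star> x) = z \<star> lie_bracket L pl x y"
proof -
  have "z \<star> lie_bracket L pl x y = z \<star> (x \<star> y) \<ominus>\<^bsub>L\<^esub> z \<star> (y \<star> x)"
    unfolding lie_bracket_def
    by (rule linear_map_diff[OF module_axioms module_axioms bilinear_map_right[OF pl_bilinear]]) simp_all
  then show ?thesis
    using M.minus_eq_minus_swap[OF pre_lie[of z x y]] by simp
qed

text \<open>A commutator of derivations is again a derivation, because the cross terms with one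
  derivative on each factor cancel. It is determined by its values on generators, which
  \<open>pl_right_action\<close> supplies.\<close>

lemma der_action:
  assumes x [simp]: "x \<in> carrier L" and y [simp]: "y \<in> carrier L" and u: "u \<in> carrier SL"
  shows "der y (der x u) \<ominus>\<^bsub>SL\<^esub> der x (der y u) = der (lie_bracket L pl x y) u"
proof (rule S.U_ext[OF S.U.module_axioms linear_map_minus[OF S.U.module_axioms] _ _ _ u])
  note m = S.U.module_axioms
  show "linear_map R SL SL (\<lambda>u. der y (der x u))" "linear_map R SL SL (\<lambda>u. der x (der y u))"
    by (rule linear_map_comp[OF linear_der linear_der]; simp)+
  show "linear_map R SL SL (der (lie_bracket L pl x y))"
    by (rule linear_der) (simp add: lie_bracket_closed)
  show "der y (der x \<one>\<^bsub>SL\<^esub>) \<ominus>\<^bsub>SL\<^esub> der x (der y \<one>\<^bsub>SL\<^esub>) = der (lie_bracket L pl x y) \<one>\<^bsub>SL\<^esub>"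
    by (simp add: der_one lie_bracket_closed linear_map_zero[OF m m linear_der] S.U.minus_eq)
  fix u z assume [simp]: "u \<in> carrier SL" "z \<in> carrier L"
    and IH: "der y (der x u) \<ominus>\<^bsub>SL\<^esub> der x (der y u) = der (lie_bracket L pl x y) u"
  have "der y (der x (u \<cdot> \<sigma> z)) \<ominus>\<^bsub>SL\<^esub> der x (der y (u \<cdot> \<sigma> z)) =
    ((der y (der x u) \<cdot> \<sigma> z \<oplus>\<^bsub>SL\<^esub> der x u \<cdot> \<sigma> (z \<star> y)) \<oplus>\<^bsub>SL\<^esub>
      (der y u \<cdot> \<sigma> (z \<star> x) \<oplus>\<^bsub>SL\<^esub> u \<cdot> \<sigma> ((z \<star> x) \<star> y))) \<ominus>\<^bsub>SL\<^esub>
    ((der x (der y u) \<cdot> \<sigma> z \<oplus>\<^bsub>SL\<^esub> der y u \<cdot> \<sigma> (z \<star> x)) \<oplus>\<^bsub>SL\<^esub>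
      (der x u \<cdot> \<sigma> (z \<star> y) \<oplus>\<^bsub>SL\<^esub> u \<cdot> \<sigma> ((z \<star> y) \<star> x)))"
    by (simp add: der_step linear_map_add[OF linear_der])
  also have "\<dots> = (der y (der x u) \<cdot> \<sigma> z \<ominus>\<^bsub>SL\<^esub> der x (der y u) \<cdot> \<sigma> z) \<oplus>\<^bsub>SL\<^esub>
      (u \<cdot> \<sigma> ((z \<star> x) \<star> y) \<ominus>\<^bsub>SL\<^esub> u \<cdot> \<sigma> ((z \<star> y) \<star> x))"
    by (rule S.U.cross_terms_cancel) simp_all
  also have "der y (der x u) \<cdot> \<sigma> z \<ominus>\<^bsub>SL\<^esub> der x (der y u) \<cdot> \<sigma> z =
    der (lie_bracket L pl x y) u \<cdot> \<sigma> z"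
    by (simp add: linear_map_diff[OF m m S.U.linear_mult_left] flip: IH)
  also have "u \<cdot> \<sigma> ((z \<star> x) \<star> y) \<ominus>\<^bsub>SL\<^esub> u \<cdot> \<sigma> ((z \<star> y) \<star> x) = u \<cdot> \<sigma> (z \<star> lie_bracket L pl x y)"
    by (simp add: linear_map_diff[OF m m S.U.linear_mult_right] linear_map_diff[OF module_axioms m S.linear_gen]
        flip: pl_right_action)
  finally show "der y (der x (u \<cdot> \<sigma> z)) \<ominus>\<^bsub>SL\<^esub> der x (der y (u \<cdot> \<sigma> z)) =
    der (lie_bracket L pl x y) (u \<cdot> \<sigma> z)"
    by (simp add: der_step lie_bracket_closed)
qed

end

section \<open>Recursion along the derivations\<close>

context pre_lie_algebra
begin

text \<open>This expresses without a grading that \<open>der x\<close> preserves the degree: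
  \<open>der x\<close> of a word is a combination of words of the same length. Both maps are
  generalised in the induction, which moves the first letter into them.\<close>

lemma der_word_ext:
  assumes "module R P" "linear_map R SL P f" "linear_map R SL P g" and x: "x \<in> carrier L" and v: "v \<in> words"
    and "\<And>w. \<lbrakk>w \<in> words; length w = length v\<rbrakk> \<Longrightarrow> f (S.word w) = g (S.word w)"
  shows "f (der x (S.word v)) = g (der x (S.word v))"
  using v assms(2,3,6)
proof (induction v arbitrary: f g)
  case Nil
  then show ?case
    using x linear_map_zero[OF S.U.module_axioms assms(1) Nil.prems(1)]
      linear_map_zero[OF S.U.module_axioms assms(1) Nil.prems(2)] by (simp add: S.word_Nil der_one)
next
  case (Cons y v)
  have y [simp]: "y \<in> carrier L" and v [simp]: "v \<in> words" using Cons.hyps by simp_all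
  have l: "linear_map R SL P (\<lambda>u. h (\<sigma> y \<cdot> u))" if "linear_map R SL P h" for h
    by (rule linear_map_comp[OF S.U.linear_mult_right that]) simp
  have "f (\<sigma> y \<cdot> der x (S.word v)) = g (\<sigma> y \<cdot> der x (S.word v))"
  proof (rule Cons.IH[OF l[OF Cons.prems(1)] l[OF Cons.prems(2)]])
    fix w assume "w \<in> words" "length w = length v"
    then show "f (\<sigma> y \<cdot> S.word w) = g (\<sigma> y \<cdot> S.word w)"
      using Cons.prems(3)[of "y # w"] by (simp add: S.word_Cons)
  qed
  moreover have "f (S.word ((y \<star> x) # v)) = g (S.word ((y \<star> x) # v))"
    using x by (intro Cons.prems(3)) simp_all
  ultimately show ?case
    using x by (simp add: der_word_Cons linear_map_add[OF Cons.prems(1)] linear_map_add[OF Cons.prems(2)])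
qed

text \<open>The recursion \<open>F (xu) = \<rho> x (F u) - F (der x u)\<close> is solved degree by degree: \<open>rec_upto n H\<close>
  says that it holds for words \<open>u\<close> with fewer than \<open>n\<close> letters. Since \<open>der x\<close> preserves the degree,
  the values of \<open>F\<close> on words with \<open>n + 1\<close> letters only depend on its values on words with \<open>n\<close> letters.\<close>

definition rec_upto where
  "rec_upto P \<rho> m n H \<longleftrightarrow> linear_map R SL P H \<and> H \<one>\<^bsub>SL\<^esub> = m \<and>
    (\<forall>y\<in>carrier L. \<forall>v\<in>words. length v < n \<longrightarrow>
      H (S.word (y # v)) = \<rho> y (H (S.word v)) \<ominus>\<^bsub>P\<^esub> H (der y (S.word v)))"

text \<open>Induction on length: the value on \<open>y # v\<close> is determined by those on
  \<open>v\<close> and on \<open>der y\<close> of \<open>v\<close>, and the latter involves only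
  words as long as \<open>v\<close>.\<close>

lemma rec_upto_unique:
  assumes P: "module R P" and H: "rec_upto P \<rho> m n H" and H': "rec_upto P \<rho> m n H'"
    and "w \<in> words" "length w \<le> n"
  shows "H (S.word w) = H' (S.word w)"
  using assms(4,5)
proof (induction "length w" arbitrary: w)
  case 0
  then show ?case using H H' by (simp add: rec_upto_def S.word_Nil)
next
  case (Suc k)
  then obtain y v where w: "w = y # v" and v [simp]: "y \<in> carrier L" "v \<in> words" and k: "length v = k"
    by (cases w) auto
  have "H (S.word v) = H' (S.word v)"
    using Suc k by (simp add: w)
  moreover have "H (der y (S.word v)) = H' (der y (S.word v))"
  proof (rule der_word_ext[OF P _ _ v])
    show "linear_map R SL P H" "linear_map R SL P H'" using H H' by (simp_all add: rec_upto_def)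
    show "H (S.word a) = H' (S.word a)" if "a \<in> words" "length a = length v" for a
      using that Suc k by (simp add: w)
  qed
  ultimately show ?case
    using H H' Suc.prems by (simp add: rec_upto_def w)
qed

text \<open>The recursion itself is taken as the definition of the new values, with the first letter
  as the one that is peeled off. The point is that the outcome does not depend on which letter comes
  first.\<close>

lemma rec_upto_Suc:
  assumes P: "module R P" and m: "m \<in> carrier P" and \<rho>: "bilinear_map R L P P \<rho>"
    and comm: "\<And>x y p. \<lbrakk>x \<in> carrier L; y \<in> carrier L; p \<in> carrier P\<rbrakk>
      \<Longrightarrow> \<rho> y (\<rho> x p) \<ominus>\<^bsub>P\<^esub> \<rho> x (\<rho> y p) = \<rho> (lie_bracket L pl x y) p"
    and H: "rec_upto P \<rho> m n H"
  shows "\<exists>H'. rec_upto P \<rho> m (Suc n) H'"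
proof -
  interpret P: module R P by fact
  note sm = S.U.module_axioms
  have lin: "linear_map R SL P H" and H_one: "H \<one>\<^bsub>SL\<^esub> = m"
    and H_Cons: "\<And>y v. \<lbrakk>y \<in> carrier L; v \<in> words; length v < n\<rbrakk>
      \<Longrightarrow> H (S.word (y # v)) = \<rho> y (H (S.word v)) \<ominus>\<^bsub>P\<^esub> H (der y (S.word v))"
    using H by (simp_all add: rec_upto_def)
  note \<rho>_left = bilinear_map_left[OF \<rho>] and \<rho>_right = bilinear_map_right[OF \<rho>]
  note [simp] = bilinear_map_closed[OF \<rho>] linear_map_closed[OF lin]
  have linG: "linear_map R SL P (\<lambda>u. \<rho> y (H u) \<ominus>\<^bsub>P\<^esub> H (der y u))" if "y \<in> carrier L" for y
    by (intro linear_map_minus P linear_map_comp[OF lin \<rho>_right] linear_map_comp[OF linear_der lin] that)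
  \<comment> \<open>The value zero beyond \<open>n + 1\<close> letters makes \<open>f\<close> total.
    The relations of the symmetric algebra relate words of equal length, up to words with a letter
    zero, on which \<open>f\<close> vanishes by linearity; so the truncation respects them.\<close>
  define f where "f w = (case w of [] \<Rightarrow> m
    | y # v \<Rightarrow> if length v \<le> n then \<rho> y (H (S.word v)) \<ominus>\<^bsub>P\<^esub> H (der y (S.word v)) else \<zero>\<^bsub>P\<^esub>)" for w
  have f_Nil: "f [] = m" and f_Cons: "f (y # v) =
      (if length v \<le> n then \<rho> y (H (S.word v)) \<ominus>\<^bsub>P\<^esub> H (der y (S.word v)) else \<zero>\<^bsub>P\<^esub>)" for y v
    by (simp_all add: f_def)
  have f_closed: "f w \<in> carrier P" if "w \<in> words" for w
    using that m by (cases w) (simp_all add: f_Nil f_Cons)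
  have slot: "linear_map R L P (\<lambda>x. f (u @ x # v))" if "u \<in> words" and v [simp]: "v \<in> words" for u v
  proof (cases u)
    case Nil
    show ?thesis
    proof (cases "length v \<le> n")
      case True
      have "linear_map R L P (\<lambda>x. \<rho> x (H (S.word v)) \<ominus>\<^bsub>P\<^esub> H (der x (S.word v)))"
        by (intro linear_map_minus P \<rho>_left linear_map_comp[OF bilinear_map_left[OF bilinear_der] lin]) simp_all
      with Nil True show ?thesis by (simp add: f_Cons)
    qed (use Nil linear_map_const_zero[OF P] in \<open>simp add: f_Cons\<close>)
  next
    case (Cons z u')
    with that have z: "z \<in> carrier L" and u': "u' \<in> words" by simp_all
    have "linear_map R L P (\<lambda>x. \<rho> z (H (S.word (u' @ x # v))) \<ominus>\<^bsub>P\<^esub> H (der z (S.word (u' @ x # v))))"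
      by (rule linear_map_comp[OF S.linear_word_slot[OF u' v] linG[OF z]])
    with Cons linear_map_const_zero[OF P, of L] show ?thesis
      by (cases "length u' + length v < n") (simp_all add: f_Cons Suc_le_eq)
  qed
  have swap: "f (u @ x # y # v) = f (u @ y # x # v)"
    if u: "u \<in> words" and v [simp]: "v \<in> words" and x [simp]: "x \<in> carrier L" and y [simp]: "y \<in> carrier L" for u v x y
  proof (cases u)
    case (Cons z u')
    \<comment> \<open>An exchange away from the head does not change the class of the tail in
      \<open>S(L)\<close>.\<close>
    with u v x y S_word_swap[of u' v x y] show ?thesis by (simp add: f_Cons)
  next
    case Nil
    show ?thesis
    proof (cases "length v < n")
      case True
      \<comment> \<open>The terms are grouped by symmetry in \<open>a\<close> and \<open>b\<close>.
        The subtracted group is symmetric as it stands; the first group is symmetric because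
        \<open>\<rho>\<close> is an action (fact \<open>2\<close> below), the second because
        \<open>der\<close> is one (fact \<open>1\<close>).\<close>
      have expand: "f (a # b # v) =
        ((\<rho> a (\<rho> b (H (S.word v))) \<ominus>\<^bsub>P\<^esub> \<rho> (b \<star> a) (H (S.word v))) \<oplus>\<^bsub>P\<^esub>
          (H (der b (der a (S.word v))) \<oplus>\<^bsub>P\<^esub> H (der (b \<star> a) (S.word v)))) \<ominus>\<^bsub>P\<^esub>
        (\<rho> a (H (der b (S.word v))) \<oplus>\<^bsub>P\<^esub> \<rho> b (H (der a (S.word v))))"
        if [simp]: "a \<in> carrier L" "b \<in> carrier L" for a b
      proof -
        \<comment> \<open>\<open>H\<close> satisfies the recursion for \<open>b\<close> on words as
          long as \<open>v\<close>, and \<open>der a\<close> of \<open>v\<close> is a combination of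
          such words.\<close>
        have "H (\<sigma> b \<cdot> der a (S.word v)) =
          \<rho> b (H (der a (S.word v))) \<ominus>\<^bsub>P\<^esub> H (der b (der a (S.word v)))"
        proof (rule der_word_ext[OF P linear_map_comp[OF S.U.linear_mult_right lin] linG])
          fix w assume "w \<in> words" "length w = length v"
          then show "H (\<sigma> b \<cdot> S.word w) = \<rho> b (H (S.word w)) \<ominus>\<^bsub>P\<^esub> H (der b (S.word w))"
            using H_Cons[of b w] True by (simp add: S.word_Cons)
        qed simp_all
        then have "f (a # b # v) = \<rho> a (\<rho> b (H (S.word v)) \<ominus>\<^bsub>P\<^esub> H (der b (S.word v))) \<ominus>\<^bsub>P\<^esub>
          ((\<rho> (b \<star> a) (H (S.word v)) \<ominus>\<^bsub>P\<^esub> H (der (b \<star> a) (S.word v))) \<oplus>\<^bsub>P\<^esub>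
            (\<rho> b (H (der a (S.word v))) \<ominus>\<^bsub>P\<^esub> H (der b (der a (S.word v)))))"
          using True by (simp add: f_Cons H_Cons der_word_Cons linear_map_add[OF lin] Suc_le_eq)
        also have "\<rho> a (\<rho> b (H (S.word v)) \<ominus>\<^bsub>P\<^esub> H (der b (S.word v))) =
          \<rho> a (\<rho> b (H (S.word v))) \<ominus>\<^bsub>P\<^esub> \<rho> a (H (der b (S.word v)))"
          by (rule linear_map_diff[OF P P \<rho>_right]) simp_all
        finally show ?thesis
          by (simp add: P.M.minus_eq P.M.minus_add P.M.a_ac)
      qed
      let ?v = "S.word v"
      have br: "\<rho> (lie_bracket L pl x y) (H ?v) = \<rho> (x \<star> y) (H ?v) \<ominus>\<^bsub>P\<^esub> \<rho> (y \<star> x) (H ?v)"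
        unfolding lie_bracket_def by (rule linear_map_diff[OF module_axioms P \<rho>_left]) simp_all
      have "der (lie_bracket L pl x y) ?v = der (x \<star> y) ?v \<ominus>\<^bsub>SL\<^esub> der (y \<star> x) ?v"
        unfolding lie_bracket_def
        by (rule linear_map_diff[OF module_axioms sm bilinear_map_left[OF bilinear_der]]) simp_all
      then have "H (der y (der x ?v)) \<ominus>\<^bsub>P\<^esub> H (der x (der y ?v)) = H (der (x \<star> y) ?v) \<ominus>\<^bsub>P\<^esub> H (der (y \<star> x) ?v)"
        using arg_cong[OF der_action[of x y ?v], of H] by (simp add: linear_map_diff[OF sm P lin])
      from P.M.minus_eq_minusD[OF this]
      have 1: "H (der y (der x ?v)) \<oplus>\<^bsub>P\<^esub> H (der (y \<star> x) ?v) = H (der x (der y ?v)) \<oplus>\<^bsub>P\<^esub> H (der (x \<star> y) ?v)"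
        by simp
      have "\<rho> y (\<rho> x (H ?v)) \<ominus>\<^bsub>P\<^esub> \<rho> x (\<rho> y (H ?v)) = \<rho> (x \<star> y) (H ?v) \<ominus>\<^bsub>P\<^esub> \<rho> (y \<star> x) (H ?v)"
        using comm[of x y "H ?v"] br by simp
      from P.M.minus_eq_minus_swap[OF this]
      have 2: "\<rho> x (\<rho> y (H ?v)) \<ominus>\<^bsub>P\<^esub> \<rho> (y \<star> x) (H ?v) = \<rho> y (\<rho> x (H ?v)) \<ominus>\<^bsub>P\<^esub> \<rho> (x \<star> y) (H ?v)"
        by simp
      show ?thesis
        unfolding Nil append_Nil expand[OF x y] expand[OF y x] 1 2
        by (simp add: P.M.a_comm)
    qed (simp add: Nil f_Cons)
  qed
  obtain H' where H': "linear_map R SL P H'" and H'_word: "\<And>w. w \<in> words \<Longrightarrow> H' (S.word w) = f w"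
  proof (rule S.U_lift_words[OF P, of f])
    fix u v x y assume [simp]: "u \<in> words" "v \<in> words" "x \<in> carrier L" "y \<in> carrier L"
    show "f (u @ x # y # v) \<ominus>\<^bsub>P\<^esub> f (u @ y # x # v) = f (u @ \<zero>\<^bsub>L\<^esub> # v)"
      using linear_map_zero[OF module_axioms P slot[of u v]] f_closed[of "u @ y # x # v"]
      by (simp add: swap P.M.minus_eq_zero_iff)
  qed (use f_closed linear_map_add[OF slot] linear_map_smult[OF slot] in simp_all)
  have H'_one: "H' \<one>\<^bsub>SL\<^esub> = m" using H'_word[of "[]"] by (simp add: S.word_Nil f_Nil)
  \<comment> \<open>The recursion for \<open>H\<close> makes the new values coincide with the old
    ones on words up to length \<open>n\<close>. Thus \<open>H\<close> may be replaced by
    \<open>H'\<close> in the formula that defines \<open>f\<close>.\<close>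
  have agree: "H' (S.word w) = H (S.word w)" if "w \<in> words" "length w \<le> n" for w
  proof (cases w)
    case Nil
    then show ?thesis by (simp add: S.word_Nil H'_one H_one)
  qed (use that H_Cons in \<open>simp add: H'_word f_Cons\<close>)
  have "rec_upto P \<rho> m (Suc n) H'"
    unfolding rec_upto_def
  proof (intro conjI ballI impI H' H'_one)
    fix y v assume y [simp]: "y \<in> carrier L" and v [simp]: "v \<in> words" and n: "length v < Suc n"
    have "H' (der y (S.word v)) = H (der y (S.word v))"
      by (rule der_word_ext[OF P H' lin y v]) (use n in \<open>simp add: agree\<close>)
    then show "H' (S.word (y # v)) = \<rho> y (H' (S.word v)) \<ominus>\<^bsub>P\<^esub> H' (der y (S.word v))"
      using n agree[of v] by (simp add: H'_word[of "y # v"] f_Cons)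
  qed
  then show ?thesis by blast
qed

lemma der_rec:
  assumes P: "module R P" and m: "m \<in> carrier P" and \<rho>: "bilinear_map R L P P \<rho>"
    and comm: "\<And>x y p. \<lbrakk>x \<in> carrier L; y \<in> carrier L; p \<in> carrier P\<rbrakk>
      \<Longrightarrow> \<rho> y (\<rho> x p) \<ominus>\<^bsub>P\<^esub> \<rho> x (\<rho> y p) = \<rho> (lie_bracket L pl x y) p"
  shows "\<exists>F. linear_map R SL P F \<and> F \<one>\<^bsub>SL\<^esub> = m \<and>
    (\<forall>u\<in>carrier SL. \<forall>x\<in>carrier L. F (u \<cdot> \<sigma> x) = \<rho> x (F u) \<ominus>\<^bsub>P\<^esub> F (der x u))"
proof -
  interpret P: module R P by fact
  have "\<exists>H. rec_upto P \<rho> m n H" for n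
  proof (induction n)
    case 0
    \<comment> \<open>No word has length less than \<open>0\<close>, so the first stage only needs
      the value \<open>m\<close> at the unit; the counit provides such a linear map.\<close>
    have "linear_map R SL P (\<lambda>u. S.Eps u \<odot>\<^bsub>P\<^esub> m)"
      by (rule bilinear_map_left[OF S.bilinear_Eps[OF P linear_map_ident] m])
    then have "rec_upto P \<rho> m 0 (\<lambda>u. S.Eps u \<odot>\<^bsub>P\<^esub> m)"
      using m by (simp add: rec_upto_def S.Eps_one)
    then show ?case by blast
  next
    case (Suc n)
    then show ?case using rec_upto_Suc[OF P m \<rho> comm] by blast
  qed
  then obtain H where H: "\<And>n. rec_upto P \<rho> m n (H n)" by metis
  have lin: "linear_map R SL P (H n)" for n using H[of n] by (simp add: rec_upto_def)
  have mono: "rec_upto P \<rho> m n (H k)" if "n \<le> k" for n k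
    using H[of k] that by (simp add: rec_upto_def)
  \<comment> \<open>Each word is evaluated by the stage of its own length. A relation does not
    change the length except for a word with a letter zero, and that one is sent to zero by every
    stage; so each check takes place within one stage.\<close>
  obtain F where F: "linear_map R SL P F" and F_word: "\<And>w. w \<in> words \<Longrightarrow> F (S.word w) = H (length w) (S.word w)"
  proof (rule S.U_lift_words[OF P, of "\<lambda>w. H (length w) (S.word w)"])
    fix u v x y assume [simp]: "u \<in> words" "v \<in> words" "x \<in> carrier L" "y \<in> carrier L"
    have c: "H n (S.word w) \<in> carrier P" if "w \<in> words" for n w
      using that linear_map_closed[OF lin] by simp
    show "H (length (u @ x # y # v)) (S.word (u @ x # y # v)) \<ominus>\<^bsub>P\<^esub>
      H (length (u @ y # x # v)) (S.word (u @ y # x # v)) = H (length (u @ \<zero>\<^bsub>L\<^esub> # v)) (S.word (u @ \<zero>\<^bsub>L\<^esub> # v))"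
      using c[of "u @ y # x # v"]
      by (simp add: S_word_swap[of u v x y] S_word_zero linear_map_zero[OF S.U.module_axioms P lin] P.M.minus_eq_zero_iff)
    show "H (length (u @ (x \<oplus>\<^bsub>L\<^esub> y) # v)) (S.word (u @ (x \<oplus>\<^bsub>L\<^esub> y) # v)) =
      H (length (u @ x # v)) (S.word (u @ x # v)) \<oplus>\<^bsub>P\<^esub> H (length (u @ y # v)) (S.word (u @ y # v))"
      by (simp add: linear_map_add[OF S.linear_word_slot] linear_map_add[OF lin])
    show "H (length (u @ (r \<odot>\<^bsub>L\<^esub> x) # v)) (S.word (u @ (r \<odot>\<^bsub>L\<^esub> x) # v)) =
      r \<odot>\<^bsub>P\<^esub> H (length (u @ x # v)) (S.word (u @ x # v))" if "r \<in> carrier R" for r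
      using that by (simp add: linear_map_smult[OF S.linear_word_slot] linear_map_smult[OF lin])
  qed (use linear_map_closed[OF lin] in auto)
  have F_one: "F \<one>\<^bsub>SL\<^esub> = m"
    using F_word[of "[]"] H[of 0] by (simp add: S.word_Nil rec_upto_def)
  have F_Cons: "F (S.word (y # v)) = \<rho> y (F (S.word v)) \<ominus>\<^bsub>P\<^esub> F (der y (S.word v))"
    if y [simp]: "y \<in> carrier L" and v [simp]: "v \<in> words" for y v
  proof -
    let ?n = "length v"
    \<comment> \<open>Uniqueness identifies the stage of length \<open>?n\<close> with the next one
      on these words, and the next stage is the one that knows the recursion at
      \<open>v\<close>.\<close>
    have agree: "F (S.word w) = H (Suc ?n) (S.word w)" if "w \<in> words" "length w = ?n" for w
      using that rec_upto_unique[OF P H[of ?n] mono[of ?n "Suc ?n"], of w] by (simp add: F_word)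
    have "F (der y (S.word v)) = H (Suc ?n) (der y (S.word v))"
      by (rule der_word_ext[OF P F lin y v agree])
    then show ?thesis
      using H[of "Suc ?n"] agree[of v] by (simp add: F_word[of "y # v"] rec_upto_def)
  qed
  have "F (u \<cdot> \<sigma> x) = \<rho> x (F u) \<ominus>\<^bsub>P\<^esub> F (der x u)" if u: "u \<in> carrier SL" and x [simp]: "x \<in> carrier L" for u x
  proof (rule S.U_ext_words[OF P _ _ _ u])
    show "linear_map R SL P (\<lambda>u. F (u \<cdot> \<sigma> x))"
      by (rule linear_map_comp[OF S.U.linear_mult_left F]) simp
    show "linear_map R SL P (\<lambda>u. \<rho> x (F u) \<ominus>\<^bsub>P\<^esub> F (der x u))"
      by (intro linear_map_minus P linear_map_comp[OF F bilinear_map_right[OF \<rho>]] linear_map_comp[OF linear_der F] x)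
  qed (simp add: S_word_gen F_Cons)
  with F F_one show ?thesis by blast
qed

lemma der_rec_unique:
  assumes P: "module R P" and F: "linear_map R SL P F" and F': "linear_map R SL P F'"
    and one: "F \<one>\<^bsub>SL\<^esub> = F' \<one>\<^bsub>SL\<^esub>"
    and F_step: "\<And>u x. \<lbrakk>u \<in> carrier SL; x \<in> carrier L\<rbrakk> \<Longrightarrow> F (u \<cdot> \<sigma> x) = \<rho> x (F u) \<ominus>\<^bsub>P\<^esub> F (der x u)"
    and F'_step: "\<And>u x. \<lbrakk>u \<in> carrier SL; x \<in> carrier L\<rbrakk> \<Longrightarrow> F' (u \<cdot> \<sigma> x) = \<rho> x (F' u) \<ominus>\<^bsub>P\<^esub> F' (der x u)"
    and u: "u \<in> carrier SL"
  shows "F u = F' u"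
proof (rule S.U_ext_words[OF P F F' _ u])
  fix w assume w: "w \<in> words"
  have "rec_upto P \<rho> (F' \<one>\<^bsub>SL\<^esub>) (length w) F" "rec_upto P \<rho> (F' \<one>\<^bsub>SL\<^esub>) (length w) F'"
    unfolding rec_upto_def by (simp_all add: F F' one F_step F'_step flip: S_word_gen)
  from rec_upto_unique[OF P this w] show "F (S.word w) = F' (S.word w)" by simp
qed

end

section \<open>The extension of the pre-Lie product\<close>

context pre_lie_algebra
begin

abbreviation stens (infixl \<open>\<boxtimes>\<close> 75) where "a \<boxtimes> b \<equiv> tensor R SL SL a b"
abbreviation SD where "SD \<equiv> S.Delta"
abbreviation ST where "ST \<equiv> tensor_module R SL SL"

lemmas S_module = S.U.module_axioms

lemma Eps_der:
  assumes x [simp]: "x \<in> carrier L" and u: "u \<in> carrier SL"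
  shows "S.Eps (der x u) = \<zero>"
proof -
  interpret B: assoc_algebra R "base_algebra R" by (rule R.assoc_algebra_base)
  have z: "\<zero>\<^bsub>base_algebra R\<^esub> = \<zero>" and a: "add (base_algebra R) = add R" by (simp_all add: base_algebra_def)
  have "S.Eps (der x u) = \<zero>\<^bsub>base_algebra R\<^esub>"
  proof (rule S.U_ext[OF B.module_axioms linear_map_comp[OF linear_der S.linear_Eps] linear_map_const_zero[OF B.module_axioms] _ _ u])
    show "S.Eps (der x \<one>\<^bsub>SL\<^esub>) = \<zero>\<^bsub>base_algebra R\<^esub>"
      by (simp add: der_one linear_map_zero[OF S_module B.module_axioms S.linear_Eps])
    show "S.Eps (der x (u \<cdot> \<sigma> y)) = \<zero>\<^bsub>base_algebra R\<^esub>" if "u \<in> carrier SL" "y \<in> carrier L" for u y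
      using that by (simp add: der_step linear_map_add[OF S.linear_Eps] S.Eps_step z a)
  qed simp
  then show ?thesis by (simp add: z)
qed

lemma bilinear_der_tens:
  assumes "module R P" "bilinear_map R SL SL P \<beta>" "x \<in> carrier L"
  shows "bilinear_map R SL SL P (\<lambda>a b. \<beta> (der x a) b \<oplus>\<^bsub>P\<^esub> \<beta> a (der x b))"
  by (intro bilinear_map_plus assms(1) bilinear_map_comp2[OF assms(2)] linear_der linear_map_ident assms(3))

text \<open>In Sweedler notation: \<open>\<Delta>(u \<circ> x) = (u\<^sub>1 \<circ> x) \<otimes> u\<^sub>2 + u\<^sub>1 \<otimes> (u\<^sub>2 \<circ> x)\<close>.\<close>

lemma Delta_der_lift:
  assumes P: "module R P" and \<beta>: "bilinear_map R SL SL P \<beta>" and x [simp]: "x \<in> carrier L" and u: "u \<in> carrier SL"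
  shows "tensor_lift R P \<beta> (SD (der x u)) = tensor_lift R P (\<lambda>a b. \<beta> (der x a) b \<oplus>\<^bsub>P\<^esub> \<beta> a (der x b)) (SD u)"
proof -
  note T = S.UU.T.module_axioms
  \<comment> \<open>\<open>\<delta>\<close> is \<open>der x \<otimes> 1 + 1 \<otimes> der x\<close>.
    By \<open>\<delta>_prim\<close> it obeys the Leibniz rule for right multiplication by primitive
    elements, so the coproduct intertwines \<open>der x\<close> with it by induction along
    generators.\<close>
  define \<delta> where "\<delta> = tensor_lift R ST (\<lambda>a b. der x a \<boxtimes> b \<oplus>\<^bsub>ST\<^esub> a \<boxtimes> der x b)"
  note bil = bilinear_der_tens[OF T S.UU.bilinear_tensor x]
  have \<delta>: "linear_map R ST ST \<delta>"
    unfolding \<delta>_def by (rule S.UU.linear_tensor_lift[OF T bil])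
  have \<delta>_tens: "\<delta> (a \<boxtimes> b) = der x a \<boxtimes> b \<oplus>\<^bsub>ST\<^esub> a \<boxtimes> der x b" if "a \<in> carrier SL" "b \<in> carrier SL" for a b
    unfolding \<delta>_def by (rule S.UU.tensor_lift_tensor[OF T bil that])
  have \<delta>_prim: "\<delta> (t \<otimes>\<^bsub>S.UU.TA\<^esub> S.primitive y) = \<delta> t \<otimes>\<^bsub>S.UU.TA\<^esub> S.primitive y \<oplus>\<^bsub>ST\<^esub> t \<otimes>\<^bsub>S.UU.TA\<^esub> S.primitive (y \<star> x)"
    if t: "t \<in> carrier ST" and y [simp]: "y \<in> carrier L" for t y
  proof (rule S.UU.tensor_ext[OF T linear_map_comp[OF S.UU.linear_TA_left \<delta>]
        linear_map_plus[OF T linear_map_comp[OF \<delta> S.UU.linear_TA_left] S.UU.linear_TA_left] _ t])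
    fix a b assume [simp]: "a \<in> carrier SL" "b \<in> carrier SL"
    note prim = S.tens_mult_primitive
    have 1: "(der x a \<boxtimes> b \<oplus>\<^bsub>ST\<^esub> a \<boxtimes> der x b) \<otimes>\<^bsub>S.UU.TA\<^esub> S.primitive y =
      (der x a \<boxtimes> b) \<otimes>\<^bsub>S.UU.TA\<^esub> S.primitive y \<oplus>\<^bsub>ST\<^esub> (a \<boxtimes> der x b) \<otimes>\<^bsub>S.UU.TA\<^esub> S.primitive y"
      by (rule linear_map_add[OF S.UU.linear_TA_left[OF S.primitive_closed]]) simp_all
    show "\<delta> ((a \<boxtimes> b) \<otimes>\<^bsub>S.UU.TA\<^esub> S.primitive y) =
      \<delta> (a \<boxtimes> b) \<otimes>\<^bsub>S.UU.TA\<^esub> S.primitive y \<oplus>\<^bsub>ST\<^esub> (a \<boxtimes> b) \<otimes>\<^bsub>S.UU.TA\<^esub> S.primitive (y \<star> x)"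
      unfolding \<delta>_tens[OF \<open>a \<in> carrier SL\<close> \<open>b \<in> carrier SL\<close>] 1
      by (simp add: prim linear_map_add[OF \<delta>] \<delta>_tens der_step linear_map_add[OF S.UU.linear_tensor_left]
          linear_map_add[OF S.UU.linear_tensor_right] S.UU.T.M.a_ac del: S.UU.TA_simps)
  qed (simp_all add: S.primitive_closed del: S.UU.TA_simps)
  have eq: "SD (der x u) = \<delta> (SD u)"
  proof (rule S.U_ext[OF T linear_map_comp[OF linear_der S.linear_Delta] linear_map_comp[OF S.linear_Delta \<delta>] _ _ u])
    show "SD (der x \<one>\<^bsub>SL\<^esub>) = \<delta> (SD \<one>\<^bsub>SL\<^esub>)"
      by (simp add: der_one S.Delta_one \<delta>_tens linear_map_zero[OF S_module T S.linear_Delta]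
          linear_map_zero[OF S_module T S.UU.linear_tensor_left] linear_map_zero[OF S_module T S.UU.linear_tensor_right])
    fix u y assume [simp]: "u \<in> carrier SL" "y \<in> carrier L" and IH: "SD (der x u) = \<delta> (SD u)"
    have "SD (der x (u \<cdot> \<sigma> y)) = SD (der x u) \<otimes>\<^bsub>S.UU.TA\<^esub> S.primitive y \<oplus>\<^bsub>ST\<^esub> SD u \<otimes>\<^bsub>S.UU.TA\<^esub> S.primitive (y \<star> x)"
      by (simp add: der_step linear_map_add[OF S.linear_Delta] S.Delta_mult S.Delta_gen)
    also have "\<dots> = \<delta> (SD (u \<cdot> \<sigma> y))"
      unfolding IH by (simp add: \<delta>_prim[symmetric] S.Delta_mult S.Delta_gen del: S.UU.TA_simps)
    finally show "SD (der x (u \<cdot> \<sigma> y)) = \<delta> (SD (u \<cdot> \<sigma> y))" .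
  qed simp
  have "tensor_lift R P \<beta> (\<delta> t) = tensor_lift R P (\<lambda>a b. \<beta> (der x a) b \<oplus>\<^bsub>P\<^esub> \<beta> a (der x b)) t"
    if t: "t \<in> carrier ST" for t
    by (rule S.UU.tensor_ext[OF P linear_map_comp[OF \<delta> S.UU.linear_tensor_lift[OF P \<beta>]]
          S.UU.linear_tensor_lift[OF P bilinear_der_tens[OF P \<beta> x]] _ t])
      (simp add: \<delta>_tens linear_map_add[OF S.UU.linear_tensor_lift[OF P \<beta>]] S.UU.tensor_lift_tensor[OF P \<beta>]
        S.UU.tensor_lift_tensor[OF P bilinear_der_tens[OF P \<beta> x]])
  then show ?thesis using u by (simp add: eq)
qed

text \<open>Condition (ii) of the extension is imposed here for all \<open>A\<close>, not only for generators.\<close>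

definition circ where
  "circ A = (SOME F. linear_map R SL SL F \<and> F \<one>\<^bsub>SL\<^esub> = A \<and>
    (\<forall>u\<in>carrier SL. \<forall>x\<in>carrier L. F (u \<cdot> \<sigma> x) = der x (F u) \<ominus>\<^bsub>SL\<^esub> F (der x u)))"

lemma
  assumes "A \<in> carrier SL"
  shows linear_circ: "linear_map R SL SL (circ A)"
    and circ_one: "circ A \<one>\<^bsub>SL\<^esub> = A"
    and circ_step: "\<And>u x. \<lbrakk>u \<in> carrier SL; x \<in> carrier L\<rbrakk>
      \<Longrightarrow> circ A (u \<cdot> \<sigma> x) = der x (circ A u) \<ominus>\<^bsub>SL\<^esub> circ A (der x u)"
  using someI_ex[OF der_rec[OF S_module assms bilinear_der der_action]] unfolding circ_def by blast+

lemma circ_closed [simp]: "\<lbrakk>A \<in> carrier SL; B \<in> carrier SL\<rbrakk> \<Longrightarrow> circ A B \<in> carrier SL"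
  by (rule linear_map_closed[OF linear_circ])

text \<open>The tool for linearity of \<open>circ\<close> in its first argument, for the value of
  \<open>1 \<circ> C\<close> and for rule (iii): the other side of the identity, as a function of
  the second argument, is shown to solve the same recursion.\<close>

lemma circ_unique:
  assumes "A \<in> carrier SL" "linear_map R SL SL F" "F \<one>\<^bsub>SL\<^esub> = A"
    and "\<And>u x. \<lbrakk>u \<in> carrier SL; x \<in> carrier L\<rbrakk> \<Longrightarrow> F (u \<cdot> \<sigma> x) = der x (F u) \<ominus>\<^bsub>SL\<^esub> F (der x u)"
    and "u \<in> carrier SL"
  shows "circ A u = F u"
  by (rule der_rec_unique[where \<rho> = der, OF S_module linear_circ[OF assms(1)] assms(2) _ circ_step[OF assms(1)] assms(4,5)])
    (simp_all add: circ_one assms)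

lemma circ_gen: "\<lbrakk>A \<in> carrier SL; x \<in> carrier L\<rbrakk> \<Longrightarrow> circ A (\<sigma> x) = der x A"
  using circ_step[of A "\<one>\<^bsub>SL\<^esub>" x]
  by (simp add: circ_one der_one linear_map_zero[OF S_module S_module linear_circ] S.U.minus_eq)

lemma bilinear_circ: "bilinear_map R SL SL SL circ"
proof (rule bilinear_mapI[OF linear_circ])
  fix u assume u: "u \<in> carrier SL"
  show "linear_map R SL SL (\<lambda>A. circ A u)"
  proof (rule linear_mapI)
    fix A assume A [simp]: "A \<in> carrier SL"
    show "circ A u \<in> carrier SL" using u by simp
    show "circ (A \<oplus>\<^bsub>SL\<^esub> B) u = circ A u \<oplus>\<^bsub>SL\<^esub> circ B u" if B [simp]: "B \<in> carrier SL" for B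
      by (rule circ_unique[OF _ linear_map_plus[OF S_module linear_circ linear_circ] _ _ u])
        (simp_all add: circ_one circ_step linear_map_add[OF linear_der] S.U.minus_eq S.U.minus_add S.U.a_ac)
    show "circ (r \<odot>\<^bsub>SL\<^esub> A) u = r \<odot>\<^bsub>SL\<^esub> circ A u" if r [simp]: "r \<in> carrier R" for r
      by (rule circ_unique[OF _ linear_map_scale[OF S_module linear_circ] _ _ u])
        (simp_all add: circ_one circ_step linear_map_smult[OF linear_der] S.U.minus_eq S.U.smult_r_distr S.U.smult_r_minus)
  qed
qed

text \<open>The counit solves the recursion for \<open>A = 1\<close>: it kills products with a
  generator and the image of \<open>der x\<close>, and \<open>der x\<close> kills the unit.\<close>

lemma circ_one_left:
  assumes u: "u \<in> carrier SL"
  shows "circ \<one>\<^bsub>SL\<^esub> u = S.Eps u \<odot>\<^bsub>SL\<^esub> \<one>\<^bsub>SL\<^esub>"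
  by (rule circ_unique[OF _ bilinear_map_left[OF S.bilinear_Eps[OF S_module linear_map_ident]] _ _ u])
    (simp_all add: S.Eps_one S.Eps_step Eps_der linear_map_smult[OF linear_der] der_one S.U.minus_eq)

lemma bilinear_circ_mult:
  assumes "A \<in> carrier SL" "B \<in> carrier SL"
  shows "bilinear_map R SL SL SL (\<lambda>a b. circ A a \<cdot> circ B b)"
  by (rule bilinear_map_comp2[OF S.U.bilinear_mult linear_circ[OF assms(1)] linear_circ[OF assms(2)]])

text \<open>As a function of \<open>C\<close> the right-hand side solves the recursion for
  \<open>A \<cdot> B\<close>, because \<open>der x\<close> is a derivation for the product and a
  coderivation for the coproduct.\<close>

lemma circ_mult:
  assumes A [simp]: "A \<in> carrier SL" and B [simp]: "B \<in> carrier SL" and C: "C \<in> carrier SL"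
  shows "circ (A \<cdot> B) C = tensor_lift R SL (\<lambda>a b. circ A a \<cdot> circ B b) (SD C)"
proof (rule circ_unique[OF _ _ _ _ C])
  let ?\<beta> = "\<lambda>a b. circ A a \<cdot> circ B b"
  note \<beta> = bilinear_circ_mult[OF A B]
  let ?F = "\<lambda>C. tensor_lift R SL ?\<beta> (SD C)"
  show "linear_map R SL SL ?F"
    by (rule linear_map_comp[OF S.linear_Delta S.UU.linear_tensor_lift[OF S_module \<beta>]])
  show "?F \<one>\<^bsub>SL\<^esub> = A \<cdot> B" by (simp add: S.Delta_lift_one[OF S_module \<beta>] circ_one)
  fix C x assume C: "C \<in> carrier SL" and x [simp]: "x \<in> carrier L"
  note d = bilinear_map_comp[OF \<beta> linear_der[OF x]] and e = bilinear_der_tens[OF S_module \<beta> x]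
  have "?F (C \<cdot> \<sigma> x) = tensor_lift R SL (\<lambda>a b. ?\<beta> (a \<cdot> \<sigma> x) b \<oplus>\<^bsub>SL\<^esub> ?\<beta> a (b \<cdot> \<sigma> x)) (SD C)"
    by (rule S.Delta_lift_step[OF S_module \<beta> C x])
  also have "\<dots> = tensor_lift R SL (\<lambda>a b. der x (?\<beta> a b) \<ominus>\<^bsub>SL\<^esub> (?\<beta> (der x a) b \<oplus>\<^bsub>SL\<^esub> ?\<beta> a (der x b))) (SD C)"
    by (rule S.UU.tensor_lift_cong[OF S_module bilinear_map_minus[OF S_module d e] _ S.Delta_closed[OF C], symmetric])
      (simp add: circ_step der_mult S.U.minus_eq S.U.l_distr S.U.r_distr S.U.l_minus S.U.r_minus S.U.minus_add S.U.a_ac)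
  also have "\<dots> = tensor_lift R SL (\<lambda>a b. der x (?\<beta> a b)) (SD C) \<ominus>\<^bsub>SL\<^esub>
      tensor_lift R SL (\<lambda>a b. ?\<beta> (der x a) b \<oplus>\<^bsub>SL\<^esub> ?\<beta> a (der x b)) (SD C)"
    by (rule S.UU.tensor_lift_minus[OF S_module d e S.Delta_closed[OF C]])
  also have "tensor_lift R SL (\<lambda>a b. der x (?\<beta> a b)) (SD C) = der x (?F C)"
    by (rule S.UU.linear_map_tensor_lift[OF S_module S_module \<beta> linear_der[OF x] S.Delta_closed[OF C], symmetric])
  also have "tensor_lift R SL (\<lambda>a b. ?\<beta> (der x a) b \<oplus>\<^bsub>SL\<^esub> ?\<beta> a (der x b)) (SD C) = ?F (der x C)"
    by (rule Delta_der_lift[OF S_module \<beta> x C, symmetric])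
  finally show "?F (C \<cdot> \<sigma> x) = der x (?F C) \<ominus>\<^bsub>SL\<^esub> ?F (der x C)" .
qed simp

lemma symmetric_hopf_eq: "symmetric_hopf R L = primitive_hopf R L SL \<sigma>"
  by (simp add: symmetric_hopf_def symmetric_algebra_eq symmetric_gen_eq)

text \<open>The definition speaks about the Hopf record of \<open>S(L)\<close>; here all operations
  are those of the algebra \<open>SL\<close>, for which the calculus is available.\<close>

lemma is_pl_extension_iff:
  "is_pl_extension R L pl c \<longleftrightarrow>
    bilinear_map R SL SL SL c \<and>
    (\<forall>x\<in>carrier L. \<forall>y\<in>carrier L. c (\<sigma> x) (\<sigma> y) = \<sigma> (x \<star> y)) \<and>
    (\<forall>A\<in>carrier SL. c A \<one>\<^bsub>SL\<^esub> = A) \<and>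
    (\<forall>t\<in>carrier L. \<forall>x\<in>carrier L. \<forall>B\<in>carrier SL.
      c (\<sigma> t) (B \<cdot> \<sigma> x) = c (c (\<sigma> t) B) (\<sigma> x) \<ominus>\<^bsub>SL\<^esub> c (\<sigma> t) (c B (\<sigma> x))) \<and>
    (\<forall>A\<in>carrier SL. \<forall>B\<in>carrier SL. \<forall>C\<in>carrier SL.
      c (A \<cdot> B) C = tensor_lift R SL (\<lambda>C1 C2. c A C1 \<cdot> c B C2) (SD C))"
proof -
  note s = S.primitive_hopf_simps
  have lift: "tensor_lift R (primitive_hopf R L SL \<sigma>) = tensor_lift R SL"
    by (rule ext, rule tensor_lift_struct_cong; simp add: s)
  have minus: "a_minus (primitive_hopf R L SL \<sigma>) = a_minus SL"
    by (simp add: fun_eq_iff a_minus_def a_inv_def m_inv_def s)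
  have bil: "bilinear_map R (primitive_hopf R L SL \<sigma>) (primitive_hopf R L SL \<sigma>) (primitive_hopf R L SL \<sigma>) c
    \<longleftrightarrow> bilinear_map R SL SL SL c"
    by (simp add: bilinear_map_def linear_map_def s)
  show ?thesis
    unfolding is_pl_extension_def Let_def symmetric_hopf_eq symmetric_gen_eq lift minus bil s ..
qed

lemma circ_is_pl_extension: "is_pl_extension R L pl circ"
  unfolding is_pl_extension_iff
  by (simp add: bilinear_circ circ_gen der_gen circ_one circ_step circ_mult)

section \<open>Uniqueness of the extension\<close>

context
  fixes c
  assumes c: "is_pl_extension R L pl c"
begin

lemma bilinear_c: "bilinear_map R SL SL SL c"
  and c_one: "A \<in> carrier SL \<Longrightarrow> c A \<one>\<^bsub>SL\<^esub> = A"
  and c_gen_gen: "\<lbrakk>x \<in> carrier L; y \<in> carrier L\<rbrakk> \<Longrightarrow> c (\<sigma> x) (\<sigma> y) = \<sigma> (x \<star> y)"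
  and c_gen_step: "\<lbrakk>t \<in> carrier L; x \<in> carrier L; B \<in> carrier SL\<rbrakk>
    \<Longrightarrow> c (\<sigma> t) (B \<cdot> \<sigma> x) = c (c (\<sigma> t) B) (\<sigma> x) \<ominus>\<^bsub>SL\<^esub> c (\<sigma> t) (c B (\<sigma> x))"
  and c_mult: "\<lbrakk>A \<in> carrier SL; B \<in> carrier SL; C \<in> carrier SL\<rbrakk>
    \<Longrightarrow> c (A \<cdot> B) C = tensor_lift R SL (\<lambda>C1 C2. c A C1 \<cdot> c B C2) (SD C)"
  using c unfolding is_pl_extension_iff by blast+

lemma c_closed: "\<lbrakk>A \<in> carrier SL; B \<in> carrier SL\<rbrakk> \<Longrightarrow> c A B \<in> carrier SL"
  by (rule bilinear_map_closed[OF bilinear_c])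

lemma bilinear_c_mult:
  assumes "A \<in> carrier SL" "B \<in> carrier SL"
  shows "bilinear_map R SL SL SL (\<lambda>a b. c A a \<cdot> c B b)"
  by (rule bilinear_map_comp2[OF S.U.bilinear_mult bilinear_map_right[OF bilinear_c assms(1)]
        bilinear_map_right[OF bilinear_c assms(2)]])

text \<open>A generator is primitive, so rule (iii) makes \<open>c A (\<sigma> x)\<close> a
  derivation in \<open>A\<close>, and it agrees with \<open>der x\<close> on generators.\<close>

lemma c_gen:
  assumes A: "A \<in> carrier SL" and x [simp]: "x \<in> carrier L"
  shows "c A (\<sigma> x) = der x A"
proof (rule S.U_ext[OF S_module bilinear_map_left[OF bilinear_c] linear_der _ _ A])
  note [simp] = c_closed c_one
  \<comment> \<open>Rule (iii) for \<open>1 = 1 \<cdot> 1\<close> equates the term with twice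
    itself, so it is zero, as for any derivation at the unit.\<close>
  have "c \<one>\<^bsub>SL\<^esub> (\<sigma> x) = c \<one>\<^bsub>SL\<^esub> (\<sigma> x) \<oplus>\<^bsub>SL\<^esub> c \<one>\<^bsub>SL\<^esub> (\<sigma> x)"
    using c_mult[of "\<one>\<^bsub>SL\<^esub>" "\<one>\<^bsub>SL\<^esub>" "\<sigma> x"]
    by (simp add: S.Delta_lift_gen[OF S_module bilinear_c_mult])
  then show "c \<one>\<^bsub>SL\<^esub> (\<sigma> x) = der x \<one>\<^bsub>SL\<^esub>"
    by (simp add: der_one S.U.add.l_cancel_one')
  fix u y assume [simp]: "u \<in> carrier SL" "y \<in> carrier L" and IH: "c u (\<sigma> x) = der x u"
  show "c (u \<cdot> \<sigma> y) (\<sigma> x) = der x (u \<cdot> \<sigma> y)"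
    by (simp add: c_mult S.Delta_lift_gen[OF S_module bilinear_c_mult] IH c_gen_gen der_step)
qed simp_all

lemma c_gen_left:
  assumes t [simp]: "t \<in> carrier L" and u: "u \<in> carrier SL"
  shows "c (\<sigma> t) u = circ (\<sigma> t) u"
  by (rule circ_unique[OF _ bilinear_map_right[OF bilinear_c] _ _ u, symmetric])
    (simp_all add: c_one c_gen_step c_gen c_closed)

text \<open>\<open>e = c 1\<close> is idempotent for convolution and \<open>e 1 = 1\<close>. Hence, if \<open>e\<close> agrees with the counit on words
  shorter than \<open>wx\<close>, then \<open>e (wx) = 2 e (wx)\<close>.\<close>

lemma c_one_left:
  assumes u: "u \<in> carrier SL"
  shows "c \<one>\<^bsub>SL\<^esub> u = S.Eps u \<odot>\<^bsub>SL\<^esub> \<one>\<^bsub>SL\<^esub>"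
proof (rule S.U_ext_words[OF S_module bilinear_map_right[OF bilinear_c]
      bilinear_map_left[OF S.bilinear_Eps[OF S_module linear_map_ident]] _ u])
  note [simp] = c_closed c_one
  let ?e = "c \<one>\<^bsub>SL\<^esub>"
  note lin = bilinear_map_right[OF bilinear_c S.U.one_closed]
  fix w assume "w \<in> words"
  then show "?e (S.word w) = S.Eps (S.word w) \<odot>\<^bsub>SL\<^esub> \<one>\<^bsub>SL\<^esub>"
  proof (induction "length w" arbitrary: w rule: less_induct)
    case less
    show ?case
    proof (cases w rule: rev_cases)
      case Nil
      then show ?thesis by (simp add: S.word_Nil S.Eps_one)
    next
      case (snoc v x)
      with less.prems have v [simp]: "v \<in> words" and x [simp]: "x \<in> carrier L" by simp_all
      have IH: "?e (S.word a) = S.Eps (S.word a) \<odot>\<^bsub>SL\<^esub> \<one>\<^bsub>SL\<^esub>" if "a \<in> words" "length a \<le> length v" for a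
        using that less.hyps[of a] by (simp add: snoc)
      let ?D = "SD (S.word v)"
      have D: "?D \<in> carrier ST" by simp
      have f: "linear_map R SL SL (\<lambda>a. ?e (a \<cdot> \<sigma> x))"
        by (rule linear_map_comp[OF S.U.linear_mult_left lin]) simp
      have l: "bilinear_map R SL SL SL (\<lambda>a b. ?e (a \<cdot> \<sigma> x) \<cdot> ?e b)"
        and r: "bilinear_map R SL SL SL (\<lambda>a b. ?e a \<cdot> ?e (b \<cdot> \<sigma> x))"
        by (rule bilinear_map_comp2[OF S.U.bilinear_mult f lin])
          (rule bilinear_map_comp2[OF S.U.bilinear_mult lin f])
      have l': "bilinear_map R SL SL SL (\<lambda>a b. ?e ((S.Eps b \<odot>\<^bsub>SL\<^esub> a) \<cdot> \<sigma> x))"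
        by (rule bilinear_map_comp[OF S.bilinear_smult_Eps_right f])
      have r': "bilinear_map R SL SL SL (\<lambda>a b. ?e ((S.Eps a \<odot>\<^bsub>SL\<^esub> b) \<cdot> \<sigma> x))"
        by (rule bilinear_map_comp[OF S.bilinear_Eps[OF S_module linear_map_ident] f])
      \<comment> \<open>The factor without \<open>x\<close> runs over words no longer than
        \<open>v\<close>, where \<open>?e\<close> is the counit by induction. Once the scalar is
        pulled into the other factor, the counit law collapses the sum.\<close>
      have "tensor_lift R SL (\<lambda>a b. ?e (a \<cdot> \<sigma> x) \<cdot> ?e b) ?D =
        tensor_lift R SL (\<lambda>a b. ?e ((S.Eps b \<odot>\<^bsub>SL\<^esub> a) \<cdot> \<sigma> x)) ?D"
        by (rule S.Delta_lift_word_cong[OF S_module l l' v])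
          (simp add: IH S.U.smult_mult_left S.U.smult_mult_right linear_map_smult[OF lin])
      also have "\<dots> = ?e (S.word v \<cdot> \<sigma> x)"
        by (subst S.UU.linear_map_tensor_lift[OF S_module S_module S.bilinear_smult_Eps_right f D, symmetric])
          (simp add: S.counit_right_U)
      finally have 1: "tensor_lift R SL (\<lambda>a b. ?e (a \<cdot> \<sigma> x) \<cdot> ?e b) ?D = ?e (S.word v \<cdot> \<sigma> x)" .
      have "tensor_lift R SL (\<lambda>a b. ?e a \<cdot> ?e (b \<cdot> \<sigma> x)) ?D =
        tensor_lift R SL (\<lambda>a b. ?e ((S.Eps a \<odot>\<^bsub>SL\<^esub> b) \<cdot> \<sigma> x)) ?D"
        by (rule S.Delta_lift_word_cong[OF S_module r r' v])
          (simp add: IH S.U.smult_mult_left S.U.smult_mult_right linear_map_smult[OF lin])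
      also have "\<dots> = ?e (S.word v \<cdot> \<sigma> x)"
        by (subst S.UU.linear_map_tensor_lift[OF S_module S_module S.bilinear_Eps[OF S_module linear_map_ident] f D, symmetric])
          (simp add: S.counit_left_U)
      finally have 2: "tensor_lift R SL (\<lambda>a b. ?e a \<cdot> ?e (b \<cdot> \<sigma> x)) ?D = ?e (S.word v \<cdot> \<sigma> x)" .
      have "?e (S.word v \<cdot> \<sigma> x) = tensor_lift R SL (\<lambda>a b. ?e a \<cdot> ?e b) (SD (S.word v \<cdot> \<sigma> x))"
        using c_mult[of "\<one>\<^bsub>SL\<^esub>" "\<one>\<^bsub>SL\<^esub>" "S.word v \<cdot> \<sigma> x"] by simp
      also have "\<dots> = tensor_lift R SL (\<lambda>a b. ?e (a \<cdot> \<sigma> x) \<cdot> ?e b \<oplus>\<^bsub>SL\<^esub> ?e a \<cdot> ?e (b \<cdot> \<sigma> x)) ?D"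
        by (rule S.Delta_lift_step[OF S_module bilinear_c_mult]) simp_all
      also have "\<dots> = ?e (S.word v \<cdot> \<sigma> x) \<oplus>\<^bsub>SL\<^esub> ?e (S.word v \<cdot> \<sigma> x)"
        by (simp only: S.UU.tensor_lift_plus[OF S_module l r D] 1 2)
      finally have "?e (S.word v \<cdot> \<sigma> x) = \<zero>\<^bsub>SL\<^esub>"
        by (simp add: S.U.add.l_cancel_one')
      then show ?thesis by (simp add: snoc S.word_snoc S.Eps_step)
    qed
  qed
qed simp_all

text \<open>Rule (iii) splits off the letters of the first argument for both products. There remain
  the empty word, where both give the counit, and single generators, where rule (ii) determines the
  value.\<close>

lemma pl_extension_unique:
  assumes A: "A \<in> carrier SL" and C: "C \<in> carrier SL"
  shows "c A C = circ A C"
proof (rule S.U_ext_words[OF S_module bilinear_map_left[OF bilinear_c C] bilinear_map_left[OF bilinear_circ C] _ A])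
  fix w assume "w \<in> words"
  then have "\<forall>C\<in>carrier SL. c (S.word w) C = circ (S.word w) C"
  proof (induction w rule: rev_induct)
    case Nil
    then show ?case by (simp add: S.word_Nil c_one_left circ_one_left)
  next
    case (snoc x w)
    then have [simp]: "w \<in> words" "x \<in> carrier L" and IH: "\<And>C. C \<in> carrier SL \<Longrightarrow> c (S.word w) C = circ (S.word w) C"
      by simp_all
    show ?case
    proof
      fix C assume C: "C \<in> carrier SL"
      have "tensor_lift R SL (\<lambda>C1 C2. c (S.word w) C1 \<cdot> c (\<sigma> x) C2) (SD C) =
        tensor_lift R SL (\<lambda>C1 C2. circ (S.word w) C1 \<cdot> circ (\<sigma> x) C2) (SD C)"
        by (rule S.UU.tensor_lift_cong[OF S_module bilinear_c_mult])
          (simp_all add: IH c_gen_left C)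
      then show "c (S.word (w @ [x])) C = circ (S.word (w @ [x])) C"
        by (simp add: S.word_snoc c_mult circ_mult C)
    qed
  qed
  then show "c (S.word w) C = circ (S.word w) C" using C by blast
qed

end

lemma pl_extension_eq:
  "\<lbrakk>A \<in> carrier SL; B \<in> carrier SL\<rbrakk> \<Longrightarrow> pl_extension R L pl A B = circ A B"
  unfolding pl_extension_def by (rule pl_extension_unique[OF someI[of "is_pl_extension R L pl", OF circ_is_pl_extension]])

end

section \<open>The Oudom--Guin product\<close>

context pre_lie_algebra
begin

definition star where
  "star A B = tensor_lift R SL (\<lambda>a b. circ A a \<cdot> b) (SD B)"

lemma bilinear_circ_left:
  "A \<in> carrier SL \<Longrightarrow> bilinear_map R SL SL SL (\<lambda>a b. circ A a \<cdot> b)"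
  by (rule bilinear_map_comp2[OF S.U.bilinear_mult linear_circ linear_map_ident])

lemma bilinear_star: "bilinear_map R SL SL SL star"
proof (rule bilinear_mapI)
  show "linear_map R SL SL (star A)" if "A \<in> carrier SL" for A
    unfolding star_def
    by (rule linear_map_comp[OF S.linear_Delta S.UU.linear_tensor_lift[OF S_module bilinear_circ_left[OF that]]])
  show "linear_map R SL SL (\<lambda>A. star A B)" if "B \<in> carrier SL" for B
    unfolding star_def
    by (rule S.UU.linear_tensor_lift_param[OF S_module S_module bilinear_circ_left _ S.Delta_closed[OF that]])
      (assumption, rule linear_map_comp[OF bilinear_map_left[OF bilinear_circ] S.U.linear_mult_left])
qed

lemma star_closed [simp]: "\<lbrakk>A \<in> carrier SL; B \<in> carrier SL\<rbrakk> \<Longrightarrow> star A B \<in> carrier SL"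
  by (rule bilinear_map_closed[OF bilinear_star])

lemma star_one: "A \<in> carrier SL \<Longrightarrow> star A \<one>\<^bsub>SL\<^esub> = A"
  by (simp add: star_def S.Delta_lift_one[OF S_module bilinear_circ_left] circ_one)

text \<open>\<open>gen_star x A = A * x\<close>, the right action of the Lie algebra on the symmetric algebra.\<close>

definition gen_star where
  "gen_star x A = A \<cdot> \<sigma> x \<oplus>\<^bsub>SL\<^esub> der x A"

lemma bilinear_gen_star: "bilinear_map R L SL SL gen_star"
proof -
  have "bilinear_map R L SL SL (\<lambda>x A. A \<cdot> \<sigma> x)"
    by (rule bilinear_mapI)
      (auto intro: S.U.linear_mult_left linear_map_comp[OF S.linear_gen S.U.linear_mult_right])
  from bilinear_map_plus[OF S_module this bilinear_der] show ?thesis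
    unfolding gen_star_def .
qed

lemma gen_star_closed [simp]: "\<lbrakk>x \<in> carrier L; A \<in> carrier SL\<rbrakk> \<Longrightarrow> gen_star x A \<in> carrier SL"
  by (simp add: gen_star_def)

text \<open>The part \<open>?z\<close> is symmetric in \<open>x\<close> and \<open>y\<close> because
  \<open>S(L)\<close> is commutative, and drops out of the commutator. What is left is a product
  with the generator of the bracket and a commutator of derivations.\<close>

lemma gen_star_action:
  assumes [simp]: "x \<in> carrier L" "y \<in> carrier L" "A \<in> carrier SL"
  shows "gen_star y (gen_star x A) \<ominus>\<^bsub>SL\<^esub> gen_star x (gen_star y A) = gen_star (lie_bracket L pl x y) A"
proof -
  have expand: "gen_star b (gen_star a A) =
      (der a A \<cdot> \<sigma> b \<oplus>\<^bsub>SL\<^esub> der b A \<cdot> \<sigma> a \<oplus>\<^bsub>SL\<^esub> A \<cdot> (\<sigma> a \<cdot> \<sigma> b)) \<oplus>\<^bsub>SL\<^esub>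
      (A \<cdot> \<sigma> (a \<star> b) \<oplus>\<^bsub>SL\<^esub> der b (der a A))"
    if [simp]: "a \<in> carrier L" "b \<in> carrier L" for a b
    by (simp add: gen_star_def linear_map_add[OF linear_der] der_step S.U.l_distr S.U.m_assoc S.U.a_ac)
  let ?z = "der x A \<cdot> \<sigma> y \<oplus>\<^bsub>SL\<^esub> der y A \<cdot> \<sigma> x \<oplus>\<^bsub>SL\<^esub> A \<cdot> (\<sigma> x \<cdot> \<sigma> y)"
  have swap: "der y A \<cdot> \<sigma> x \<oplus>\<^bsub>SL\<^esub> der x A \<cdot> \<sigma> y \<oplus>\<^bsub>SL\<^esub> A \<cdot> (\<sigma> y \<cdot> \<sigma> x) = ?z"
    by (simp add: S.U.a_comm sgen_commute[of x y])
  have z: "?z \<in> carrier SL" by simp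
  have "gen_star y (gen_star x A) \<ominus>\<^bsub>SL\<^esub> gen_star x (gen_star y A) =
    (?z \<oplus>\<^bsub>SL\<^esub> (A \<cdot> \<sigma> (x \<star> y) \<oplus>\<^bsub>SL\<^esub> der y (der x A))) \<ominus>\<^bsub>SL\<^esub>
    (?z \<oplus>\<^bsub>SL\<^esub> (A \<cdot> \<sigma> (y \<star> x) \<oplus>\<^bsub>SL\<^esub> der x (der y A)))"
    by (simp only: expand assms swap)
  also have "\<dots> = (A \<cdot> \<sigma> (x \<star> y) \<ominus>\<^bsub>SL\<^esub> A \<cdot> \<sigma> (y \<star> x)) \<oplus>\<^bsub>SL\<^esub> (der y (der x A) \<ominus>\<^bsub>SL\<^esub> der x (der y A))"
    by (rule S.U.common_summand_cancel) simp_all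
  also have "A \<cdot> \<sigma> (x \<star> y) \<ominus>\<^bsub>SL\<^esub> A \<cdot> \<sigma> (y \<star> x) = A \<cdot> \<sigma> (lie_bracket L pl x y)"
    unfolding lie_bracket_def
    by (simp add: linear_map_diff[OF S_module S_module S.U.linear_mult_right]
        linear_map_diff[OF module_axioms S_module S.linear_gen])
  finally show ?thesis by (simp add: der_action gen_star_def)
qed

text \<open>Under the coproduct of \<open>B\<close>, both parts of \<open>gen_star x B\<close>
  distribute over the two Sweedler factors. The terms in the first factor combine by the recursion
  for \<open>circ\<close>, those in the second by the Leibniz rule.\<close>

lemma star_gen_star:
  assumes A [simp]: "A \<in> carrier SL" and B [simp]: "B \<in> carrier SL" and x [simp]: "x \<in> carrier L"
  shows "star A (gen_star x B) = gen_star x (star A B)"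
proof -
  let ?\<beta> = "\<lambda>a b. circ A a \<cdot> b"
  note \<beta> = bilinear_circ_left[OF A]
  have s: "bilinear_map R SL SL SL (\<lambda>a b. ?\<beta> (a \<cdot> \<sigma> x) b \<oplus>\<^bsub>SL\<^esub> ?\<beta> a (b \<cdot> \<sigma> x))"
    by (intro bilinear_map_plus S_module bilinear_map_comp2[OF \<beta>] S.U.linear_mult_left linear_map_ident S.gen_closed x)
  have d: "bilinear_map R SL SL SL (\<lambda>a b. ?\<beta> (der x a) b \<oplus>\<^bsub>SL\<^esub> ?\<beta> a (der x b))"
    by (rule bilinear_der_tens[OF S_module \<beta> x])
  note g = bilinear_map_right[OF bilinear_gen_star x]
  have "star A (gen_star x B) = tensor_lift R SL ?\<beta> (SD (B \<cdot> \<sigma> x)) \<oplus>\<^bsub>SL\<^esub> tensor_lift R SL ?\<beta> (SD (der x B))"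
    by (simp add: star_def gen_star_def linear_map_add[OF S.linear_Delta]
        linear_map_add[OF S.UU.linear_tensor_lift[OF S_module \<beta>]])
  also have "\<dots> = tensor_lift R SL (\<lambda>a b. (?\<beta> (a \<cdot> \<sigma> x) b \<oplus>\<^bsub>SL\<^esub> ?\<beta> a (b \<cdot> \<sigma> x)) \<oplus>\<^bsub>SL\<^esub>
      (?\<beta> (der x a) b \<oplus>\<^bsub>SL\<^esub> ?\<beta> a (der x b))) (SD B)"
    by (simp only: S.Delta_lift_step[OF S_module \<beta> B x] Delta_der_lift[OF S_module \<beta> x B]
        S.UU.tensor_lift_plus[OF S_module s d S.Delta_closed[OF B]])
  also have "\<dots> = tensor_lift R SL (\<lambda>a b. gen_star x (?\<beta> a b)) (SD B)"
  proof (rule S.UU.tensor_lift_cong[OF S_module bilinear_map_comp[OF \<beta> g] _ S.Delta_closed[OF B], symmetric])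
    fix a b assume [simp]: "a \<in> carrier SL" "b \<in> carrier SL"
    \<comment> \<open>The recursion of \<open>circ\<close> read backwards: the two terms with
      \<open>x\<close> inside the second argument add up to the derivative of the whole.\<close>
    have c: "circ A (a \<cdot> \<sigma> x) \<oplus>\<^bsub>SL\<^esub> circ A (der x a) = der x (circ A a)"
      by (simp add: circ_step S.U.minus_add_cancel)
    have "gen_star x (?\<beta> a b) = (circ A (a \<cdot> \<sigma> x) \<oplus>\<^bsub>SL\<^esub> circ A (der x a)) \<cdot> b \<oplus>\<^bsub>SL\<^esub>
      (?\<beta> a (b \<cdot> \<sigma> x) \<oplus>\<^bsub>SL\<^esub> ?\<beta> a (der x b))"
      unfolding c by (simp add: gen_star_def der_mult S.U.m_assoc S.U.a_ac)
    then show "gen_star x (?\<beta> a b) = (?\<beta> (a \<cdot> \<sigma> x) b \<oplus>\<^bsub>SL\<^esub> ?\<beta> a (b \<cdot> \<sigma> x)) \<oplus>\<^bsub>SL\<^esub>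
      (?\<beta> (der x a) b \<oplus>\<^bsub>SL\<^esub> ?\<beta> a (der x b))"
      by (simp add: S.U.l_distr S.U.a_ac)
  qed
  also have "\<dots> = gen_star x (star A B)"
    unfolding star_def
    by (rule S.UU.linear_map_tensor_lift[OF S_module S_module \<beta> g S.Delta_closed[OF B], symmetric])
  finally show ?thesis .
qed

section \<open>The isomorphism\<close>

lemmas E_module = E.U.module_axioms
abbreviation ED where "ED \<equiv> E.Delta"
abbreviation ET where "ET \<equiv> tensor_module R EL EL"

definition phi (\<open>\<phi>\<close>) where
  "\<phi> = (SOME G. linear_map R EL SL G \<and> G \<one>\<^bsub>EL\<^esub> = \<one>\<^bsub>SL\<^esub> \<and>
    (\<forall>u\<in>carrier EL. \<forall>x\<in>carrier L. G (u \<otimes>\<^bsub>EL\<^esub> \<upsilon> x) = gen_star x (G u)))"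

definition psi (\<open>\<psi>\<close>) where
  "\<psi> = (SOME F. linear_map R SL EL F \<and> F \<one>\<^bsub>SL\<^esub> = \<one>\<^bsub>EL\<^esub> \<and>
    (\<forall>u\<in>carrier SL. \<forall>x\<in>carrier L. F (u \<cdot> \<sigma> x) = F u \<otimes>\<^bsub>EL\<^esub> \<upsilon> x \<ominus>\<^bsub>EL\<^esub> F (der x u)))"

lemma linear_phi: "linear_map R EL SL \<phi>"
  and phi_one: "\<phi> \<one>\<^bsub>EL\<^esub> = \<one>\<^bsub>SL\<^esub>"
  and phi_step: "\<lbrakk>u \<in> carrier EL; x \<in> carrier L\<rbrakk> \<Longrightarrow> \<phi> (u \<otimes>\<^bsub>EL\<^esub> \<upsilon> x) = gen_star x (\<phi> u)"
proof -
  have "\<exists>G. linear_map R EL SL G \<and> G \<one>\<^bsub>EL\<^esub> = \<one>\<^bsub>SL\<^esub> \<and>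
    (\<forall>u\<in>carrier EL. \<forall>x\<in>carrier L. G (u \<otimes>\<^bsub>EL\<^esub> \<upsilon> x) = gen_star x (G u))"
    by (rule E.U_rec[OF S_module S.U.one_closed bilinear_gen_star gen_star_action]) blast+
  from someI_ex[OF this] show "linear_map R EL SL \<phi>" "\<phi> \<one>\<^bsub>EL\<^esub> = \<one>\<^bsub>SL\<^esub>"
    "\<lbrakk>u \<in> carrier EL; x \<in> carrier L\<rbrakk> \<Longrightarrow> \<phi> (u \<otimes>\<^bsub>EL\<^esub> \<upsilon> x) = gen_star x (\<phi> u)"
    unfolding phi_def by blast+
qed

lemma linear_psi: "linear_map R SL EL \<psi>"
  and psi_one: "\<psi> \<one>\<^bsub>SL\<^esub> = \<one>\<^bsub>EL\<^esub>"
  and psi_step: "\<lbrakk>u \<in> carrier SL; x \<in> carrier L\<rbrakk>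
    \<Longrightarrow> \<psi> (u \<cdot> \<sigma> x) = \<psi> u \<otimes>\<^bsub>EL\<^esub> \<upsilon> x \<ominus>\<^bsub>EL\<^esub> \<psi> (der x u)"
proof -
  have "\<exists>F. linear_map R SL EL F \<and> F \<one>\<^bsub>SL\<^esub> = \<one>\<^bsub>EL\<^esub> \<and>
    (\<forall>u\<in>carrier SL. \<forall>x\<in>carrier L. F (u \<cdot> \<sigma> x) = F u \<otimes>\<^bsub>EL\<^esub> \<upsilon> x \<ominus>\<^bsub>EL\<^esub> F (der x u))"
  proof (rule der_rec[OF E_module E.U.one_closed, of "\<lambda>x u. u \<otimes>\<^bsub>EL\<^esub> \<upsilon> x"])
    show "bilinear_map R L EL EL (\<lambda>x u. u \<otimes>\<^bsub>EL\<^esub> \<upsilon> x)"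
      by (rule bilinear_mapI)
        (auto intro: E.U.linear_mult_left linear_map_comp[OF E.linear_gen E.U.linear_mult_right])
    show "u \<otimes>\<^bsub>EL\<^esub> \<upsilon> x \<otimes>\<^bsub>EL\<^esub> \<upsilon> y \<ominus>\<^bsub>EL\<^esub> u \<otimes>\<^bsub>EL\<^esub> \<upsilon> y \<otimes>\<^bsub>EL\<^esub> \<upsilon> x = u \<otimes>\<^bsub>EL\<^esub> \<upsilon> (lie_bracket L pl x y)"
      if "x \<in> carrier L" "y \<in> carrier L" "u \<in> carrier EL" for x y u
      using that by (simp add: E.U.m_assoc linear_map_diff[OF E_module E_module E.U.linear_mult_right] flip: E.gen_commutator)
  qed
  from someI_ex[OF this] show "linear_map R SL EL \<psi>" "\<psi> \<one>\<^bsub>SL\<^esub> = \<one>\<^bsub>EL\<^esub>"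
    "\<lbrakk>u \<in> carrier SL; x \<in> carrier L\<rbrakk> \<Longrightarrow> \<psi> (u \<cdot> \<sigma> x) = \<psi> u \<otimes>\<^bsub>EL\<^esub> \<upsilon> x \<ominus>\<^bsub>EL\<^esub> \<psi> (der x u)"
    unfolding psi_def by blast+
qed

lemma phi_closed [simp]: "u \<in> carrier EL \<Longrightarrow> \<phi> u \<in> carrier SL"
  by (rule linear_map_closed[OF linear_phi])

lemma psi_closed [simp]: "u \<in> carrier SL \<Longrightarrow> \<psi> u \<in> carrier EL"
  by (rule linear_map_closed[OF linear_psi])

text \<open>The derivative that the recursion of \<open>\<phi>\<close> adds is the one that the
  recursion of \<open>\<psi>\<close> subtracts.\<close>

lemma psi_phi:
  assumes u: "u \<in> carrier EL"
  shows "\<psi> (\<phi> u) = u"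
proof (rule E.U_ext[OF E_module linear_map_comp[OF linear_phi linear_psi] linear_map_ident _ _ u])
  fix u x assume "u \<in> carrier EL" "x \<in> carrier L" "\<psi> (\<phi> u) = u"
  then show "\<psi> (\<phi> (u \<otimes>\<^bsub>EL\<^esub> \<upsilon> x)) = u \<otimes>\<^bsub>EL\<^esub> \<upsilon> x"
    by (simp add: phi_step gen_star_def linear_map_add[OF linear_psi] psi_step E.U.minus_add_cancel)
qed (simp add: phi_one psi_one)

text \<open>Both sides solve the recursion with \<open>gen_star\<close> as action:
  \<open>u x\<close> is \<open>gen_star x u\<close> minus the derivative of \<open>u\<close>. Plain
  induction along generators does not suffice, since the recursion of \<open>\<psi>\<close> involves
  \<open>der x u\<close> besides \<open>u\<close>.\<close>

lemma phi_psi: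
  assumes u: "u \<in> carrier SL"
  shows "\<phi> (\<psi> u) = u"
proof (rule der_rec_unique[where \<rho> = gen_star, OF S_module linear_map_comp[OF linear_psi linear_phi] linear_map_ident _ _ _ u])
  fix u x assume [simp]: "u \<in> carrier SL" "x \<in> carrier L"
  show "\<phi> (\<psi> (u \<cdot> \<sigma> x)) = gen_star x (\<phi> (\<psi> u)) \<ominus>\<^bsub>SL\<^esub> \<phi> (\<psi> (der x u))"
    by (simp add: psi_step linear_map_diff[OF E_module S_module linear_phi] phi_step)
  show "u \<cdot> \<sigma> x = gen_star x u \<ominus>\<^bsub>SL\<^esub> der x u"
    by (simp add: gen_star_def S.U.minus_eq S.U.a_assoc S.U.r_neg)
qed (simp add: phi_one psi_one)

lemma phi_mult:
  assumes u [simp]: "u \<in> carrier EL" and v: "v \<in> carrier EL"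
  shows "\<phi> (u \<otimes>\<^bsub>EL\<^esub> v) = star (\<phi> u) (\<phi> v)"
proof (rule E.U_ext[OF S_module linear_map_comp[OF E.U.linear_mult_right[OF u] linear_phi]
      linear_map_comp[OF linear_phi bilinear_map_right[OF bilinear_star]] _ _ v])
  fix v x assume [simp]: "v \<in> carrier EL" "x \<in> carrier L" and IH: "\<phi> (u \<otimes>\<^bsub>EL\<^esub> v) = star (\<phi> u) (\<phi> v)"
  have "\<phi> (u \<otimes>\<^bsub>EL\<^esub> v \<otimes>\<^bsub>EL\<^esub> \<upsilon> x) = star (\<phi> u) (\<phi> (v \<otimes>\<^bsub>EL\<^esub> \<upsilon> x))"
    by (simp add: phi_step IH star_gen_star)
  then show "\<phi> (u \<otimes>\<^bsub>EL\<^esub> (v \<otimes>\<^bsub>EL\<^esub> \<upsilon> x)) = star (\<phi> u) (\<phi> (v \<otimes>\<^bsub>EL\<^esub> \<upsilon> x))"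
    by (simp add: E.U.m_assoc)
qed (simp_all add: phi_one star_one)

lemma bilinear_phi_tens: "bilinear_map R EL EL ST (\<lambda>a b. \<phi> a \<boxtimes> \<phi> b)"
  by (rule bilinear_map_comp2[OF S.UU.bilinear_tensor linear_phi linear_phi])

text \<open>Both parts of \<open>gen_star x\<close>, multiplication by \<open>\<sigma> x\<close> and
  \<open>der x\<close>, distribute over the factors of the coproduct. So \<open>gen_star x\<close>
  behaves like right multiplication by a primitive element, and the two sides follow the same
  recursion in \<open>u\<close>.\<close>

lemma Delta_phi:
  assumes u: "u \<in> carrier EL"
  shows "SD (\<phi> u) = tensor_lift R ST (\<lambda>a b. \<phi> a \<boxtimes> \<phi> b) (ED u)"
proof -
  note T = S.UU.T.module_axioms
  have sp: "bilinear_map R SL SL ST (\<lambda>a b. (a \<cdot> \<sigma> x) \<boxtimes> b \<oplus>\<^bsub>ST\<^esub> a \<boxtimes> (b \<cdot> \<sigma> x))" if "x \<in> carrier L" for x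
    using that by (intro bilinear_map_plus T bilinear_map_comp2[OF S.UU.bilinear_tensor] S.U.linear_mult_left linear_map_ident S.gen_closed)
  have g: "bilinear_map R SL SL ST (\<lambda>a b. gen_star x a \<boxtimes> b \<oplus>\<^bsub>ST\<^esub> a \<boxtimes> gen_star x b)" if "x \<in> carrier L" for x
    using that by (intro bilinear_map_plus T bilinear_map_comp2[OF S.UU.bilinear_tensor] linear_map_ident bilinear_map_right[OF bilinear_gen_star])
  have gen: "SD (gen_star x A) = tensor_lift R ST (\<lambda>a b. gen_star x a \<boxtimes> b \<oplus>\<^bsub>ST\<^esub> a \<boxtimes> gen_star x b) (SD A)"
    if A [simp]: "A \<in> carrier SL" and x [simp]: "x \<in> carrier L" for A x
  proof -
    have "SD (gen_star x A) = tensor_lift R ST (\<boxtimes>) (SD (A \<cdot> \<sigma> x)) \<oplus>\<^bsub>ST\<^esub> tensor_lift R ST (\<boxtimes>) (SD (der x A))"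
      by (simp add: gen_star_def linear_map_add[OF S.linear_Delta] S.UU.tensor_lift_self)
    also have "\<dots> = tensor_lift R ST (\<lambda>a b. ((a \<cdot> \<sigma> x) \<boxtimes> b \<oplus>\<^bsub>ST\<^esub> a \<boxtimes> (b \<cdot> \<sigma> x)) \<oplus>\<^bsub>ST\<^esub>
      (der x a \<boxtimes> b \<oplus>\<^bsub>ST\<^esub> a \<boxtimes> der x b)) (SD A)"
      by (simp only: S.Delta_lift_step[OF T S.UU.bilinear_tensor A x] Delta_der_lift[OF T S.UU.bilinear_tensor x A]
          S.UU.tensor_lift_plus[OF T sp[OF x] bilinear_der_tens[OF T S.UU.bilinear_tensor x] S.Delta_closed[OF A]])
    also have "\<dots> = tensor_lift R ST (\<lambda>a b. gen_star x a \<boxtimes> b \<oplus>\<^bsub>ST\<^esub> a \<boxtimes> gen_star x b) (SD A)"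
      by (rule S.UU.tensor_lift_cong[OF T g[OF x] _ S.Delta_closed[OF A], symmetric])
        (simp add: gen_star_def linear_map_add[OF S.UU.linear_tensor_left] linear_map_add[OF S.UU.linear_tensor_right] S.UU.T.M.a_ac)
    finally show ?thesis .
  qed
  show ?thesis
  proof (rule E.Delta_lift_eqI[OF T bilinear_phi_tens linear_map_comp[OF linear_phi S.linear_Delta]
        S.UU.linear_tensor_lift[OF T g] _ _ _ u, symmetric])
    show "\<phi> \<one>\<^bsub>EL\<^esub> \<boxtimes> \<phi> \<one>\<^bsub>EL\<^esub> = SD (\<phi> \<one>\<^bsub>EL\<^esub>)"
      by (simp add: phi_one S.Delta_one)
  qed (simp_all add: phi_step gen S.UU.tensor_lift_tensor[OF T g])
qed

lemma Eps_phi: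
  assumes u: "u \<in> carrier EL"
  shows "S.Eps (\<phi> u) = E.Eps u"
proof -
  interpret B: assoc_algebra R "base_algebra R" by (rule R.assoc_algebra_base)
  have a: "add (base_algebra R) = add R" by (simp add: base_algebra_def)
  show ?thesis
    by (rule E.U_ext[OF B.module_axioms linear_map_comp[OF linear_phi S.linear_Eps] E.linear_Eps _ _ u])
      (simp_all add: phi_one S.Eps_one E.Eps_one phi_step E.Eps_step gen_star_def
        linear_map_add[OF S.linear_Eps] S.Eps_step Eps_der a)
qed

text \<open>The algebra under \<open>pre_lie_hopf\<close> as a plain algebra record. The facts about
  tensor products of algebras apply to it, while it shares its module structure, and hence its
  tensor square as a module, with \<open>SL\<close>.\<close>

definition PS where "PS = SL\<lparr>mult := mult (pre_lie_hopf R L pl)\<rparr>"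

lemma PS_simps [simp]:
  "carrier PS = carrier SL" "zero PS = zero SL" "add PS = add SL" "smult PS = smult SL" "one PS = one SL"
  by (simp_all add: PS_def)

lemma linear_PS [simp]:
  "linear_map R PS M f \<longleftrightarrow> linear_map R SL M f" "linear_map R N PS g \<longleftrightarrow> linear_map R N SL g"
  by (simp_all add: linear_map_def)

lemma tensor_PS: "tensor_module R PS PS = ST" "tensor R PS PS = (\<boxtimes>)"
  by (rule tensor_module_cong; simp)+

lemma tensor_lift_PS: "tensor_lift R PS = tensor_lift R SL"
  by (rule ext, rule tensor_lift_struct_cong) simp_all

lemma pre_lie_hopf_simps:
  "carrier (pre_lie_hopf R L pl) = carrier PS" "zero (pre_lie_hopf R L pl) = zero PS"
  "add (pre_lie_hopf R L pl) = add PS" "smult (pre_lie_hopf R L pl) = smult PS"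
  "mult (pre_lie_hopf R L pl) = mult PS" "one (pre_lie_hopf R L pl) = one PS"
  "comult (pre_lie_hopf R L pl) = SD" "counit (pre_lie_hopf R L pl) = S.Eps"
  by (simp_all add: PS_def pre_lie_hopf_def Let_def symmetric_hopf_eq S.primitive_hopf_simps)

text \<open>The chosen extension is known on the carrier, where it is \<open>circ\<close>; the
  replacement takes place under the Sweedler sum.\<close>

lemma mult_PS:
  assumes A: "A \<in> carrier SL" and B: "B \<in> carrier SL"
  shows "A \<otimes>\<^bsub>PS\<^esub> B = star A B"
proof -
  have lift: "tensor_lift R (primitive_hopf R L SL \<sigma>) \<beta> = tensor_lift R SL \<beta>" for \<beta> :: "_ \<Rightarrow> _ \<Rightarrow> ('c list \<Rightarrow> 'a) set set"
    by (rule tensor_lift_struct_cong; simp add: S.primitive_hopf_simps)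
  have "A \<otimes>\<^bsub>PS\<^esub> B = tensor_lift R SL (\<lambda>a b. pl_extension R L pl A a \<cdot> b) (SD B)"
    by (simp add: PS_def pre_lie_hopf_def Let_def symmetric_hopf_eq lift S.primitive_hopf_simps)
  also have "\<dots> = star A B"
    unfolding star_def
    by (rule S.UU.tensor_lift_cong[OF S_module bilinear_circ_left[OF A] _ S.Delta_closed[OF B], symmetric])
      (simp add: pl_extension_eq A)
  finally show ?thesis .
qed

section \<open>Transport of the Hopf structure along \<phi>\<close>

lemma phi_surj: "A \<in> carrier SL \<Longrightarrow> \<exists>u\<in>carrier EL. A = \<phi> u"
  by (intro bexI[of _ "\<psi> A"]) (simp_all add: phi_psi)

lemma bilinear_mult_PS: "bilinear_map R SL SL SL (mult PS)"
proof (rule bilinear_mapI)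
  show "linear_map R SL SL (mult PS A)" if "A \<in> carrier SL" for A
    by (rule linear_map_cong[OF bilinear_map_right[OF bilinear_star that] S_module]) (rule mult_PS[OF that, symmetric])
  show "linear_map R SL SL (\<lambda>A. A \<otimes>\<^bsub>PS\<^esub> B)" if "B \<in> carrier SL" for B
    by (rule linear_map_cong[OF bilinear_map_left[OF bilinear_star that] S_module]) (rule mult_PS[OF _ that, symmetric])
qed

lemma mult_PS_phi: "\<lbrakk>u \<in> carrier EL; v \<in> carrier EL\<rbrakk> \<Longrightarrow> \<phi> u \<otimes>\<^bsub>PS\<^esub> \<phi> v = \<phi> (u \<otimes>\<^bsub>EL\<^esub> v)"
  by (simp add: mult_PS phi_mult)

lemma assoc_algebra_PS: "assoc_algebra R PS"
proof (rule assoc_algebraI)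
  show "module R PS" by (rule module_cong[OF S_module]) simp_all
  show "bilinear_map R PS PS PS (mult PS)"
    using bilinear_mult_PS by (simp add: bilinear_map_def)
  show "A \<otimes>\<^bsub>PS\<^esub> B \<otimes>\<^bsub>PS\<^esub> C = A \<otimes>\<^bsub>PS\<^esub> (B \<otimes>\<^bsub>PS\<^esub> C)"
    if ABC: "A \<in> carrier PS" "B \<in> carrier PS" "C \<in> carrier PS" for A B C
  proof -
    obtain u v w where "u \<in> carrier EL" "v \<in> carrier EL" "w \<in> carrier EL" "A = \<phi> u" "B = \<phi> v" "C = \<phi> w"
      using phi_surj[OF ABC(1)[unfolded PS_simps]] phi_surj[OF ABC(2)[unfolded PS_simps]]
        phi_surj[OF ABC(3)[unfolded PS_simps]] by blast
    then show ?thesis by (simp add: mult_PS_phi E.U.m_assoc)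
  qed
  show "\<one>\<^bsub>PS\<^esub> \<otimes>\<^bsub>PS\<^esub> A = A" if A: "A \<in> carrier PS" for A
  proof -
    obtain u where u: "u \<in> carrier EL" "A = \<phi> u"
      using phi_surj[OF A[unfolded PS_simps]] by blast
    then show ?thesis using mult_PS_phi[of "\<one>\<^bsub>EL\<^esub>" u] by (simp add: phi_one)
  qed
  show "A \<otimes>\<^bsub>PS\<^esub> \<one>\<^bsub>PS\<^esub> = A" if "A \<in> carrier PS" for A
    using that by (simp add: mult_PS star_one)
qed simp

sublocale PP: tensor_alg R PS PS
  by (intro tensor_alg.intro assoc_algebra_PS)

text \<open>\<open>\<phi> \<otimes> \<phi>\<close>, here \<open>?\<Phi>\<close>, is multiplicative
  from the tensor square of \<open>EL\<close> to that of \<open>PS\<close>. Since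
  \<open>\<phi>\<close> is onto and respects the coproducts, multiplicativity of the coproduct
  carries over from \<open>EL\<close>.\<close>

lemma alg_hom_Delta_PS: "alg_hom R PS (tensor_product_algebra R PS PS) SD"
proof -
  note T = S.UU.T.module_axioms
  let ?TA = "tensor_product_algebra R PS PS"
  let ?\<Phi> = "tensor_lift R ST (\<lambda>a b. \<phi> a \<boxtimes> \<phi> b)"
  note lin = E.UU.linear_tensor_lift[OF T bilinear_phi_tens]
  note pure = E.UU.tensor_lift_tensor[OF T bilinear_phi_tens]
  note L = PP.linear_TA_left[unfolded tensor_PS] and R = PP.linear_TA_right[unfolded tensor_PS]
  note closed = linear_map_closed[OF lin]
  have 1: "?\<Phi> (tensor R EL EL a b \<otimes>\<^bsub>E.UU.TA\<^esub> t) = (\<phi> a \<boxtimes> \<phi> b) \<otimes>\<^bsub>?TA\<^esub> ?\<Phi> t"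
    if a [simp]: "a \<in> carrier EL" and b [simp]: "b \<in> carrier EL" and t: "t \<in> carrier ET" for a b t
  proof (rule E.UU.tensor_ext[OF T linear_map_comp[OF E.UU.linear_TA_right lin] linear_map_comp[OF lin R] _ t])
    fix c d assume [simp]: "c \<in> carrier EL" "d \<in> carrier EL"
    show "?\<Phi> (tensor R EL EL a b \<otimes>\<^bsub>E.UU.TA\<^esub> tensor R EL EL c d) = (\<phi> a \<boxtimes> \<phi> b) \<otimes>\<^bsub>?TA\<^esub> ?\<Phi> (tensor R EL EL c d)"
      by (simp add: E.UU.mult_tens pure PP.mult_tens[unfolded tensor_PS PS_simps] mult_PS_phi)
  qed simp_all
  have 2: "?\<Phi> (s \<otimes>\<^bsub>E.UU.TA\<^esub> t) = ?\<Phi> s \<otimes>\<^bsub>?TA\<^esub> ?\<Phi> t" if s: "s \<in> carrier ET" and t: "t \<in> carrier ET" for s t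
    by (rule E.UU.tensor_ext[OF T linear_map_comp[OF E.UU.linear_TA_left[OF t] lin] linear_map_comp[OF lin L[OF closed[OF t]]] _ s])
      (simp add: 1 pure t)
  have mult: "SD (A \<otimes>\<^bsub>PS\<^esub> B) = SD A \<otimes>\<^bsub>?TA\<^esub> SD B" if AB: "A \<in> carrier SL" "B \<in> carrier SL" for A B
  proof -
    obtain u v where "u \<in> carrier EL" "v \<in> carrier EL" "A = \<phi> u" "B = \<phi> v"
      using phi_surj[OF AB(1)] phi_surj[OF AB(2)] by blast
    then show ?thesis by (simp add: mult_PS_phi Delta_phi E.Delta_mult 2)
  qed
  show ?thesis
    unfolding alg_hom_def
  proof
    show "SD \<in> ring_hom PS ?TA"
      by (rule ring_hom_memI)
        (simp_all add: mult PP.TA_simps tensor_PS linear_map_add[OF S.linear_Delta] S.Delta_one)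
    show "linear_map R PS ?TA SD"
      using S.linear_Delta by (simp add: tensor_PS)
  qed
qed

lemma alg_hom_Eps_PS: "alg_hom R PS (base_algebra R) S.Eps"
proof -
  have mult: "S.Eps (A \<otimes>\<^bsub>PS\<^esub> B) = S.Eps A \<otimes>\<^bsub>base_algebra R\<^esub> S.Eps B" if AB: "A \<in> carrier SL" "B \<in> carrier SL" for A B
  proof -
    obtain u v where "u \<in> carrier EL" "v \<in> carrier EL" "A = \<phi> u" "B = \<phi> v"
      using phi_surj[OF AB(1)] phi_surj[OF AB(2)] by blast
    then show ?thesis
      using E.alg_hom_Eps by (simp add: mult_PS_phi Eps_phi alg_hom_def ring_hom_def)
  qed
  show ?thesis
    unfolding alg_hom_def
    using S.alg_hom_Eps by (auto intro!: ring_hom_memI simp: alg_hom_def ring_hom_def mult)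
qed

lemma antipode_PS:
  obtains S where "linear_map R SL SL S"
    "\<And>x. x \<in> carrier SL \<Longrightarrow> tensor_lift R SL (\<lambda>a b. S a \<otimes>\<^bsub>PS\<^esub> b) (SD x) = S.Eps x \<odot>\<^bsub>SL\<^esub> \<one>\<^bsub>SL\<^esub>"
    "\<And>x. x \<in> carrier SL \<Longrightarrow> tensor_lift R SL (\<lambda>a b. a \<otimes>\<^bsub>PS\<^esub> S b) (SD x) = S.Eps x \<odot>\<^bsub>SL\<^esub> \<one>\<^bsub>SL\<^esub>"
proof -
  obtain A where A: "linear_map R EL EL A"
    and left: "\<And>u. u \<in> carrier EL \<Longrightarrow> tensor_lift R EL (\<lambda>a b. A a \<otimes>\<^bsub>EL\<^esub> b) (ED u) = E.Eps u \<odot>\<^bsub>EL\<^esub> \<one>\<^bsub>EL\<^esub>"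
    and right: "\<And>u. u \<in> carrier EL \<Longrightarrow> tensor_lift R EL (\<lambda>a b. a \<otimes>\<^bsub>EL\<^esub> A b) (ED u) = E.Eps u \<odot>\<^bsub>EL\<^esub> \<one>\<^bsub>EL\<^esub>"
    using E.antipode_U by blast
  note [simp] = linear_map_closed[OF A]
  \<comment> \<open>The antipode of \<open>EL\<close>, conjugated by the isomorphism.\<close>
  define S where "S x = \<phi> (A (\<psi> x))" for x
  have S: "linear_map R SL SL S"
    unfolding S_def by (rule linear_map_comp[OF linear_map_comp[OF linear_psi A] linear_phi])
  have S_phi: "S (\<phi> u) = \<phi> (A u)" if "u \<in> carrier EL" for u
    using that by (simp add: S_def psi_phi)
  \<comment> \<open>One argument for both antipode laws: a convolution identity in \<open>EL\<close>
    is carried along \<open>\<phi>\<close> to the one for \<open>\<beta>\<close> on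
    \<open>SL\<close>.\<close>
  have transfer: "tensor_lift R SL \<beta> (SD x) = S.Eps x \<odot>\<^bsub>SL\<^esub> \<one>\<^bsub>SL\<^esub>"
    if \<beta>: "bilinear_map R SL SL SL \<beta>" and \<gamma>: "bilinear_map R EL EL EL \<gamma>"
      and \<gamma>_conv: "\<And>u. u \<in> carrier EL \<Longrightarrow> tensor_lift R EL \<gamma> (ED u) = E.Eps u \<odot>\<^bsub>EL\<^esub> \<one>\<^bsub>EL\<^esub>"
      and \<beta>\<gamma>: "\<And>a b. \<lbrakk>a \<in> carrier EL; b \<in> carrier EL\<rbrakk> \<Longrightarrow> \<beta> (\<phi> a) (\<phi> b) = \<phi> (\<gamma> a b)" and x: "x \<in> carrier SL" for \<beta> \<gamma> x
  proof -
    obtain u where u: "u \<in> carrier EL" and x_eq: "x = \<phi> u" using phi_surj[OF x] by blast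
    have "tensor_lift R SL \<beta> (SD x) = tensor_lift R SL (\<lambda>a b. \<beta> (\<phi> a) (\<phi> b)) (ED u)"
      unfolding x_eq Delta_phi[OF u]
      by (rule E.UU.tensor_lift_map[OF S_module S_module S_module linear_phi linear_phi \<beta> E.Delta_closed[OF u]])
    also have "\<dots> = tensor_lift R SL (\<lambda>a b. \<phi> (\<gamma> a b)) (ED u)"
      by (rule E.UU.tensor_lift_cong[OF S_module bilinear_map_comp2[OF \<beta> linear_phi linear_phi] \<beta>\<gamma> E.Delta_closed[OF u]])
    also have "\<dots> = \<phi> (tensor_lift R EL \<gamma> (ED u))"
      by (rule E.UU.linear_map_tensor_lift[OF E_module S_module \<gamma> linear_phi E.Delta_closed[OF u], symmetric])
    also have "\<dots> = S.Eps x \<odot>\<^bsub>SL\<^esub> \<one>\<^bsub>SL\<^esub>"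
      using u by (simp add: \<gamma>_conv linear_map_smult[OF linear_phi] phi_one x_eq Eps_phi)
    finally show ?thesis .
  qed
  show thesis
  proof (rule that[OF S])
    show "tensor_lift R SL (\<lambda>a b. S a \<otimes>\<^bsub>PS\<^esub> b) (SD x) = S.Eps x \<odot>\<^bsub>SL\<^esub> \<one>\<^bsub>SL\<^esub>" if "x \<in> carrier SL" for x
      by (rule transfer[OF bilinear_map_comp2[OF bilinear_mult_PS S linear_map_ident]
            bilinear_map_comp2[OF E.U.bilinear_mult A linear_map_ident] left _ that])
        (simp_all add: S_phi mult_PS_phi)
    show "tensor_lift R SL (\<lambda>a b. a \<otimes>\<^bsub>PS\<^esub> S b) (SD x) = S.Eps x \<odot>\<^bsub>SL\<^esub> \<one>\<^bsub>SL\<^esub>" if "x \<in> carrier SL" for x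
      by (rule transfer[OF bilinear_map_comp2[OF bilinear_mult_PS linear_map_ident S]
            bilinear_map_comp2[OF E.U.bilinear_mult linear_map_ident A] right _ that])
        (simp_all add: S_phi mult_PS_phi)
  qed
qed

lemma hopf_algebra_pre_lie: "hopf_algebra R (pre_lie_hopf R L pl)"
proof -
  obtain S where S: "linear_map R SL SL S"
    "\<And>x. x \<in> carrier SL \<Longrightarrow> tensor_lift R SL (\<lambda>a b. S a \<otimes>\<^bsub>PS\<^esub> b) (SD x) = S.Eps x \<odot>\<^bsub>SL\<^esub> \<one>\<^bsub>SL\<^esub>"
    "\<And>x. x \<in> carrier SL \<Longrightarrow> tensor_lift R SL (\<lambda>a b. a \<otimes>\<^bsub>PS\<^esub> S b) (SD x) = S.Eps x \<odot>\<^bsub>SL\<^esub> \<one>\<^bsub>SL\<^esub>"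
    using antipode_PS by blast
  have T3: "tensor_module R ST PS = tensor_module R ST SL" "tensor R ST PS = tensor R ST SL"
    by (rule tensor_module_cong; simp)+
  \<comment> \<open>Coproduct and counit are those of the symmetric Hopf algebra, so coassociativity
    and the counit laws are taken over from it. The new product enters only through the morphism
    properties and the antipode.\<close>
  show ?thesis
    by (rule hopf_algebraI[OF assoc_algebra_PS pre_lie_hopf_simps(1-6), where S = S,
          unfolded pre_lie_hopf_simps(7,8) tensor_PS T3 tensor_lift_PS linear_PS PS_simps,
          OF alg_hom_Delta_PS alg_hom_Eps_PS S.coassoc_U S.counit_left_U S.counit_right_U S])
qed

lemma enveloping_hopf_eq: "enveloping_hopf R L (lie_bracket L pl) = primitive_hopf R L EL \<upsilon>"
  by (simp add: enveloping_hopf_def)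

lemma hopf_iso_psi: "hopf_iso R (pre_lie_hopf R L pl) (enveloping_hopf R L (lie_bracket L pl)) \<psi>"
proof -
  let ?K = "primitive_hopf R L EL \<upsilon>"
  note K = E.primitive_hopf_simps
  have T: "tensor_module R ?K ?K = ET" "tensor R ?K ?K = tensor R EL EL"
    by (rule tensor_module_cong; simp add: K)+
  have mult: "\<psi> (A \<otimes>\<^bsub>PS\<^esub> B) = \<psi> A \<otimes>\<^bsub>EL\<^esub> \<psi> B" if AB: "A \<in> carrier SL" "B \<in> carrier SL" for A B
  proof -
    obtain u v where "u \<in> carrier EL" "v \<in> carrier EL" "A = \<phi> u" "B = \<phi> v"
      using phi_surj[OF AB(1)] phi_surj[OF AB(2)] by blast
    then show ?thesis by (simp add: mult_PS_phi psi_phi)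
  qed
  have hom: "alg_hom R (pre_lie_hopf R L pl) ?K \<psi>"
    unfolding alg_hom_def
  proof
    show "\<psi> \<in> ring_hom (pre_lie_hopf R L pl) ?K"
      by (rule ring_hom_memI) (simp_all add: pre_lie_hopf_simps K mult linear_map_add[OF linear_psi] psi_one)
    show "linear_map R (pre_lie_hopf R L pl) ?K \<psi>"
      using linear_psi by (simp add: linear_map_def pre_lie_hopf_simps K)
  qed
  have bij: "bij_betw \<psi> (carrier SL) (carrier EL)"
    by (rule bij_betw_byWitness[where f' = \<phi>]) (auto simp: psi_phi phi_psi)
  \<comment> \<open>Compatibility of \<open>\<phi>\<close> with the coproducts, read backwards by
    writing \<open>x\<close> as an image under \<open>\<phi>\<close>.\<close>
  have comult: "ED (\<psi> x) = tensor_lift R ET (\<lambda>a b. tensor R EL EL (\<psi> a) (\<psi> b)) (SD x)" if x_closed: "x \<in> carrier SL" for x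
  proof -
    obtain u where u: "u \<in> carrier EL" and x: "x = \<phi> u" using phi_surj[OF x_closed] by blast
    note t = E.UU.T.module_axioms
    have b: "bilinear_map R SL SL ET (\<lambda>a b. tensor R EL EL (\<psi> a) (\<psi> b))"
      by (rule bilinear_map_comp2[OF E.UU.bilinear_tensor linear_psi linear_psi])
    have "tensor_lift R ET (\<lambda>a b. tensor R EL EL (\<psi> a) (\<psi> b)) (SD x) =
      tensor_lift R ET (\<lambda>a b. tensor R EL EL (\<psi> (\<phi> a)) (\<psi> (\<phi> b))) (ED u)"
      unfolding x Delta_phi[OF u]
      by (rule E.UU.tensor_lift_map[OF S_module S_module t linear_phi linear_phi b E.Delta_closed[OF u]])
    also have "\<dots> = tensor_lift R ET (tensor R EL EL) (ED u)"
      by (rule E.UU.tensor_lift_cong[OF t bilinear_map_comp2[OF b linear_phi linear_phi] _ E.Delta_closed[OF u]])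
        (simp add: psi_phi)
    also have "\<dots> = ED u" by (rule E.UU.tensor_lift_self[OF E.Delta_closed[OF u]])
    finally show ?thesis using u by (simp add: x psi_phi)
  qed
  have counit: "E.Eps (\<psi> x) = S.Eps x" if "x \<in> carrier SL" for x
    using Eps_phi[of "\<psi> x"] that by (simp add: phi_psi)
  show ?thesis
    unfolding hopf_iso_def enveloping_hopf_eq T
    using hom bij comult counit by (simp add: pre_lie_hopf_simps K)
qed

end

theorem theorem2p12:
  fixes R :: "('r, 'm) ring_scheme"
    and L :: "('r, 'a, 'n) module_scheme"
    and pl :: "'a \<Rightarrow> 'a \<Rightarrow> 'a"
  assumes "pre_lie_algebra R L pl"
  shows "hopf_isomorphic R (pre_lie_hopf R L pl) (enveloping_hopf R L (lie_bracket L pl))"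
proof -
  interpret pre_lie_algebra R L pl by (rule assms)
  show ?thesis
    unfolding hopf_isomorphic_def
    using hopf_algebra_pre_lie E.hopf_algebra_primitive hopf_iso_psi by (auto simp: enveloping_hopf_eq)
qed

end
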